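(* Let $\alpha$ be an admissible anisotropy, $s>0$, $\beta\in\mathbb R$ and $f\in\mathcal S'(\mathbb R^2)$. The following are equivalent: (i) $f\in B^{s,\alpha}_{2,2,|\log|^\beta}(\mathbb R^2)$; (ii) $\displaystyle\sum_{j\ge0}j^{-2\beta}2^{2js}\sum_{(j_1,j_2)\in\Gamma_j(\alpha)}\|\phi_{j_1,j_2}\hat f\|_{L^2}^2=\sum_{j\ge0}j^{-2\beta}2^{2js}\sum_{(j_1,j_2)\in\Gamma_j(\alpha)}\|\Delta_{j_1,j_2}f\|_{L^2}^2<+\infty.$
   Context: $\mathbb N=\{0,1,2,\dots\}$, $[x]$ integer part; $j^\gamma$ at $j=0$ read as $1$. Admissible anisotropy: $\alpha_i\ge0$, $\alpha_1+\alpha_2=2$; $t^\alpha\xi=(t^{\alpha_1}\xi_1,t^{\alpha_2}\xi_2)$. Anisotropic Besov spaces: $\varphi_0^\alpha\in\mathcal S(\mathbb R^2)$, $\varphi_0^\alpha\ge0$, $\varphi_0^\alpha(\xi)=1$ if $\max_i|\xi_i|\le1$, $=0$ if $\max_i2^{-\alpha_i}|\xi_i|\ge1$; $\varphi_j^\alpha(\xi)=\varphi_0^\alpha(2^{-j\alpha}\xi)-\varphi_0^\alpha(2^{-(j-1)\alpha}\xi)$ ($j\ge1$); $\Delta_j^\alpha f=\mathcal F^{-1}(\varphi_j^\alpha\hat f)$; $B^{s,\alpha}_{2,2,|\log|^\beta}(\mathbb R^2)=\{f\in\mathcal S':\sum_{j\ge0}j^{-2\beta}2^{2js}\|\Delta_j^\alpha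 f\|_{L^2}^2<\infty\}$. Hyperbolic Littlewood–Paley: $\theta_0\in\mathcal S(\mathbb R)$, $\theta_0\ge0$, supported in $[-2,2]$, $=1$ on $[-1,1]$; $\theta_j(t)=\theta_0(2^{-j}t)-\theta_0(2^{-(j-1)}t)$ for $j\ge1$; $\phi_{j_1,j_2}(\xi)=\theta_{j_1}(\xi_1)\theta_{j_2}(\xi_2)$; $\Delta_{j_1,j_2}f=\mathcal F^{-1}(\phi_{j_1,j_2}\hat f)$. $\Gamma_j(\alpha)=\Gamma_j^{HL}\cup\Gamma_j^{LH}\cup\Gamma_j^{HH}$ with $\Gamma_j^{HL}=\{(j_1,j_2)\in\mathbb N^2:[(j-1)\alpha_1]-1\le j_1\le[j\alpha_1]+1,\ 0\le j_2\le[(j-1)\alpha_2]-1\}$, $\Gamma_j^{LH}=\{(j_1,j_2)\in\mathbb N^2:0\le j_1\le[(j-1)\alpha_1]-1,\ [(j-1)\alpha_2]-1\le j_2\le[j\alpha_2]+1\}$, $\Gamma_j^{HH}=\{(j_1,j_2)\in\mathbb N^2:[(j-1)\alpha_1]-1\le j_1\le[j\alpha_1]+1,\ [(j-1)\alpha_2]-1\le j_2\le[j\alpha_2]+1\}$. *)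

theory Defs
  imports "HOL-Analysis.Analysis"
begin

type_synonym testfun = "real \<times> real \<Rightarrow> complex"
type_synonym distr = "testfun \<Rightarrow> complex"

definition partial1 :: "testfun \<Rightarrow> testfun" where
  "partial1 g = (\<lambda>z. vector_derivative (\<lambda>t. g (t, snd z)) (at (fst z)))"

definition partial2 :: "testfun \<Rightarrow> testfun" where
  "partial2 g = (\<lambda>z. vector_derivative (\<lambda>t. g (fst z, t)) (at (snd z)))"

definition pdiff :: "nat \<Rightarrow> nat \<Rightarrow> testfun \<Rightarrow> testfun" where
  "pdiff a b g = (partial1 ^^ a) ((partial2 ^^ b) g)"

definition schwartz2 :: "testfun set" where
  "schwartz2 = {g. \<forall>a b. (\<forall>z. pdiff a b g differentiable (at z)) \<and>
                  (\<forall>k::nat. \<exists>C. \<forall>z. (1 + norm z) ^ k * cmod (pdiff a b g z) \<le> C)}"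

definition schwartz1 :: "(real \<Rightarrow> real) set" where
  "schwartz1 = {g. \<forall>k. (\<forall>t. (deriv ^^ k) g differentiable (at t)) \<and>
                  (\<forall>m::nat. \<exists>C. \<forall>t. (1 + \<bar>t\<bar>) ^ m * \<bar>(deriv ^^ k) g t\<bar> \<le> C)}"

definition schwartz_seminorm :: "nat \<Rightarrow> testfun \<Rightarrow> real" where
  "schwartz_seminorm N \<psi> =
     (\<Sum>a\<le>N. \<Sum>b\<le>N. (SUP z. (1 + norm z) ^ N * cmod (pdiff a b \<psi> z)))"

definition tempered :: "distr \<Rightarrow> bool" where
  "tempered T \<longleftrightarrow>
     (\<forall>\<psi>1\<in>schwartz2. \<forall>\<psi>2\<in>schwartz2. T (\<lambda>z. \<psi>1 z + \<psi>2 z) = T \<psi>1 + T \<psi>2) \<and>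
     (\<forall>\<psi>\<in>schwartz2. \<forall>c. T (\<lambda>z. c * \<psi> z) = c * T \<psi>) \<and>
     (\<exists>C N. \<forall>\<psi>\<in>schwartz2. cmod (T \<psi>) \<le> C * schwartz_seminorm N \<psi>)"

definition fourier :: "testfun \<Rightarrow> testfun" where
  "fourier \<psi> = (\<lambda>\<xi>. integral\<^sup>L lborel (\<lambda>x. cis (- 2 * pi * (x \<bullet> \<xi>)) * \<psi> x))"

definition inv_fourier :: "testfun \<Rightarrow> testfun" where
  "inv_fourier \<psi> = (\<lambda>x. integral\<^sup>L lborel (\<lambda>\<xi>. cis (2 * pi * (x \<bullet> \<xi>)) * \<psi> \<xi>))"

definition dfourier :: "distr \<Rightarrow> distr" where
  "dfourier T = (\<lambda>\<psi>. T (fourier \<psi>))"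

definition dinv_fourier :: "distr \<Rightarrow> distr" where
  "dinv_fourier T = (\<lambda>\<psi>. T (inv_fourier \<psi>))"

definition dmult :: "(real \<times> real \<Rightarrow> real) \<Rightarrow> distr \<Rightarrow> distr" where
  "dmult \<phi> T = (\<lambda>\<psi>. T (\<lambda>z. complex_of_real (\<phi> z) * \<psi> z))"

text \<open>Squared L2 norm of a distribution: the squared L2 norm of an L2 function
  representing it, and \<open>\<infinity>\<close> if there is none.\<close>
definition l2sq :: "distr \<Rightarrow> ennreal" where
  "l2sq T = Inf {(\<integral>\<^sup>+ z. ennreal ((cmod (g z))\<^sup>2) \<partial>lborel) | g.
       g \<in> borel_measurable lborel \<and>
       (\<forall>\<psi>\<in>schwartz2. integrable lborel (\<lambda>z. g z * \<psi> z) \<and>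
                       T \<psi> = integral\<^sup>L lborel (\<lambda>z. g z * \<psi> z))}"

definition admissible :: "real \<Rightarrow> real \<Rightarrow> bool" where
  "admissible \<alpha>1 \<alpha>2 \<longleftrightarrow> \<alpha>1 \<ge> 0 \<and> \<alpha>2 \<ge> 0 \<and> \<alpha>1 + \<alpha>2 = 2"

definition aniso_cutoff :: "real \<Rightarrow> real \<Rightarrow> (real \<times> real \<Rightarrow> real) \<Rightarrow> bool" where
  "aniso_cutoff \<alpha>1 \<alpha>2 \<phi>0 \<longleftrightarrow>
     (\<lambda>z. complex_of_real (\<phi>0 z)) \<in> schwartz2 \<and> (\<forall>\<xi>. \<phi>0 \<xi> \<ge> 0) \<and>
     (\<forall>\<xi>. max \<bar>fst \<xi>\<bar> \<bar>snd \<xi>\<bar> \<le> 1 \<longrightarrow> \<phi>0 \<xi> = 1) \<and>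
     (\<forall>\<xi>. max (2 powr (- \<alpha>1) * \<bar>fst \<xi>\<bar>) (2 powr (- \<alpha>2) * \<bar>snd \<xi>\<bar>) \<ge> 1 \<longrightarrow> \<phi>0 \<xi> = 0)"

definition aniso_scale :: "real \<Rightarrow> real \<Rightarrow> real \<Rightarrow> real \<times> real \<Rightarrow> real \<times> real" where
  "aniso_scale \<alpha>1 \<alpha>2 t \<xi> = (t powr \<alpha>1 * fst \<xi>, t powr \<alpha>2 * snd \<xi>)"

definition aniso_phi :: "real \<Rightarrow> real \<Rightarrow> (real \<times> real \<Rightarrow> real) \<Rightarrow> nat \<Rightarrow> real \<times> real \<Rightarrow> real" where
  "aniso_phi \<alpha>1 \<alpha>2 \<phi>0 j \<xi> =
     (if j = 0 then \<phi>0 \<xi>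
      else \<phi>0 (aniso_scale \<alpha>1 \<alpha>2 (2 powr (- real j)) \<xi>)
         - \<phi>0 (aniso_scale \<alpha>1 \<alpha>2 (2 powr (- (real j - 1))) \<xi>))"

definition aniso_Delta :: "real \<Rightarrow> real \<Rightarrow> (real \<times> real \<Rightarrow> real) \<Rightarrow> nat \<Rightarrow> distr \<Rightarrow> distr" where
  "aniso_Delta \<alpha>1 \<alpha>2 \<phi>0 j f = dinv_fourier (dmult (aniso_phi \<alpha>1 \<alpha>2 \<phi>0 j) (dfourier f))"

text \<open>Weight \<open>j^{-2\<beta>} 2^{2js}\<close>, with \<open>j^\<gamma>\<close> read as 1 at \<open>j = 0\<close>.\<close>
definition wt :: "real \<Rightarrow> real \<Rightarrow> nat \<Rightarrow> real" where
  "wt s \<beta> j = (if j = 0 then 1 else real j powr (- 2 * \<beta>)) * 2 powr (2 * real j * s)"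

definition in_besov :: "real \<Rightarrow> real \<Rightarrow> (real \<times> real \<Rightarrow> real) \<Rightarrow> real \<Rightarrow> real \<Rightarrow> distr \<Rightarrow> bool" where
  "in_besov \<alpha>1 \<alpha>2 \<phi>0 s \<beta> f \<longleftrightarrow> tempered f \<and>
     (\<Sum>j. ennreal (wt s \<beta> j) * l2sq (aniso_Delta \<alpha>1 \<alpha>2 \<phi>0 j f)) < \<infinity>"

definition hyp_cutoff :: "(real \<Rightarrow> real) \<Rightarrow> bool" where
  "hyp_cutoff \<theta>0 \<longleftrightarrow> \<theta>0 \<in> schwartz1 \<and> (\<forall>t. \<theta>0 t \<ge> 0) \<and>
     (\<forall>t. \<bar>t\<bar> > 2 \<longrightarrow> \<theta>0 t = 0) \<and> (\<forall>t. \<bar>t\<bar> \<le> 1 \<longrightarrow> \<theta>0 t = 1)"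

definition theta :: "(real \<Rightarrow> real) \<Rightarrow> nat \<Rightarrow> real \<Rightarrow> real" where
  "theta \<theta>0 j t = (if j = 0 then \<theta>0 t
       else \<theta>0 (2 powr (- real j) * t) - \<theta>0 (2 powr (- (real j - 1)) * t))"

definition hyp_phi :: "(real \<Rightarrow> real) \<Rightarrow> nat \<Rightarrow> nat \<Rightarrow> real \<times> real \<Rightarrow> real" where
  "hyp_phi \<theta>0 j1 j2 \<xi> = theta \<theta>0 j1 (fst \<xi>) * theta \<theta>0 j2 (snd \<xi>)"

definition hyp_Delta :: "(real \<Rightarrow> real) \<Rightarrow> nat \<Rightarrow> nat \<Rightarrow> distr \<Rightarrow> distr" where
  "hyp_Delta \<theta>0 j1 j2 f = dinv_fourier (dmult (hyp_phi \<theta>0 j1 j2) (dfourier f))"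

definition Gamma_HL :: "real \<Rightarrow> real \<Rightarrow> nat \<Rightarrow> (nat \<times> nat) set" where
  "Gamma_HL \<alpha>1 \<alpha>2 j = {(j1, j2).
     \<lfloor>(real j - 1) * \<alpha>1\<rfloor> - 1 \<le> int j1 \<and> int j1 \<le> \<lfloor>real j * \<alpha>1\<rfloor> + 1 \<and>
     int j2 \<le> \<lfloor>(real j - 1) * \<alpha>2\<rfloor> - 1}"

definition Gamma_LH :: "real \<Rightarrow> real \<Rightarrow> nat \<Rightarrow> (nat \<times> nat) set" where
  "Gamma_LH \<alpha>1 \<alpha>2 j = {(j1, j2).
     int j1 \<le> \<lfloor>(real j - 1) * \<alpha>1\<rfloor> - 1 \<and>
     \<lfloor>(real j - 1) * \<alpha>2\<rfloor> - 1 \<le> int j2 \<and> int j2 \<le> \<lfloor>real j * \<alpha>2\<rfloor> + 1}"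

definition Gamma_HH :: "real \<Rightarrow> real \<Rightarrow> nat \<Rightarrow> (nat \<times> nat) set" where
  "Gamma_HH \<alpha>1 \<alpha>2 j = {(j1, j2).
     \<lfloor>(real j - 1) * \<alpha>1\<rfloor> - 1 \<le> int j1 \<and> int j1 \<le> \<lfloor>real j * \<alpha>1\<rfloor> + 1 \<and>
     \<lfloor>(real j - 1) * \<alpha>2\<rfloor> - 1 \<le> int j2 \<and> int j2 \<le> \<lfloor>real j * \<alpha>2\<rfloor> + 1}"

definition Gamma :: "real \<Rightarrow> real \<Rightarrow> nat \<Rightarrow> (nat \<times> nat) set" where
  "Gamma \<alpha>1 \<alpha>2 j = Gamma_HL \<alpha>1 \<alpha>2 j \<union> Gamma_LH \<alpha>1 \<alpha>2 j \<union> Gamma_HH \<alpha>1 \<alpha>2 j"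

end

theory Submission
  imports Defs "HOL-Probability.Sinc_Integral" "HOL-Probability.Characteristic_Functions"
begin

text \<open>
  By Plancherel both conditions become weighted sums of squared norms of the pieces
  \<open>\<phi>\<^sub>j U\<close> and \<open>\<phi>\<^sub>(\<^sub>j\<^sub>1\<^sub>,\<^sub>j\<^sub>2\<^sub>) U\<close> of \<open>U = \<F>f\<close>. Choose \<open>K\<close> with \<open>K \<alpha>\<^sub>i \<ge> 3 + \<alpha>\<^sub>i\<close>.
  On the support of \<open>\<phi>\<^sub>(\<^sub>j\<^sub>1\<^sub>,\<^sub>j\<^sub>2\<^sub>)\<close> with \<open>(j\<^sub>1, j\<^sub>2) \<in> \<Gamma>\<^sub>j\<close> the anisotropic cutoffs of index
  \<open>l\<close> with \<open>\<bar>l - j\<bar> \<le> K\<close> already sum to 1, and conversely on the support of the anisotropic cutoff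
  of index \<open>l\<close> the hyperbolic cutoffs from the sets \<open>\<Gamma>\<^sub>j\<close> with \<open>\<bar>j - l\<bar> \<le> K\<close> sum to 1. Since all
  overlaps are bounded, each level of one sum is controlled by boundedly many neighbouring levels
  of the other, and neighbouring weights are comparable. A degenerate anisotropy, with some
  \<open>\<alpha>\<^sub>i = 0\<close>, admits no cutoff \<open>\<phi>\<^sub>0\<close>.

  Schwartz functions are handled coinductively: a family of rapidly decreasing differentiable functions
  that is closed under both partial derivatives consists of Schwartz functions. Plancherel's
  inequality and Fourier inversion come from a Gaussian window; extending the Fourier transform to square-integrable
  functions and inverting it on test functions yields both halves of Plancherel's theorem for distributions.
\<close>

section \<open>Schwartz functions of two variables\<close>

text \<open>The transform \<open>U\<close> of \<open>f\<close> is only a distribution: there is no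
  function |U|^2 to integrate against the cutoffs, and some pieces may have a square-integrable
  representative while others have none. The comparison therefore works on representatives. Those of
  the pieces of one decomposition, multiplied by auxiliary cutoffs and added, give one function
  whose product with a cutoff of the other decomposition represents the corresponding piece. For
  this the first cutoffs need to sum to 1 only where the second cutoff is nonzero, so finitely many
  pieces suffice. Since \<open>l2sq\<close> is an infimum, representatives are chosen up to an error
  that is sent to zero at the end. The obstacle is uniformity: the number of pairs in
  \<open>Gamma \<alpha>1 \<alpha>2 j\<close> grows with \<open>j\<close>, so a constant obtained by
  counting pieces would destroy the comparison of the weighted sums.\<close>

definition rapid :: "testfun \<Rightarrow> bool" where
  "rapid g \<longleftrightarrow> (\<forall>k::nat. \<exists>C. \<forall>z. (1 + norm z) ^ k * cmod (g z) \<le> C)"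

lemma rapidE:
  assumes "rapid g"
  obtains C where "C \<ge> 0" "\<And>z. (1 + norm z) ^ k * cmod (g z) \<le> C"
proof -
  obtain C where C: "\<And>z. (1 + norm z) ^ k * cmod (g z) \<le> C"
    using assms unfolding rapid_def by blast
  have "0 \<le> (1 + norm (0::real\<times>real)) ^ k * cmod (g 0)" by simp
  with C[of 0] have "C \<ge> 0" by linarith
  with C that show ?thesis by blast
qed

lemma rapid_add:
  assumes "rapid g" "rapid h"
  shows "rapid (\<lambda>z. g z + h z)"
  unfolding rapid_def
proof
  fix k :: nat
  obtain C where C: "\<And>z. (1 + norm z) ^ k * cmod (g z) \<le> C" by (rule rapidE[OF assms(1)]) blast
  obtain D where D: "\<And>z. (1 + norm z) ^ k * cmod (h z) \<le> D" by (rule rapidE[OF assms(2)]) blast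
  have "(1 + norm z) ^ k * cmod (g z + h z) \<le> C + D" for z
  proof -
    have "(1 + norm z) ^ k * cmod (g z + h z) \<le> (1 + norm z) ^ k * (cmod (g z) + cmod (h z))"
      by (intro mult_left_mono norm_triangle_ineq) auto
    with C[of z] D[of z] show ?thesis by (simp add: distrib_left)
  qed
  then show "\<exists>C. \<forall>z. (1 + norm z) ^ k * cmod (g z + h z) \<le> C" by blast
qed

text \<open>Growth of polynomial order is paid for by raising the exponent from \<open>k\<close> to
  \<open>k + n\<close>. The same criterion serves for scalars, characters, and linear and quadratic
  weights.\<close>

lemma rapid_dominated:
  assumes "rapid g" and "\<And>z. cmod (h z) \<le> A * (1 + norm z) ^ n * cmod (g z)" and "A \<ge> 0"
  shows "rapid h"
  unfolding rapid_def
proof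
  fix k :: nat
  obtain C where C: "\<And>z. (1 + norm z) ^ (k + n) * cmod (g z) \<le> C" by (rule rapidE[OF assms(1)]) blast
  have "(1 + norm z) ^ k * cmod (h z) \<le> A * C" for z
  proof -
    have "(1 + norm z) ^ k * cmod (h z) \<le> (1 + norm z) ^ k * (A * (1 + norm z) ^ n * cmod (g z))"
      by (intro mult_left_mono assms) auto
    also have "\<dots> = A * ((1 + norm z) ^ (k + n) * cmod (g z))"
      by (simp add: power_add mult_ac)
    also have "\<dots> \<le> A * C" by (intro mult_left_mono C assms)
    finally show ?thesis .
  qed
  then show "\<exists>C. \<forall>z. (1 + norm z) ^ k * cmod (h z) \<le> C" by blast
qed

lemma pdiff_simps:
  "pdiff 0 0 g = g" "pdiff (Suc a) b g = partial1 (pdiff a b g)"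
  "pdiff 0 (Suc b) g = pdiff 0 b (partial2 g)" "pdiff a (Suc b) g = pdiff a b (partial2 g)"
  by (simp_all add: pdiff_def funpow_swap1)

text \<open>The definition of \<open>schwartz2\<close> speaks of total differentiability, while
  \<open>pdiff\<close> is built from slice derivatives. Restricting a total derivative to the two
  coordinate lines identifies its coefficients, so one application of the usual differentiation
  rules determines both partial derivatives.\<close>

lemma partials_iff:
  fixes g :: testfun
  shows "(g has_derivative (\<lambda>h. fst h *\<^sub>R p + snd h *\<^sub>R q)) (at z) \<longleftrightarrow>
     g differentiable (at z) \<and> partial1 g z = p \<and> partial2 g z = q"
proof
  assume D: "(g has_derivative (\<lambda>h. fst h *\<^sub>R p + snd h *\<^sub>R q)) (at z)"
  have D1: "((\<lambda>t. (t, snd z)) has_derivative (\<lambda>h. (h, 0))) (at (fst z))"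
    by (auto intro!: derivative_eq_intros)
  have D2: "((\<lambda>t. (fst z, t)) has_derivative (\<lambda>h. (0, h))) (at (snd z))"
    by (auto intro!: derivative_eq_intros)
  have "((\<lambda>t. g (t, snd z)) has_derivative (\<lambda>h. h *\<^sub>R p)) (at (fst z))"
    using has_derivative_compose[OF D1, of g "\<lambda>h. fst h *\<^sub>R p + snd h *\<^sub>R q"] D by simp
  then have 1: "partial1 g z = p"
    unfolding partial1_def by (simp add: has_vector_derivative_def vector_derivative_at)
  have "((\<lambda>t. g (fst z, t)) has_derivative (\<lambda>h. h *\<^sub>R q)) (at (snd z))"
    using has_derivative_compose[OF D2, of g "\<lambda>h. fst h *\<^sub>R p + snd h *\<^sub>R q"] D by simp
  then have 2: "partial2 g z = q"
    unfolding partial2_def by (simp add: has_vector_derivative_def vector_derivative_at)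
  show "g differentiable (at z) \<and> partial1 g z = p \<and> partial2 g z = q"
    using D 1 2 differentiable_def by blast
next
  assume A: "g differentiable (at z) \<and> partial1 g z = p \<and> partial2 g z = q"
  then obtain L where L: "(g has_derivative L) (at z)" unfolding differentiable_def by blast
  then have lin: "bounded_linear L" by (rule has_derivative_bounded_linear)
  have Leq: "L = (\<lambda>h. fst h *\<^sub>R L (1,0) + snd h *\<^sub>R L (0,1))"
  proof
    fix h :: "real \<times> real"
    have "h = fst h *\<^sub>R (1,0) + snd h *\<^sub>R (0,1)" by (cases h) simp
    then have "L h = L (fst h *\<^sub>R (1,0) + snd h *\<^sub>R (0,1))" by simp
    then show "L h = fst h *\<^sub>R L (1,0) + snd h *\<^sub>R L (0,1)"
      using bounded_linear.linear[OF lin] by (simp only: linear_add linear_scale)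
  qed
  have L': "(g has_derivative (\<lambda>h. fst h *\<^sub>R L (1,0) + snd h *\<^sub>R L (0,1))) (at z)"
    using L by (subst (asm) Leq)
  have D1: "((\<lambda>t. (t, snd z)) has_derivative (\<lambda>h. (h, 0))) (at (fst z))"
    by (auto intro!: derivative_eq_intros)
  have D2: "((\<lambda>t. (fst z, t)) has_derivative (\<lambda>h. (0, h))) (at (snd z))"
    by (auto intro!: derivative_eq_intros)
  have "((\<lambda>t. g (t, snd z)) has_derivative (\<lambda>h. h *\<^sub>R L (1,0))) (at (fst z))"
    using has_derivative_compose[OF D1, of g "\<lambda>h. fst h *\<^sub>R L (1,0) + snd h *\<^sub>R L (0,1)"] L' by simp
  then have 1: "partial1 g z = L (1,0)"
    unfolding partial1_def by (simp add: has_vector_derivative_def vector_derivative_at)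
  have "((\<lambda>t. g (fst z, t)) has_derivative (\<lambda>h. h *\<^sub>R L (0,1))) (at (snd z))"
    using has_derivative_compose[OF D2, of g "\<lambda>h. fst h *\<^sub>R L (1,0) + snd h *\<^sub>R L (0,1)"] L' by simp
  then have 2: "partial2 g z = L (0,1)"
    unfolding partial2_def by (simp add: has_vector_derivative_def vector_derivative_at)
  show "(g has_derivative (\<lambda>h. fst h *\<^sub>R p + snd h *\<^sub>R q)) (at z)"
    using L' A 1 2 by simp
qed

lemma differentiable_partials:
  assumes "g differentiable (at z)"
  shows "(g has_derivative (\<lambda>h. fst h *\<^sub>R partial1 g z + snd h *\<^sub>R partial2 g z)) (at z)"
  using assms partials_iff by blast

lemma has_vector_derivative_partial1:
  fixes g :: testfun
  assumes "g differentiable (at (x, y))"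
  shows "((\<lambda>t. g (t, y)) has_vector_derivative partial1 g (x, y)) (at x)"
proof -
  have D1: "((\<lambda>t. (t, y)) has_derivative (\<lambda>h. (h, 0))) (at x)"
    by (auto intro!: derivative_eq_intros)
  show ?thesis
    using has_derivative_compose[OF D1 differentiable_partials[OF assms]]
    by (simp add: has_vector_derivative_def)
qed

lemma has_vector_derivative_partial2:
  fixes g :: testfun
  assumes "g differentiable (at (x, y))"
  shows "((\<lambda>t. g (x, t)) has_vector_derivative partial2 g (x, y)) (at y)"
proof -
  have D1: "((\<lambda>t. (x, t)) has_derivative (\<lambda>h. (0, h))) (at y)"
    by (auto intro!: derivative_eq_intros)
  show ?thesis
    using has_derivative_compose[OF D1 differentiable_partials[OF assms]]
    by (simp add: has_vector_derivative_def)
qed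

lemma schwartz2_altdef:
  "g \<in> schwartz2 \<longleftrightarrow> (\<forall>a b. (\<forall>z. pdiff a b g differentiable (at z)) \<and> rapid (pdiff a b g))"
  unfolding schwartz2_def rapid_def mem_Collect_eq ..

lemma schwartz2_coinduct:
  assumes "g \<in> X"
    and diff: "\<And>g z. g \<in> X \<Longrightarrow> g differentiable (at z)"
    and rapid: "\<And>g. g \<in> X \<Longrightarrow> rapid g"
    and p1: "\<And>g. g \<in> X \<Longrightarrow> partial1 g \<in> X"
    and p2: "\<And>g. g \<in> X \<Longrightarrow> partial2 g \<in> X"
  shows "g \<in> schwartz2"
proof -
  have p2n: "(partial2 ^^ b) h \<in> X" if "h \<in> X" for b h
    using that p2 by (induction b) auto
  have p1n: "(partial1 ^^ a) h \<in> X" if "h \<in> X" for a h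
    using that p1 by (induction a) auto
  have "pdiff a b g \<in> X" for a b
    unfolding pdiff_def using assms(1) p1n p2n by blast
  then show ?thesis
    unfolding schwartz2_altdef using diff rapid by blast
qed

lemma schwartz2_pdiff_differentiable: "g \<in> schwartz2 \<Longrightarrow> pdiff a b g differentiable (at z)"
  by (simp only: schwartz2_altdef)

lemma schwartz2_differentiable: "g \<in> schwartz2 \<Longrightarrow> g differentiable (at z)"
  using schwartz2_pdiff_differentiable[of g 0 0] by (simp add: pdiff_simps)

lemma schwartz2_rapid: "g \<in> schwartz2 \<Longrightarrow> rapid g"
  using schwartz2_altdef[of g] by (metis pdiff_simps(1))

lemma continuous_on_differentiable:
  fixes g :: testfun
  shows "(\<And>z. g differentiable (at z)) \<Longrightarrow> continuous_on S g"
  by (meson continuous_at_imp_continuous_on differentiable_imp_continuous_within)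

text \<open>Schwarz's theorem on mixed partials, obtained by differentiating
  \<open>p (x, v) = p (x, a) + \<integral>\<^sub>a\<^sup>v \<partial>\<^sub>2 p (x, t) dt\<close> in \<open>x\<close>. It is needed because
  \<^const>\<open>pdiff\<close> fixes the order of differentiation.\<close>
lemma partials_commute:
  assumes p: "\<And>z. p differentiable (at z)"
    and p1: "\<And>z. partial1 p differentiable (at z)"
    and p2: "\<And>z. partial2 p differentiable (at z)"
    and p21: "\<And>z. partial1 (partial2 p) differentiable (at z)"
  shows "partial2 (partial1 p) = partial1 (partial2 p)"
proof
  fix z :: "real \<times> real"
  obtain x y where z: "z = (x, y)" by (cases z)
  define r where "r = partial1 (partial2 p)"
  have contr: "continuous_on S r" for S
    unfolding r_def by (rule continuous_on_differentiable[OF p21])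
  \<comment> \<open>\<open>y\<close> must be an interior point of \<open>{a..b}\<close>: the
    fundamental theorem yields a derivative within the interval, and only at interior points is it a
    two-sided one.\<close>
  define a where "a = y - 1"
  define b where "b = y + 1"
  have FTC: "((\<lambda>t. partial2 p (x', t)) has_integral p (x', v) - p (x', a)) {a..v}"
    if "a \<le> v" for x' v
    by (rule fundamental_theorem_of_calculus[OF that])
       (metis has_vector_derivative_partial2 has_vector_derivative_at_within p)
  have A: "partial1 p (x, v) = partial1 p (x, a) + integral {a..v} (\<lambda>t. r (x, t))" if "a \<le> v" for v
  proof -
    have "((\<lambda>x'. integral (cbox a v) (\<lambda>t. partial2 p (x', t))) has_vector_derivative
        integral (cbox a v) (\<lambda>t. r (x, t))) (at x within UNIV)"
    proof (rule leibniz_rule_vector_derivative[where fx = "\<lambda>x t. r (x, t)"])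
      show "((\<lambda>x'. partial2 p (x', t)) has_vector_derivative r (x', t)) (at x' within UNIV)" for x' t
        unfolding r_def using has_vector_derivative_partial1[OF p2] .
      show "(\<lambda>t. partial2 p (x', t)) integrable_on cbox a v" for x'
        using FTC[OF that, of x'] by auto
      have "continuous_on (UNIV \<times> cbox a v) r" by (rule contr)
      then show "continuous_on (UNIV \<times> cbox a v) (\<lambda>(x, t). r (x, t))" by simp
    qed auto
    moreover have "integral (cbox a v) (\<lambda>t. partial2 p (x', t)) = p (x', v) - p (x', a)" for x'
      using FTC[OF that, of x'] by (simp add: integral_unique)
    ultimately have "((\<lambda>x'. p (x', v) - p (x', a)) has_vector_derivative
        integral {a..v} (\<lambda>t. r (x, t))) (at x)" by simp
    moreover have "((\<lambda>x'. p (x', v) - p (x', a)) has_vector_derivative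
        partial1 p (x, v) - partial1 p (x, a)) (at x)"
      by (intro has_vector_derivative_diff has_vector_derivative_partial1 p)
    ultimately have "partial1 p (x, v) - partial1 p (x, a) = integral {a..v} (\<lambda>t. r (x, t))"
      using vector_derivative_unique_at by blast
    then show ?thesis by (simp add: algebra_simps)
  qed
  have "((\<lambda>v. integral {a..v} (\<lambda>t. r (x, t))) has_vector_derivative r (x, y)) (at y within {a..b})"
    by (rule integral_has_vector_derivative)
       (auto simp: a_def b_def intro!: continuous_on_compose2[OF contr[of UNIV]] continuous_intros)
  then have "((\<lambda>v. partial1 p (x, a) + integral {a..v} (\<lambda>t. r (x, t))) has_vector_derivative r (x, y))
      (at y within {a..b})"
    using has_vector_derivative_add[OF has_vector_derivative_const[of "partial1 p (x, a)"]] by force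
  then have "((\<lambda>v. partial1 p (x, v)) has_vector_derivative r (x, y)) (at y within {a..b})"
  proof (rule has_vector_derivative_transform[rotated 2])
    show "y \<in> {a..b}" by (simp add: a_def b_def)
    show "partial1 p (x, v) = partial1 p (x, a) + integral {a..v} (\<lambda>t. r (x, t))" if "v \<in> {a..b}" for v
      using that by (intro A) simp
  qed
  moreover have "at y within {a..b} = at y"
    by (rule at_within_interior) (auto simp: a_def b_def)
  ultimately have "((\<lambda>v. partial1 p (x, v)) has_vector_derivative r (x, y)) (at y)" by simp
  moreover have "((\<lambda>v. partial1 p (x, v)) has_vector_derivative partial2 (partial1 p) (x, y)) (at y)"
    by (rule has_vector_derivative_partial2[OF p1])
  ultimately show "partial2 (partial1 p) z = partial1 (partial2 p) z"
    unfolding z r_def using vector_derivative_unique_at by blast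
qed

lemma schwartz2_partial2: "g \<in> schwartz2 \<Longrightarrow> partial2 g \<in> schwartz2"
  unfolding schwartz2_altdef pdiff_simps(4)[symmetric] by blast

text \<open>\<open>pdiff\<close> applies \<open>partial2\<close> first, so closure under
  \<open>partial2\<close> is immediate, whereas an inner \<open>partial1\<close> has to be carried
  past every \<open>partial2\<close>. The induction commutes one of them at a time and continues
  with \<open>partial2 g\<close>.\<close>

lemma pdiff_partial1:
  assumes "g \<in> schwartz2"
  shows "pdiff a b (partial1 g) = pdiff (Suc a) b g"
proof -
  have "(partial2 ^^ b) (partial1 g) = partial1 ((partial2 ^^ b) g)"
    using assms
  proof (induction b arbitrary: g)
    case (Suc b)
    have D: "pdiff a b g differentiable (at z)" for a b z
      using schwartz2_pdiff_differentiable[OF Suc.prems] .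
    have "partial2 (partial1 g) = partial1 (partial2 g)"
      using D[of 0 0] D[of 1 0] D[of 0 1] D[of 1 1]
      by (intro partials_commute) (simp_all add: pdiff_def)
    then have "(partial2 ^^ Suc b) (partial1 g) = (partial2 ^^ b) (partial1 (partial2 g))"
      by (metis comp_apply funpow_Suc_right)
    also have "\<dots> = partial1 ((partial2 ^^ Suc b) g)"
      using Suc.IH[OF schwartz2_partial2[OF Suc.prems]] by (metis comp_apply funpow_Suc_right)
    finally show ?case .
  qed simp
  then show ?thesis by (simp add: pdiff_def funpow_swap1)
qed

lemma schwartz2_partial1: "g \<in> schwartz2 \<Longrightarrow> partial1 g \<in> schwartz2"
  unfolding schwartz2_altdef[of "partial1 g"] using pdiff_partial1[of g] schwartz2_altdef[of g] by simp

lemma schwartz2_has_derivative: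
  "g \<in> schwartz2 \<Longrightarrow> (g has_derivative (\<lambda>h. fst h *\<^sub>R partial1 g z + snd h *\<^sub>R partial2 g z)) (at z)"
  by (intro differentiable_partials schwartz2_differentiable)

text \<open>A total derivative with coefficients in \<open>X\<close> supplies differentiability and
  both partials at once, so closure proofs reduce to a differentiation rule and a rearrangement of
  its result.\<close>

lemma schwartz2_coinduct':
  assumes "g \<in> X"
    and diff: "\<And>g. g \<in> X \<Longrightarrow> \<exists>p\<in>X. \<exists>q\<in>X. \<forall>z. (g has_derivative (\<lambda>h. fst h *\<^sub>R p z + snd h *\<^sub>R q z)) (at z)"
    and rapid: "\<And>g. g \<in> X \<Longrightarrow> rapid g"
  shows "g \<in> schwartz2"
proof (rule schwartz2_coinduct[OF assms(1)])
  fix g assume "g \<in> X"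
  from diff[OF this] obtain p q where pq: "p \<in> X" "q \<in> X"
    "\<And>z. (g has_derivative (\<lambda>h. fst h *\<^sub>R p z + snd h *\<^sub>R q z)) (at z)" by blast
  then have "\<And>z. g differentiable (at z) \<and> partial1 g z = p z \<and> partial2 g z = q z"
    using partials_iff by blast
  then have "partial1 g = p" "partial2 g = q" "\<And>z. g differentiable (at z)" by auto
  then show "\<And>z. g differentiable (at z)" "partial1 g \<in> X" "partial2 g \<in> X" using pq by auto
qed (use rapid in auto)

section \<open>Closure of the Schwartz class under algebraic operations and dilations\<close>

lemma schwartz2_add:
  assumes "g \<in> schwartz2" "h \<in> schwartz2"
  shows "(\<lambda>z. g z + h z) \<in> schwartz2"
proof -
  define X where "X = {\<lambda>z. g z + h z |g h. g \<in> schwartz2 \<and> h \<in> schwartz2}"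
  have XI: "(\<lambda>z. g z + h z) \<in> X" if "g \<in> schwartz2" "h \<in> schwartz2" for g h
    unfolding X_def using that by blast
  show ?thesis
  proof (rule schwartz2_coinduct'[OF XI[OF assms]])
    fix u assume "u \<in> X"
    then obtain g h where u: "u = (\<lambda>z. g z + h z)" "g \<in> schwartz2" "h \<in> schwartz2"
      unfolding X_def by blast
    show "rapid u" unfolding u(1) by (intro rapid_add schwartz2_rapid u)
    have "(u has_derivative (\<lambda>k. fst k *\<^sub>R (partial1 g z + partial1 h z) + snd k *\<^sub>R (partial2 g z + partial2 h z))) (at z)" for z
      unfolding u(1)
      by (rule has_derivative_eq_rhs, rule has_derivative_add[OF schwartz2_has_derivative[OF u(2)] schwartz2_has_derivative[OF u(3)]])
         (auto simp: algebra_simps)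
    then show "\<exists>p\<in>X. \<exists>q\<in>X. \<forall>z. (u has_derivative (\<lambda>k. fst k *\<^sub>R p z + snd k *\<^sub>R q z)) (at z)"
      by (intro bexI[OF _ XI[OF schwartz2_partial1[OF u(2)] schwartz2_partial1[OF u(3)]]]
                bexI[OF _ XI[OF schwartz2_partial2[OF u(2)] schwartz2_partial2[OF u(3)]]] allI)
  qed
qed

lemma rapid_mult:
  assumes "rapid g" "rapid h"
  shows "rapid (\<lambda>z. g z * h z)"
proof -
  obtain C where "C \<ge> 0" and C: "\<And>z. (1 + norm z) ^ 0 * cmod (g z) \<le> C" by (rule rapidE[OF assms(1)]) blast
  then show ?thesis
    by (intro rapid_dominated[OF assms(2), where A = C and n = 0]) (auto simp: norm_mult intro!: mult_right_mono)
qed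

text \<open>Products alone are not closed under differentiation: the Leibniz rule turns one product
  into a sum of two. Closing them under addition gives a family suited to coinduction.\<close>

inductive_set prodspan :: "testfun set" where
  mult: "g \<in> schwartz2 \<Longrightarrow> h \<in> schwartz2 \<Longrightarrow> (\<lambda>z. g z * h z) \<in> prodspan"
| add: "u \<in> prodspan \<Longrightarrow> v \<in> prodspan \<Longrightarrow> (\<lambda>z. u z + v z) \<in> prodspan"

lemma schwartz2_mult:
  assumes "g \<in> schwartz2" "h \<in> schwartz2"
  shows "(\<lambda>z. g z * h z) \<in> schwartz2"
proof (rule schwartz2_coinduct'[where X = prodspan])
  fix u assume "u \<in> prodspan"
  then show "\<exists>p\<in>prodspan. \<exists>q\<in>prodspan. \<forall>z. (u has_derivative (\<lambda>k. fst k *\<^sub>R p z + snd k *\<^sub>R q z)) (at z)"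
  proof induction
    case (mult g h)
    have "((\<lambda>z. g z * h z) has_derivative (\<lambda>k. fst k *\<^sub>R (partial1 g z * h z + g z * partial1 h z)
       + snd k *\<^sub>R (partial2 g z * h z + g z * partial2 h z))) (at z)" for z
      by (rule has_derivative_eq_rhs, rule has_derivative_mult[OF schwartz2_has_derivative[OF mult(1)] schwartz2_has_derivative[OF mult(2)]])
         (auto simp: algebra_simps)
    then show ?case
      by (intro bexI[OF _ prodspan.add[OF prodspan.mult[OF schwartz2_partial1[OF mult(1)] mult(2)]
                                          prodspan.mult[OF mult(1) schwartz2_partial1[OF mult(2)]]]]
                bexI[OF _ prodspan.add[OF prodspan.mult[OF schwartz2_partial2[OF mult(1)] mult(2)]
                                          prodspan.mult[OF mult(1) schwartz2_partial2[OF mult(2)]]]] allI)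
  next
    case (add u v)
    from add.IH(1) obtain p q where p: "p \<in> prodspan" "q \<in> prodspan"
      and u: "\<And>z. (u has_derivative (\<lambda>k. fst k *\<^sub>R p z + snd k *\<^sub>R q z)) (at z)" by (elim bexE) auto
    from add.IH(2) obtain p' q' where p': "p' \<in> prodspan" "q' \<in> prodspan"
      and v: "\<And>z. (v has_derivative (\<lambda>k. fst k *\<^sub>R p' z + snd k *\<^sub>R q' z)) (at z)" by (elim bexE) auto
    have "((\<lambda>z. u z + v z) has_derivative (\<lambda>k. fst k *\<^sub>R (p z + p' z) + snd k *\<^sub>R (q z + q' z))) (at z)" for z
      by (rule has_derivative_eq_rhs, rule has_derivative_add[OF u v]) (auto simp: algebra_simps)
    then show ?case
      by (intro bexI[OF _ prodspan.add[OF p(1) p'(1)]] bexI[OF _ prodspan.add[OF p(2) p'(2)]] allI)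
  qed
next
  fix u assume "u \<in> prodspan"
  then show "rapid u"
    by induction (auto intro: rapid_mult rapid_add schwartz2_rapid)
qed (rule prodspan.mult[OF assms])

text \<open>Nonzero constants are not Schwartz functions, so this is not a case of
  \<open>schwartz2_mult\<close>.\<close>

lemma schwartz2_cmult:
  assumes "g \<in> schwartz2"
  shows "(\<lambda>z. c * g z) \<in> schwartz2"
proof -
  define X where "X = {\<lambda>z. c * g z |g. g \<in> schwartz2}"
  have XI: "(\<lambda>z. c * g z) \<in> X" if "g \<in> schwartz2" for g
    unfolding X_def using that by blast
  show ?thesis
  proof (rule schwartz2_coinduct'[OF XI[OF assms]])
    fix u assume "u \<in> X"
    then obtain g where u: "u = (\<lambda>z. c * g z)" "g \<in> schwartz2" unfolding X_def by blast
    show "rapid u" unfolding u(1)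
      by (rule rapid_dominated[OF schwartz2_rapid[OF u(2)], where A = "cmod c" and n = 0]) (auto simp: norm_mult)
    have "(u has_derivative (\<lambda>k. fst k *\<^sub>R (c * partial1 g z) + snd k *\<^sub>R (c * partial2 g z))) (at z)" for z
      unfolding u(1)
      by (rule has_derivative_eq_rhs, rule has_derivative_mult_right[OF schwartz2_has_derivative[OF u(2)]])
         (auto simp: algebra_simps)
    then show "\<exists>p\<in>X. \<exists>q\<in>X. \<forall>z. (u has_derivative (\<lambda>k. fst k *\<^sub>R p z + snd k *\<^sub>R q z)) (at z)"
      by (intro bexI[OF _ XI[OF schwartz2_partial1[OF u(2)]]] bexI[OF _ XI[OF schwartz2_partial2[OF u(2)]]] allI)
  qed
qed

lemma schwartz2_zero: "(\<lambda>z. 0) \<in> schwartz2"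
  by (rule schwartz2_coinduct'[where X = "{\<lambda>z. 0}"]) (auto simp: rapid_def)

lemma schwartz2_diff:
  assumes "g \<in> schwartz2" "h \<in> schwartz2"
  shows "(\<lambda>z. g z - h z) \<in> schwartz2"
  using schwartz2_add[OF assms(1) schwartz2_cmult[OF assms(2), of "-1"]] by simp

lemma schwartz2_sum:
  "(\<And>i. i \<in> I \<Longrightarrow> g i \<in> schwartz2) \<Longrightarrow> (\<lambda>z. \<Sum>i\<in>I. g i z) \<in> schwartz2"
  by (induction I rule: infinite_finite_induct) (auto intro: schwartz2_zero schwartz2_add)

text \<open>By the Leibniz rule the set of all \<open>\<ell> g + h\<close> is closed under partial derivatives.\<close>
lemma schwartz2_linear_mult:
  assumes "g \<in> schwartz2"
  shows "(\<lambda>z. complex_of_real (a * fst z + b * snd z) * g z) \<in> schwartz2"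
proof -
  define X where "X = {\<lambda>z. complex_of_real (a * fst z + b * snd z) * g z + h z |g h. g \<in> schwartz2 \<and> h \<in> schwartz2}"
  have XI: "(\<lambda>z. complex_of_real (a * fst z + b * snd z) * g z + h z) \<in> X" if "g \<in> schwartz2" "h \<in> schwartz2" for g h
    unfolding X_def using that by blast
  have "(\<lambda>z. complex_of_real (a * fst z + b * snd z) * g z + 0) \<in> schwartz2"
  proof (rule schwartz2_coinduct'[where X = X])
    show "(\<lambda>z. complex_of_real (a * fst z + b * snd z) * g z + 0) \<in> X"
      using XI[OF assms schwartz2_zero] .
  next
    fix u assume "u \<in> X"
    then obtain g h where u: "u = (\<lambda>z. complex_of_real (a * fst z + b * snd z) * g z + h z)"
      "g \<in> schwartz2" "h \<in> schwartz2" unfolding X_def by blast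
    have "\<bar>a * fst z + b * snd z\<bar> \<le> (\<bar>a\<bar> + \<bar>b\<bar>) * (1 + norm z)" for z :: "real \<times> real"
    proof -
      have "\<bar>fst z\<bar> \<le> 1 + norm z" "\<bar>snd z\<bar> \<le> 1 + norm z"
        using norm_fst_le[of "fst z" "snd z"] norm_snd_le[of "snd z" "fst z"] by auto
      then have "\<bar>a\<bar> * \<bar>fst z\<bar> \<le> \<bar>a\<bar> * (1 + norm z)" "\<bar>b\<bar> * \<bar>snd z\<bar> \<le> \<bar>b\<bar> * (1 + norm z)"
        by (auto intro!: mult_left_mono)
      moreover have "\<bar>a * fst z + b * snd z\<bar> \<le> \<bar>a\<bar> * \<bar>fst z\<bar> + \<bar>b\<bar> * \<bar>snd z\<bar>"
        by (metis abs_mult abs_triangle_ineq)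
      ultimately show ?thesis by (simp add: distrib_right)
    qed
    then have "rapid (\<lambda>z. complex_of_real (a * fst z + b * snd z) * g z)"
      by (intro rapid_dominated[OF schwartz2_rapid[OF u(2)], where A = "\<bar>a\<bar> + \<bar>b\<bar>" and n = 1])
         (auto simp del: of_real_add of_real_mult simp: norm_mult intro!: mult_right_mono)
    then show "rapid u" unfolding u(1) by (rule rapid_add[OF _ schwartz2_rapid[OF u(3)]])
    have L: "((\<lambda>z. complex_of_real (a * fst z + b * snd z)) has_derivative
        (\<lambda>k. complex_of_real (a * fst k + b * snd k))) (at z)" for z :: "real \<times> real"
      by (intro has_derivative_of_real) (auto intro!: derivative_eq_intros)
    let ?p = "\<lambda>z. complex_of_real (a * fst z + b * snd z) * partial1 g z + (complex_of_real a * g z + partial1 h z)"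
    let ?q = "\<lambda>z. complex_of_real (a * fst z + b * snd z) * partial2 g z + (complex_of_real b * g z + partial2 h z)"
    have "(u has_derivative (\<lambda>k. fst k *\<^sub>R ?p z + snd k *\<^sub>R ?q z)) (at z)" for z
    proof -
      have "(u has_derivative (\<lambda>k. complex_of_real (a * fst z + b * snd z) * (fst k *\<^sub>R partial1 g z + snd k *\<^sub>R partial2 g z)
          + complex_of_real (a * fst k + b * snd k) * g z + (fst k *\<^sub>R partial1 h z + snd k *\<^sub>R partial2 h z))) (at z)"
        unfolding u(1)
        by (rule has_derivative_add[OF has_derivative_mult[OF L schwartz2_has_derivative[OF u(2)]] schwartz2_has_derivative[OF u(3)]])
      moreover have "complex_of_real (a * fst z + b * snd z) * (fst k *\<^sub>R partial1 g z + snd k *\<^sub>R partial2 g z)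
          + complex_of_real (a * fst k + b * snd k) * g z + (fst k *\<^sub>R partial1 h z + snd k *\<^sub>R partial2 h z)
          = fst k *\<^sub>R ?p z + snd k *\<^sub>R ?q z" for k
        unfolding scaleR_conv_of_real of_real_add of_real_mult by algebra
      ultimately show ?thesis by (simp only:)
    qed
    then show "\<exists>p\<in>X. \<exists>q\<in>X. \<forall>z. (u has_derivative (\<lambda>k. fst k *\<^sub>R p z + snd k *\<^sub>R q z)) (at z)"
      by (intro bexI[OF _ XI[OF schwartz2_partial1[OF u(2)] schwartz2_add[OF schwartz2_cmult[OF u(2)] schwartz2_partial1[OF u(3)]]]]
                bexI[OF _ XI[OF schwartz2_partial2[OF u(2)] schwartz2_add[OF schwartz2_cmult[OF u(2)] schwartz2_partial2[OF u(3)]]]] allI)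
  qed
  then show ?thesis by simp
qed

lemma rapid_dilation:
  assumes "rapid g" and "a \<noteq> 0" "b \<noteq> 0"
  shows "rapid (\<lambda>z. g (a * fst z, b * snd z))"
  unfolding rapid_def
proof
  fix k :: nat
  obtain C where C: "\<And>z. (1 + norm z) ^ k * cmod (g z) \<le> C" by (rule rapidE[OF assms(1)]) blast
  \<comment> \<open>\<open>A\<close> bounds the inverse dilation: each coordinate of
    \<open>z\<close> is at most the norm of the dilated point divided by
    \<open>\<bar>a\<bar>\<close> or \<open>\<bar>b\<bar>\<close>, and the leading 1 absorbs the
    constant in \<open>1 + norm z\<close>.\<close>
  define A where "A = 1 + 1 / \<bar>a\<bar> + 1 / \<bar>b\<bar>"
  have "(1 + norm z) ^ k * cmod (g (a * fst z, b * snd z)) \<le> A ^ k * C" for z :: "real \<times> real"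
  proof -
    let ?w = "(a * fst z, b * snd z)"
    have "norm z \<le> norm (fst z) + norm (snd z)"
      using norm_Pair_le[of "fst z" "snd z"] by simp
    moreover have "\<bar>a * fst z\<bar> \<le> norm ?w" "\<bar>b * snd z\<bar> \<le> norm ?w"
      using norm_fst_le[of "fst ?w" "snd ?w"] norm_snd_le[of "snd ?w" "fst ?w"] by auto
    then have "\<bar>fst z\<bar> \<le> norm ?w / \<bar>a\<bar>" "\<bar>snd z\<bar> \<le> norm ?w / \<bar>b\<bar>"
      using assms by (simp_all add: field_simps abs_mult)
    ultimately have "1 + norm z \<le> 1 + (norm ?w / \<bar>a\<bar> + norm ?w / \<bar>b\<bar>)" by simp
    also have "\<dots> \<le> A * (1 + norm ?w)"
      unfolding A_def by (simp add: algebra_simps)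
    finally have "(1 + norm z) ^ k \<le> (A * (1 + norm ?w)) ^ k"
      by (intro power_mono) auto
    then have "(1 + norm z) ^ k * cmod (g ?w) \<le> (A * (1 + norm ?w)) ^ k * cmod (g ?w)"
      by (intro mult_right_mono) auto
    also have "\<dots> = A ^ k * ((1 + norm ?w) ^ k * cmod (g ?w))" by (simp add: power_mult_distrib)
    also have "\<dots> \<le> A ^ k * C" by (intro mult_left_mono C) (auto simp: A_def)
    finally show ?thesis .
  qed
  then show "\<exists>C. \<forall>z. (1 + norm z) ^ k * cmod (g (a * fst z, b * snd z)) \<le> C" by blast
qed

lemma schwartz2_dilation:
  assumes "g \<in> schwartz2" and ab: "a \<noteq> 0" "b \<noteq> 0"
  shows "(\<lambda>z. g (a * fst z, b * snd z)) \<in> schwartz2"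
proof -
  define X where "X = {\<lambda>z. g (a * fst z, b * snd z) |g. g \<in> schwartz2}"
  have XI: "(\<lambda>z. g (a * fst z, b * snd z)) \<in> X" if "g \<in> schwartz2" for g
    unfolding X_def using that by blast
  show ?thesis
  proof (rule schwartz2_coinduct'[OF XI[OF assms(1)]])
    fix u assume "u \<in> X"
    then obtain g where u: "u = (\<lambda>z. g (a * fst z, b * snd z))" "g \<in> schwartz2"
      unfolding X_def by blast
    show "rapid u" unfolding u(1) by (intro rapid_dilation ab schwartz2_rapid u)
    have D: "((\<lambda>z. (a * fst z, b * snd z)) has_derivative (\<lambda>k. (a * fst k, b * snd k))) (at z)" for z
      by (auto intro!: derivative_eq_intros)
    have "(u has_derivative (\<lambda>k. fst k *\<^sub>R (complex_of_real a * partial1 g (a * fst z, b * snd z))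
        + snd k *\<^sub>R (complex_of_real b * partial2 g (a * fst z, b * snd z)))) (at z)" for z
      unfolding u(1)
      by (rule has_derivative_eq_rhs, rule has_derivative_compose[OF D schwartz2_has_derivative[OF u(2)]])
         (auto simp: scaleR_conv_of_real algebra_simps)
    then show "\<exists>p\<in>X. \<exists>q\<in>X. \<forall>z. (u has_derivative (\<lambda>k. fst k *\<^sub>R p z + snd k *\<^sub>R q z)) (at z)"
      by (intro bexI[OF _ XI[OF schwartz2_cmult[OF schwartz2_partial1[OF u(2)]]]]
                bexI[OF _ XI[OF schwartz2_cmult[OF schwartz2_partial2[OF u(2)]]]] allI)
  qed
qed

section \<open>Schwartz functions of one variable and their tensor products\<close>

lemma schwartz1_deriv: "u \<in> schwartz1 \<Longrightarrow> deriv u \<in> schwartz1"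
  unfolding schwartz1_def mem_Collect_eq
  by (rule allI, drule spec[where x = "Suc _"], unfold funpow_Suc_right o_apply)

lemma schwartz1_has_field_derivative:
  assumes "u \<in> schwartz1" shows "(u has_real_derivative deriv u t) (at t)"
proof -
  have "u differentiable (at t)"
    using assms[unfolded schwartz1_def mem_Collect_eq, rule_format, of 0] by (simp only: funpow_0)
  then show ?thesis
    by (meson DERIV_deriv_iff_real_differentiable)
qed

lemma schwartz1_decay:
  assumes "u \<in> schwartz1"
  obtains C where "C \<ge> 0" "\<And>t. (1 + \<bar>t\<bar>) ^ m * \<bar>u t\<bar> \<le> C"
proof -
  from assms have "\<exists>C. \<forall>t. (1 + \<bar>t\<bar>) ^ m * \<bar>(deriv ^^ 0) u t\<bar> \<le> C"
    unfolding schwartz1_def by blast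
  then obtain C where C: "\<And>t. (1 + \<bar>t\<bar>) ^ m * \<bar>u t\<bar> \<le> C" by auto
  have "0 \<le> (1 + \<bar>0::real\<bar>) ^ m * \<bar>u 0\<bar>" by simp
  with C[of 0] have "C \<ge> 0" by linarith
  with C that show ?thesis by blast
qed

text \<open>The inequality \<open>1 + norm z \<le> (1 + \<bar>x\<bar>) * (1 + \<bar>y\<bar>)\<close>
  for \<open>z = (x, y)\<close> splits the weight between the factors. With dilations and
  differences, such tensor products yield all hyperbolic cutoffs.\<close>

lemma schwartz2_tensor:
  assumes "u \<in> schwartz1" "v \<in> schwartz1"
  shows "(\<lambda>z. complex_of_real (u (fst z) * v (snd z))) \<in> schwartz2"
proof -
  define X where "X = {\<lambda>z. complex_of_real (u (fst z) * v (snd z)) |u v. u \<in> schwartz1 \<and> v \<in> schwartz1}"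
  have XI: "(\<lambda>z. complex_of_real (u (fst z) * v (snd z))) \<in> X" if "u \<in> schwartz1" "v \<in> schwartz1" for u v
    unfolding X_def using that by blast
  show ?thesis
  proof (rule schwartz2_coinduct'[OF XI[OF assms]])
    fix g assume "g \<in> X"
    then obtain u v where g: "g = (\<lambda>z. complex_of_real (u (fst z) * v (snd z)))"
      "u \<in> schwartz1" "v \<in> schwartz1" unfolding X_def by blast
    show "rapid g" unfolding rapid_def
    proof
      fix k :: nat
      obtain C where C0: "C \<ge> 0" and C: "\<And>t. (1 + \<bar>t\<bar>) ^ k * \<bar>u t\<bar> \<le> C" using schwartz1_decay[OF g(2)] by blast
      obtain D where D: "\<And>t. (1 + \<bar>t\<bar>) ^ k * \<bar>v t\<bar> \<le> D" using schwartz1_decay[OF g(3)] by blast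
      have "(1 + norm z) ^ k * cmod (g z) \<le> C * D" for z
      proof -
        have "norm z \<le> norm (fst z) + norm (snd z)"
          using norm_Pair_le[of "fst z" "snd z"] by simp
        moreover have "(1 + \<bar>fst z\<bar>) * (1 + \<bar>snd z\<bar>) = 1 + \<bar>fst z\<bar> + \<bar>snd z\<bar> + \<bar>fst z\<bar> * \<bar>snd z\<bar>"
          by (simp add: algebra_simps)
        moreover have "0 \<le> \<bar>fst z\<bar> * \<bar>snd z\<bar>" by simp
        ultimately have "1 + norm z \<le> (1 + \<bar>fst z\<bar>) * (1 + \<bar>snd z\<bar>)"
          unfolding real_norm_def by linarith
        then have "(1 + norm z) ^ k \<le> ((1 + \<bar>fst z\<bar>) * (1 + \<bar>snd z\<bar>)) ^ k"
          by (intro power_mono) auto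
        then have "(1 + norm z) ^ k * cmod (g z) \<le> ((1 + \<bar>fst z\<bar>) * (1 + \<bar>snd z\<bar>)) ^ k * cmod (g z)"
          by (intro mult_right_mono) auto
        also have "\<dots> = ((1 + \<bar>fst z\<bar>) ^ k * \<bar>u (fst z)\<bar>) * ((1 + \<bar>snd z\<bar>) ^ k * \<bar>v (snd z)\<bar>)"
          unfolding g(1) norm_of_real abs_mult by (simp add: power_mult_distrib mult_ac)
        also have "\<dots> \<le> C * D" by (intro mult_mono C D C0) auto
        finally show ?thesis .
      qed
      then show "\<exists>C. \<forall>z. (1 + norm z) ^ k * cmod (g z) \<le> C" by blast
    qed
    have "(g has_derivative (\<lambda>k. fst k *\<^sub>R complex_of_real (deriv u (fst z) * v (snd z)) +
        snd k *\<^sub>R complex_of_real (u (fst z) * deriv v (snd z)))) (at z)" for z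
    proof -
      have 1: "((\<lambda>z. u (fst z)) has_derivative (\<lambda>k. deriv u (fst z) * fst k)) (at z)"
        by (rule has_derivative_compose[where f = fst, OF _ schwartz1_has_field_derivative[OF g(2), unfolded has_field_derivative_def]])
           (rule has_derivative_fst[OF has_derivative_ident])
      have 2: "((\<lambda>z. v (snd z)) has_derivative (\<lambda>k. deriv v (snd z) * snd k)) (at z)"
        by (rule has_derivative_compose[where f = snd, OF _ schwartz1_has_field_derivative[OF g(3), unfolded has_field_derivative_def]])
           (rule has_derivative_snd[OF has_derivative_ident])
      show ?thesis unfolding g(1)
        by (rule has_derivative_eq_rhs, rule has_derivative_of_real[OF has_derivative_mult[OF 1 2]])
           (auto simp: scaleR_conv_of_real algebra_simps)
    qed
    then show "\<exists>p\<in>X. \<exists>q\<in>X. \<forall>z. (g has_derivative (\<lambda>k. fst k *\<^sub>R p z + snd k *\<^sub>R q z)) (at z)"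
      by (intro bexI[OF _ XI[OF schwartz1_deriv[OF g(2)] g(3)]] bexI[OF _ XI[OF g(2) schwartz1_deriv[OF g(3)]]] allI)
  qed
qed

section \<open>The Fourier transform on Schwartz functions\<close>

text \<open>The factors may live in different Euclidean spaces because the result is used both for
  the plane as a product of lines and for pairs of points of the plane, in the multiplication
  formula of the Fourier transform.\<close>

lemma integrable_tensor:
  fixes u :: "'b::euclidean_space \<Rightarrow> 'a::{real_normed_field, banach, second_countable_topology}"
    and v :: "'c::euclidean_space \<Rightarrow> 'a"
  assumes u: "integrable lborel u" and v: "integrable lborel v"
  shows "integrable lborel (\<lambda>z. u (fst z) * v (snd z))"
    and "(\<integral>z. u (fst z) * v (snd z) \<partial>lborel) = (\<integral>x. u x \<partial>lborel) * (\<integral>y. v y \<partial>lborel)"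
proof -
  have [measurable]: "u \<in> borel_measurable borel" "v \<in> borel_measurable borel"
    using u v by (auto dest: borel_measurable_integrable)
  have "integrable (lborel \<Otimes>\<^sub>M lborel) (\<lambda>z. u (fst z) * v (snd z))"
  proof (rule lborel_pair.Fubini_integrable)
    have "integrable lborel (\<lambda>x. norm (u x) * (\<integral>y. norm (v y) \<partial>lborel))"
      using u by (intro integrable_mult_left integrable_norm)
    then show "integrable lborel (\<lambda>x. \<integral>y. norm (u (fst (x, y)) * v (snd (x, y))) \<partial>lborel)"
      by (simp add: norm_mult)
    show "AE x in lborel. integrable lborel (\<lambda>y. u (fst (x, y)) * v (snd (x, y)))"
      using v by simp
  qed (measurable)
  then show 1: "integrable lborel (\<lambda>z. u (fst z) * v (snd z))"
    by (simp only: lborel_prod)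
  have "(\<integral>z. u (fst z) * v (snd z) \<partial>lborel) = (\<integral>x. (\<integral>y. u x * v y \<partial>lborel) \<partial>lborel)"
    using lborel_pair.integral_fst'[of "\<lambda>z. u (fst z) * v (snd z)"] 1 by (simp add: lborel_prod)
  then show "(\<integral>z. u (fst z) * v (snd z) \<partial>lborel) = (\<integral>x. u x \<partial>lborel) * (\<integral>y. v y \<partial>lborel)"
    by simp
qed

lemma integrable_inverse_one_plus_square: "integrable lborel (\<lambda>x::real. inverse (1 + x\<^sup>2))"
  using integrable_inverse_1_plus_square by (simp add: set_integrable_def einterval_eq_UNIV)

text \<open>Decay of order 4 is enough: \<open>1 + (fst z)\<^sup>2\<close> and
  \<open>1 + (snd z)\<^sup>2\<close> are each at most \<open>(1 + norm z)\<^sup>2\<close>, so an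
  integrable tensor product dominates.\<close>

lemma rapid_integrable:
  assumes "rapid g" and [measurable]: "g \<in> borel_measurable borel"
  shows "integrable lborel g"
proof -
  obtain C where C: "\<And>z. (1 + norm z) ^ 4 * cmod (g z) \<le> C" using rapidE[OF assms(1), of 4] by blast
  have I: "integrable lborel (\<lambda>z::real\<times>real. C * (inverse (1 + (fst z)\<^sup>2) * inverse (1 + (snd z)\<^sup>2)))"
    by (intro integrable_mult_right integrable_tensor integrable_inverse_one_plus_square)
  show ?thesis
  proof (rule Bochner_Integration.integrable_bound[OF I])
    show "AE z in lborel. norm (g z) \<le> norm (C * (inverse (1 + (fst z)\<^sup>2) * inverse (1 + (snd z)\<^sup>2)))"
    proof (rule AE_I2)
      fix z :: "real \<times> real"
      have sq: "1 + t\<^sup>2 \<le> (1 + norm z)\<^sup>2" if "\<bar>t\<bar> \<le> norm z" for t :: real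
      proof -
        have "t\<^sup>2 \<le> (norm z)\<^sup>2" using power_mono[OF that, of 2] by simp
        moreover have "(1 + norm z)\<^sup>2 = 1 + (norm z)\<^sup>2 + 2 * norm z" by (simp add: power2_sum)
        ultimately show ?thesis using norm_ge_zero[of z] by linarith
      qed
      have "(1 + (fst z)\<^sup>2) * (1 + (snd z)\<^sup>2) \<le> (1 + norm z)\<^sup>2 * (1 + norm z)\<^sup>2"
        using norm_fst_le[of "fst z" "snd z"] norm_snd_le[of "snd z" "fst z"]
        by (intro mult_mono sq) auto
      also have "\<dots> = (1 + norm z) ^ 4" by (simp flip: power_add)
      finally have "(1 + (fst z)\<^sup>2) * (1 + (snd z)\<^sup>2) * cmod (g z) \<le> (1 + norm z) ^ 4 * cmod (g z)"
        by (rule mult_right_mono) simp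
      also note C[of z]
      finally have "cmod (g z) \<le> C / ((1 + (fst z)\<^sup>2) * (1 + (snd z)\<^sup>2))"
        by (simp add: pos_le_divide_eq add_pos_nonneg mult_ac)
      also have "\<dots> \<le> norm (C * (inverse (1 + (fst z)\<^sup>2) * inverse (1 + (snd z)\<^sup>2)))"
        by (simp add: divide_inverse)
      finally show "norm (g z) \<le> norm (C * (inverse (1 + (fst z)\<^sup>2) * inverse (1 + (snd z)\<^sup>2)))" .
    qed
  qed simp
qed

lemma schwartz2_continuous: "g \<in> schwartz2 \<Longrightarrow> continuous_on S g"
  by (intro continuous_on_differentiable schwartz2_differentiable)

lemma schwartz2_measurable: "g \<in> schwartz2 \<Longrightarrow> g \<in> borel_measurable borel"
  by (intro borel_measurable_continuous_onI schwartz2_continuous)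

lemma schwartz2_integrable: "g \<in> schwartz2 \<Longrightarrow> integrable lborel g"
  by (intro rapid_integrable schwartz2_rapid schwartz2_measurable)

lemma schwartz2_bounded:
  assumes "g \<in> schwartz2"
  obtains M where "M \<ge> 0" "\<And>z. cmod (g z) \<le> M"
proof (rule rapidE[OF schwartz2_rapid[OF assms], of 0])
  fix C assume "C \<ge> 0" "\<And>z. (1 + norm z) ^ 0 * cmod (g z) \<le> C"
  then show ?thesis by (intro that[of C]) simp_all
qed

text \<open>With the frequency as first argument, \<open>character (- x)\<close> is the kernel of
  the inverse transform at \<open>x\<close>, and multiplying characters adds frequencies.\<close>

definition character :: "real \<times> real \<Rightarrow> real \<times> real \<Rightarrow> complex" where
  "character \<xi> x = cis (- 2 * pi * (x \<bullet> \<xi>))"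

lemma character_measurable [measurable]: "character \<xi> \<in> borel_measurable borel"
  unfolding character_def by (intro borel_measurable_continuous_onI continuous_intros)

lemma norm_character [simp]: "cmod (character \<xi> x) = 1"
  by (simp add: character_def)

lemma fourier_character: "fourier g \<xi> = (\<integral>x. character \<xi> x * g x \<partial>lborel)"
  unfolding fourier_def character_def ..

lemma integrable_character_mult:
  assumes "integrable lborel g"
  shows "integrable lborel (\<lambda>x. character \<xi> x * g x)"
proof (rule Bochner_Integration.integrable_bound[OF assms])
  show "(\<lambda>x. character \<xi> x * g x) \<in> borel_measurable lborel"
    using borel_measurable_integrable[OF assms] by measurable
qed (simp add: norm_mult)

lemma fourier_bound: "cmod (fourier g \<xi>) \<le> (\<integral>x. cmod (g x) \<partial>lborel)"
  using integral_norm_bound[of lborel "\<lambda>x. character \<xi> x * g x"]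
  by (simp add: norm_mult fourier_character)

lemma inv_fourier_eq: "inv_fourier g x = fourier g (- x)"
  unfolding inv_fourier_def fourier_def by (simp add: inner_commute)

lemma fourier_add:
  "integrable lborel g \<Longrightarrow> integrable lborel h \<Longrightarrow> fourier (\<lambda>z. g z + h z) \<xi> = fourier g \<xi> + fourier h \<xi>"
  unfolding fourier_character by (simp add: distrib_left integrable_character_mult)

lemma fourier_cmult: "fourier (\<lambda>z. c * g z) \<xi> = c * fourier g \<xi>"
  unfolding fourier_character by (simp add: mult.left_commute)

text \<open>The transforms of \<open>dfreq1 g\<close> and \<open>dfreq2 g\<close> are the partial
  derivatives of \<open>fourier g\<close>. The linear forms are left unsimplified to match
  \<open>schwartz2_linear_mult\<close>.\<close>

definition dfreq1 :: "testfun \<Rightarrow> testfun" where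
  "dfreq1 g = (\<lambda>x. (- 2 * pi * \<i>) * (complex_of_real (1 * fst x + 0 * snd x) * g x))"

definition dfreq2 :: "testfun \<Rightarrow> testfun" where
  "dfreq2 g = (\<lambda>x. (- 2 * pi * \<i>) * (complex_of_real (0 * fst x + 1 * snd x) * g x))"

lemma schwartz2_dfreq: "g \<in> schwartz2 \<Longrightarrow> dfreq1 g \<in> schwartz2" "g \<in> schwartz2 \<Longrightarrow> dfreq2 g \<in> schwartz2"
  unfolding dfreq1_def dfreq2_def by (intro schwartz2_cmult schwartz2_linear_mult; assumption)+

lemma cis_taylor: "cmod (cis t - 1 - \<i> * t) \<le> t\<^sup>2 / 2"
proof -
  have "{..1::nat} = {0, 1}" by auto
  then show ?thesis
    using iexp_approx1[of t 1] by (simp add: cis_conv_exp algebra_simps power2_eq_square numeral_2_eq_2)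
qed

text \<open>The increment of the character is compared pointwise with its linearisation, where the
  Taylor remainder of \<open>cis\<close> is quadratic. Integration against \<open>g\<close> leaves a
  remainder of at most \<open>K * (norm (\<eta> - \<xi>))\<^sup>2\<close>, so no limit has to be
  taken under the integral.\<close>

lemma fourier_has_derivative:
  assumes g: "g \<in> schwartz2"
  shows "(fourier g has_derivative
      (\<lambda>h. fst h *\<^sub>R fourier (dfreq1 g) \<xi> + snd h *\<^sub>R fourier (dfreq2 g) \<xi>)) (at \<xi>)"
proof -
  \<comment> \<open>The factor \<open>2 * pi\<^sup>2\<close> is \<open>(2 * pi)\<^sup>2 / 2\<close>,
    from the remainder \<open>t\<^sup>2 / 2\<close> at
    \<open>t = - 2 * pi * (x \<bullet> h)\<close>; the second moment of \<open>g\<close> is finite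
    by its decay.\<close>
  define K where "K = 2 * pi\<^sup>2 * (\<integral>x. (norm x)\<^sup>2 * cmod (g x) \<partial>lborel)"
  have "rapid (\<lambda>x. complex_of_real ((norm x)\<^sup>2) * g x)"
    by (rule rapid_dominated[OF schwartz2_rapid[OF g], where A = 1 and n = 2])
       (auto simp: norm_mult norm_power intro!: mult_right_mono power_mono)
  moreover have "(\<lambda>x. complex_of_real ((norm x)\<^sup>2) * g x) \<in> borel_measurable borel"
    using schwartz2_measurable[OF g] by measurable
  ultimately have "integrable lborel (\<lambda>x. complex_of_real ((norm x)\<^sup>2) * g x)"
    by (rule rapid_integrable)
  then have int2: "integrable lborel (\<lambda>x. (norm x)\<^sup>2 * cmod (g x))"
    by (auto dest: integrable_norm simp: norm_mult norm_power)
  note ig = integrable_character_mult[OF schwartz2_integrable]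
  have main: "cmod ((fourier g \<eta> - fourier g \<xi>) -
      (fst (\<eta> - \<xi>) *\<^sub>R fourier (dfreq1 g) \<xi> + snd (\<eta> - \<xi>) *\<^sub>R fourier (dfreq2 g) \<xi>)) \<le> K * (norm (\<eta> - \<xi>))\<^sup>2" for \<eta>
  proof -
    define h where "h = \<eta> - \<xi>"
    define t where "t x = - 2 * pi * (x \<bullet> h)" for x :: "real \<times> real"
    have eq: "(character \<eta> x * g x - character \<xi> x * g x) -
        (of_real (fst h) * (character \<xi> x * dfreq1 g x) + of_real (snd h) * (character \<xi> x * dfreq2 g x))
        = character \<xi> x * (cis (t x) - 1 - \<i> * t x) * g x" for x
    proof -
      have "character \<eta> x = character \<xi> x * cis (t x)"
        unfolding character_def t_def h_def cis_mult by (simp add: inner_diff_right algebra_simps)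
      moreover have "of_real (fst h) * (character \<xi> x * dfreq1 g x) + of_real (snd h) * (character \<xi> x * dfreq2 g x)
         = character \<xi> x * (\<i> * t x) * g x"
        unfolding dfreq1_def dfreq2_def t_def by (simp add: inner_prod_def algebra_simps)
      ultimately show ?thesis by (simp add: algebra_simps)
    qed
    have I1: "integrable lborel (\<lambda>x. (character \<eta> x * g x - character \<xi> x * g x) -
        (of_real (fst h) * (character \<xi> x * dfreq1 g x) + of_real (snd h) * (character \<xi> x * dfreq2 g x)))"
      by (intro Bochner_Integration.integrable_diff Bochner_Integration.integrable_add integrable_mult_right ig g schwartz2_dfreq)
    have "(fourier g \<eta> - fourier g \<xi>) - (fst h *\<^sub>R fourier (dfreq1 g) \<xi> + snd h *\<^sub>R fourier (dfreq2 g) \<xi>)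
      = (\<integral>x. (character \<eta> x * g x - character \<xi> x * g x) -
        (of_real (fst h) * (character \<xi> x * dfreq1 g x) + of_real (snd h) * (character \<xi> x * dfreq2 g x)) \<partial>lborel)"
      unfolding fourier_character scaleR_conv_of_real
      using ig[OF g] ig[OF schwartz2_dfreq(1)[OF g]] ig[OF schwartz2_dfreq(2)[OF g]]
      by (simp add: Bochner_Integration.integral_diff Bochner_Integration.integral_add)
    also have "cmod \<dots> \<le> (\<integral>x. 2 * pi\<^sup>2 * (norm h)\<^sup>2 * ((norm x)\<^sup>2 * cmod (g x)) \<partial>lborel)"
    proof (rule Bochner_Integration.integral_norm_bound_integral[OF I1])
      show "integrable lborel (\<lambda>x. 2 * pi\<^sup>2 * (norm h)\<^sup>2 * ((norm x)\<^sup>2 * cmod (g x)))"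
        by (intro integrable_mult_right int2)
      fix x :: "real \<times> real"
      have "(t x)\<^sup>2 / 2 = 2 * pi\<^sup>2 * (x \<bullet> h)\<^sup>2"
        unfolding t_def by (simp add: power_mult_distrib)
      also have "\<dots> \<le> 2 * pi\<^sup>2 * (norm x * norm h)\<^sup>2"
        using power_mono[OF Cauchy_Schwarz_ineq2[of x h], of 2] by (intro mult_left_mono) auto
      finally have "cmod (cis (t x) - 1 - \<i> * t x) * cmod (g x) \<le> 2 * pi\<^sup>2 * (norm x * norm h)\<^sup>2 * cmod (g x)"
        using cis_taylor[of "t x"] by (intro mult_right_mono) auto
      then show "cmod ((character \<eta> x * g x - character \<xi> x * g x) -
        (of_real (fst h) * (character \<xi> x * dfreq1 g x) + of_real (snd h) * (character \<xi> x * dfreq2 g x)))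
         \<le> 2 * pi\<^sup>2 * (norm h)\<^sup>2 * ((norm x)\<^sup>2 * cmod (g x))"
        unfolding eq by (simp add: norm_mult power_mult_distrib mult_ac)
    qed
    also have "\<dots> = K * (norm h)\<^sup>2" unfolding K_def by simp
    finally show ?thesis unfolding h_def .
  qed
  show ?thesis
  proof (rule has_derivativeI_sandwich[where e = 1 and H = "\<lambda>\<eta>. K * norm (\<eta> - \<xi>)"])
    show "bounded_linear (\<lambda>h. fst h *\<^sub>R fourier (dfreq1 g) \<xi> + snd h *\<^sub>R fourier (dfreq2 g) \<xi>)"
      by (intro bounded_linear_intros)
    have "((\<lambda>\<eta>. K * norm (\<eta> - \<xi>)) \<longlongrightarrow> K * norm (\<xi> - \<xi>)) (at \<xi>)" by (intro tendsto_intros)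
    then show "((\<lambda>\<eta>. K * norm (\<eta> - \<xi>)) \<longlongrightarrow> 0) (at \<xi>)" by simp
    fix \<eta> assume "\<eta> \<noteq> \<xi>"
    then have "norm (\<eta> - \<xi>) > 0" by simp
    then show "cmod (fourier g \<eta> - fourier g \<xi> -
        (fst (\<eta> - \<xi>) *\<^sub>R fourier (dfreq1 g) \<xi> + snd (\<eta> - \<xi>) *\<^sub>R fourier (dfreq2 g) \<xi>)) / norm (\<eta> - \<xi>)
        \<le> K * norm (\<eta> - \<xi>)"
      using main[of \<eta>] by (subst pos_divide_le_eq) (auto simp: power2_eq_square mult_ac)
  qed simp
qed


lemma schwartz2_character_mult:
  assumes "g \<in> schwartz2"
  shows "(\<lambda>x. character \<xi> x * g x) \<in> schwartz2"
    and "partial1 (\<lambda>x. character \<xi> x * g x) = (\<lambda>x. character \<xi> x * (partial1 g x + (- 2 * pi * \<i> * of_real (fst \<xi>)) * g x))"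
    and "partial2 (\<lambda>x. character \<xi> x * g x) = (\<lambda>x. character \<xi> x * (partial2 g x + (- 2 * pi * \<i> * of_real (snd \<xi>)) * g x))"
proof -
  define X where "X = {\<lambda>x. character \<xi> x * g x |g. g \<in> schwartz2}"
  have XI: "(\<lambda>x. character \<xi> x * g x) \<in> X" if "g \<in> schwartz2" for g
    unfolding X_def using that by blast
  have D: "((\<lambda>x. character \<xi> x * g x) has_derivative
      (\<lambda>h. fst h *\<^sub>R (character \<xi> z * (partial1 g z + (- 2 * pi * \<i> * of_real (fst \<xi>)) * g z))
         + snd h *\<^sub>R (character \<xi> z * (partial2 g z + (- 2 * pi * \<i> * of_real (snd \<xi>)) * g z)))) (at z)"
    if g: "g \<in> schwartz2" for g z
  proof -
    have 1: "((\<lambda>x. - 2 * pi * (x \<bullet> \<xi>)) has_derivative (\<lambda>h. - 2 * pi * (h \<bullet> \<xi>))) (at z)"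
      by (auto intro!: derivative_eq_intros)
    have 2: "(cis has_derivative (\<lambda>t. t *\<^sub>R (\<i> * cis s))) (at s)" for s
      unfolding has_vector_derivative_def[symmetric] cis_conv_exp
      by (auto intro!: derivative_eq_intros has_vector_derivative_real_field simp: mult.commute)
    have "(character \<xi> has_derivative (\<lambda>h. (- 2 * pi * (h \<bullet> \<xi>)) *\<^sub>R (\<i> * character \<xi> z))) (at z)"
      unfolding character_def by (rule has_derivative_compose[OF 1 2])
    then have "((\<lambda>x. character \<xi> x * g x) has_derivative (\<lambda>h. character \<xi> z * (fst h *\<^sub>R partial1 g z + snd h *\<^sub>R partial2 g z)
        + (- 2 * pi * (h \<bullet> \<xi>)) *\<^sub>R (\<i> * character \<xi> z) * g z)) (at z)"
      by (rule has_derivative_mult[OF _ schwartz2_has_derivative[OF g]])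
    moreover have "character \<xi> z * (fst h *\<^sub>R partial1 g z + snd h *\<^sub>R partial2 g z)
        + (- 2 * pi * (h \<bullet> \<xi>)) *\<^sub>R (\<i> * character \<xi> z) * g z
       = fst h *\<^sub>R (character \<xi> z * (partial1 g z + (- 2 * pi * \<i> * of_real (fst \<xi>)) * g z))
         + snd h *\<^sub>R (character \<xi> z * (partial2 g z + (- 2 * pi * \<i> * of_real (snd \<xi>)) * g z))" for h
      unfolding scaleR_conv_of_real inner_prod_def inner_real_def of_real_add of_real_mult of_real_minus
        of_real_numeral by algebra
    ultimately show ?thesis by (simp only:)
  qed
  show "(\<lambda>x. character \<xi> x * g x) \<in> schwartz2"
  proof (rule schwartz2_coinduct'[OF XI[OF assms]])
    fix u assume "u \<in> X"
    then obtain g where u: "u = (\<lambda>x. character \<xi> x * g x)" "g \<in> schwartz2" unfolding X_def by blast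
    show "rapid u" unfolding u(1)
      by (rule rapid_dominated[OF schwartz2_rapid[OF u(2)], where A = 1 and n = 0]) (auto simp: norm_mult)
    show "\<exists>p\<in>X. \<exists>q\<in>X. \<forall>z. (u has_derivative (\<lambda>k. fst k *\<^sub>R p z + snd k *\<^sub>R q z)) (at z)"
      unfolding u(1)
      by (rule bexI[OF _ XI[OF schwartz2_add[OF schwartz2_partial1[OF u(2)] schwartz2_cmult[OF u(2)]]]],
          rule bexI[OF _ XI[OF schwartz2_add[OF schwartz2_partial2[OF u(2)] schwartz2_cmult[OF u(2)]]]],
          rule allI, rule D, rule u(2))
  qed
  show "partial1 (\<lambda>x. character \<xi> x * g x) = (\<lambda>x. character \<xi> x * (partial1 g x + (- 2 * pi * \<i> * of_real (fst \<xi>)) * g x))"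
    "partial2 (\<lambda>x. character \<xi> x * g x) = (\<lambda>x. character \<xi> x * (partial2 g x + (- 2 * pi * \<i> * of_real (snd \<xi>)) * g x))"
    using D[OF assms, unfolded partials_iff] by (intro ext; simp)+
qed

text \<open>A majorant of order \<open>1 / (1 + t\<^sup>2)\<close> does two jobs: for
  \<open>h\<close> it forces the boundary values at both infinities to vanish, for \<open>h'\<close>
  it gives integrability on the line.\<close>

lemma integral_derivative_zero:
  fixes h h' :: "real \<Rightarrow> complex"
  assumes D: "\<And>t. (h has_vector_derivative h' t) (at t)"
    and cont: "\<And>t. isCont h' t"
    and bh: "\<And>t. cmod (h t) \<le> C * inverse (1 + t\<^sup>2)"
    and bh': "\<And>t. cmod (h' t) \<le> C' * inverse (1 + t\<^sup>2)"
  shows "(\<integral>t. h' t \<partial>lborel) = 0"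
proof -
  have [measurable]: "h' \<in> borel_measurable borel"
    by (intro borel_measurable_continuous_onI continuous_at_imp_continuous_on) (use cont in blast)
  have int: "integrable lborel h'"
  proof (rule Bochner_Integration.integrable_bound[OF integrable_mult_right[OF integrable_inverse_one_plus_square]])
    show "AE t in lborel. norm (h' t) \<le> norm (C' * inverse (1 + t\<^sup>2))"
      using bh' by (intro AE_I2) (simp, meson abs_ge_self order_trans)
  qed simp
  have lim_top: "((\<lambda>t::real. C * inverse (1 + t\<^sup>2)) \<longlongrightarrow> 0) at_top" by real_asymp
  have lim_bot: "((\<lambda>t::real. C * inverse (1 + t\<^sup>2)) \<longlongrightarrow> 0) at_bot" by real_asymp
  have "(h \<longlongrightarrow> 0) at_top" "(h \<longlongrightarrow> 0) at_bot"
    by (rule Lim_null_comparison[OF _ lim_top] Lim_null_comparison[OF _ lim_bot]; use bh in simp)+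
  then have "(LBINT t=-\<infinity>..\<infinity>. h' t) = 0 - 0"
    by (intro interval_integral_FTC_integrable[where F = h])
       (use D cont int in \<open>auto simp: ereal_tendsto_simps set_integrable_def einterval_eq_UNIV\<close>)
  then show ?thesis
    by (simp add: interval_lebesgue_integral_def set_lebesgue_integral_def einterval_eq_UNIV)
qed

lemma schwartz2_slice_bound:
  assumes "g \<in> schwartz2"
  shows "\<exists>C. \<forall>x y. cmod (g (x, y)) \<le> C * inverse (1 + x\<^sup>2) \<and> cmod (g (x, y)) \<le> C * inverse (1 + y\<^sup>2)"
proof -
  obtain C where C: "\<And>z. (1 + norm z) ^ 2 * cmod (g z) \<le> C" using rapidE[OF schwartz2_rapid[OF assms], of 2] by blast
  have *: "cmod (g z) \<le> C * inverse (1 + t\<^sup>2)" if "\<bar>t\<bar> \<le> norm z" for t z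
  proof -
    have "t\<^sup>2 \<le> (norm z)\<^sup>2" using power_mono[OF that, of 2] by simp
    moreover have "(1 + norm z)\<^sup>2 = 1 + (norm z)\<^sup>2 + 2 * norm z" by (simp add: power2_sum)
    ultimately have "1 + t\<^sup>2 \<le> (1 + norm z)\<^sup>2" using norm_ge_zero[of z] by linarith
    then have "(1 + t\<^sup>2) * cmod (g z) \<le> (1 + norm z)\<^sup>2 * cmod (g z)"
      by (rule mult_right_mono) simp
    also note C[of z]
    finally have "cmod (g z) \<le> C / (1 + t\<^sup>2)"
      by (simp add: pos_le_divide_eq add_pos_nonneg mult_ac)
    then show ?thesis by (simp add: divide_inverse)
  qed
  show ?thesis
  proof (intro exI[of _ C] allI conjI *)
    show "\<bar>x\<bar> \<le> norm (x, y)" "\<bar>y\<bar> \<le> norm (x, y)" for x y :: real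
      using norm_fst_le[of x y] norm_snd_le[of y x] by simp_all
  qed
qed

lemma integral_partial_zero:
  assumes g: "g \<in> schwartz2"
  shows "(\<integral>z. partial1 g z \<partial>lborel) = 0" and "(\<integral>z. partial2 g z \<partial>lborel) = 0"
proof -
  note p1 = schwartz2_partial1[OF g] and p2 = schwartz2_partial2[OF g]
  obtain C where C: "\<forall>x y. cmod (g (x, y)) \<le> C * inverse (1 + x\<^sup>2) \<and> cmod (g (x, y)) \<le> C * inverse (1 + y\<^sup>2)"
    using schwartz2_slice_bound[OF g] by (rule exE)
  obtain C1 where C1: "\<forall>x y. cmod (partial1 g (x, y)) \<le> C1 * inverse (1 + x\<^sup>2) \<and> cmod (partial1 g (x, y)) \<le> C1 * inverse (1 + y\<^sup>2)"
    using schwartz2_slice_bound[OF p1] by (rule exE)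
  obtain C2 where C2: "\<forall>x y. cmod (partial2 g (x, y)) \<le> C2 * inverse (1 + x\<^sup>2) \<and> cmod (partial2 g (x, y)) \<le> C2 * inverse (1 + y\<^sup>2)"
    using schwartz2_slice_bound[OF p2] by (rule exE)
  have z1: "(\<integral>x. partial1 g (x, y) \<partial>lborel) = 0" for y
  proof (rule integral_derivative_zero)
    show "((\<lambda>x. g (x, y)) has_vector_derivative partial1 g (x, y)) (at x)" for x
      by (rule has_vector_derivative_partial1[OF schwartz2_differentiable[OF g]])
    have "continuous_on UNIV (\<lambda>x. partial1 g (x, y))"
      by (intro continuous_on_compose2[OF schwartz2_continuous[OF p1, of UNIV]] continuous_intros) auto
    then show "isCont (\<lambda>x. partial1 g (x, y)) x" for x
      by (simp add: continuous_on_eq_continuous_at)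
  qed (use C C1 in blast)+
  have z2: "(\<integral>y. partial2 g (x, y) \<partial>lborel) = 0" for x
  proof (rule integral_derivative_zero)
    show "((\<lambda>y. g (x, y)) has_vector_derivative partial2 g (x, y)) (at y)" for y
      by (rule has_vector_derivative_partial2[OF schwartz2_differentiable[OF g]])
    have "continuous_on UNIV (\<lambda>y. partial2 g (x, y))"
      by (intro continuous_on_compose2[OF schwartz2_continuous[OF p2, of UNIV]] continuous_intros) auto
    then show "isCont (\<lambda>y. partial2 g (x, y)) y" for y
      by (simp add: continuous_on_eq_continuous_at)
  qed (use C C2 in blast)+
  have "(\<integral>z. partial1 g z \<partial>(lborel \<Otimes>\<^sub>M lborel)) = (\<integral>y. (\<integral>x. partial1 g (x, y) \<partial>lborel) \<partial>lborel)"
    using lborel_pair.integral_snd[of "\<lambda>x y. partial1 g (x, y)"] schwartz2_integrable[OF p1]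
    by (simp add: lborel_prod)
  then show "(\<integral>z. partial1 g z \<partial>lborel) = 0" by (simp add: z1 lborel_prod)
  have "(\<integral>z. partial2 g z \<partial>(lborel \<Otimes>\<^sub>M lborel)) = (\<integral>x. (\<integral>y. partial2 g (x, y) \<partial>lborel) \<partial>lborel)"
    using lborel_pair.integral_fst'[of "partial2 g"] schwartz2_integrable[OF p2]
    by (simp add: lborel_prod)
  then show "(\<integral>z. partial2 g z \<partial>lborel) = 0" by (simp add: z2 lborel_prod)
qed

text \<open>Integration by parts: each partial derivative of \<open>character \<xi> x * g x\<close>
  has integral zero, and the product rule splits it into the character times a partial derivative of
  \<open>g\<close> and a frequency multiple of the character times \<open>g\<close>.\<close>

lemma fourier_partial:
  assumes g: "g \<in> schwartz2"
  shows "fourier (partial1 g) \<xi> = 2 * pi * \<i> * of_real (fst \<xi>) * fourier g \<xi>"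
    and "fourier (partial2 g) \<xi> = 2 * pi * \<i> * of_real (snd \<xi>) * fourier g \<xi>"
proof -
  have "fourier (\<lambda>x. partial1 g x + (- 2 * pi * \<i> * of_real (fst \<xi>)) * g x) \<xi> = 0"
    unfolding fourier_character
    using integral_partial_zero(1)[OF schwartz2_character_mult(1)[OF g]] schwartz2_character_mult(2)[OF g] by simp
  moreover have "fourier (\<lambda>x. partial1 g x + (- 2 * pi * \<i> * of_real (fst \<xi>)) * g x) \<xi>
      = fourier (partial1 g) \<xi> + (- 2 * pi * \<i> * of_real (fst \<xi>)) * fourier g \<xi>"
    by (subst fourier_add, (intro schwartz2_integrable schwartz2_partial1 schwartz2_cmult g)+, subst fourier_cmult, rule refl)
  ultimately show "fourier (partial1 g) \<xi> = 2 * pi * \<i> * of_real (fst \<xi>) * fourier g \<xi>"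
    by (simp add: add_eq_0_iff2)
  have "fourier (\<lambda>x. partial2 g x + (- 2 * pi * \<i> * of_real (snd \<xi>)) * g x) \<xi> = 0"
    unfolding fourier_character
    using integral_partial_zero(2)[OF schwartz2_character_mult(1)[OF g]] schwartz2_character_mult(3)[OF g] by simp
  moreover have "fourier (\<lambda>x. partial2 g x + (- 2 * pi * \<i> * of_real (snd \<xi>)) * g x) \<xi>
      = fourier (partial2 g) \<xi> + (- 2 * pi * \<i> * of_real (snd \<xi>)) * fourier g \<xi>"
    by (subst fourier_add, (intro schwartz2_integrable schwartz2_partial2 schwartz2_cmult g)+, subst fourier_cmult, rule refl)
  ultimately show "fourier (partial2 g) \<xi> = 2 * pi * \<i> * of_real (snd \<xi>) * fourier g \<xi>"
    by (simp add: add_eq_0_iff2)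
qed

text \<open>One factor of the weight is traded for one derivative of \<open>g\<close>, since
  multiplying a transform by a coordinate amounts, up to a constant, to transforming a partial
  derivative. The induction on the exponent must therefore range over all \<open>g\<close>.\<close>

lemma rapid_fourier:
  assumes "g \<in> schwartz2"
  shows "rapid (fourier g)"
proof -
  have "\<exists>C. \<forall>\<xi>. (1 + norm \<xi>) ^ k * cmod (fourier g \<xi>) \<le> C" if "g \<in> schwartz2" for k g
    using that
  proof (induction k arbitrary: g)
    case 0
    then show ?case using fourier_bound[of g] by auto
  next
    case (Suc k)
    from Suc.IH[OF Suc.prems] obtain C where C: "\<And>\<xi>. (1 + norm \<xi>) ^ k * cmod (fourier g \<xi>) \<le> C" by blast
    from Suc.IH[OF schwartz2_partial1[OF Suc.prems]] obtain C1
      where C1: "\<And>\<xi>. (1 + norm \<xi>) ^ k * cmod (fourier (partial1 g) \<xi>) \<le> C1" by blast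
    from Suc.IH[OF schwartz2_partial2[OF Suc.prems]] obtain C2
      where C2: "\<And>\<xi>. (1 + norm \<xi>) ^ k * cmod (fourier (partial2 g) \<xi>) \<le> C2" by blast
    have "(1 + norm \<xi>) ^ Suc k * cmod (fourier g \<xi>) \<le> C + C1 + C2" for \<xi>
    proof -
      let ?a = "cmod (fourier g \<xi>)" and ?P = "(1 + norm \<xi>) ^ k"
      have le: "t * ?a \<le> 2 * pi * t * ?a" if "t \<ge> 0" for t
        using that pi_ge_two by (intro mult_right_mono) (auto intro: mult_right_mono[of 1 "2 * pi" t, simplified])
      have "cmod (fourier (partial1 g) \<xi>) = 2 * pi * \<bar>fst \<xi>\<bar> * ?a"
        "cmod (fourier (partial2 g) \<xi>) = 2 * pi * \<bar>snd \<xi>\<bar> * ?a"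
        by (simp_all add: fourier_partial[OF Suc.prems] norm_mult)
      then have "\<bar>fst \<xi>\<bar> * ?a \<le> cmod (fourier (partial1 g) \<xi>)" "\<bar>snd \<xi>\<bar> * ?a \<le> cmod (fourier (partial2 g) \<xi>)"
        using le[of "\<bar>fst \<xi>\<bar>"] le[of "\<bar>snd \<xi>\<bar>"] by simp_all
      moreover have "norm \<xi> * ?a \<le> (\<bar>fst \<xi>\<bar> + \<bar>snd \<xi>\<bar>) * ?a"
        using norm_Pair_le[of "fst \<xi>" "snd \<xi>"] by (intro mult_right_mono) auto
      ultimately have "(1 + norm \<xi>) * ?a \<le> ?a + cmod (fourier (partial1 g) \<xi>) + cmod (fourier (partial2 g) \<xi>)"
        by (simp add: distrib_right)
      then have "?P * ((1 + norm \<xi>) * ?a) \<le> ?P * (?a + cmod (fourier (partial1 g) \<xi>) + cmod (fourier (partial2 g) \<xi>))"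
        by (intro mult_left_mono) auto
      with C[of \<xi>] C1[of \<xi>] C2[of \<xi>] show ?thesis by (simp add: algebra_simps)
    qed
    then show ?case by blast
  qed
  with assms show ?thesis unfolding rapid_def by blast
qed

text \<open>Derivatives of transforms are transforms again, so the image of the Schwartz class is
  itself a family to which the coinduction applies.\<close>

theorem fourier_schwartz2:
  assumes "g \<in> schwartz2"
  shows "fourier g \<in> schwartz2"
proof -
  define X where "X = fourier ` schwartz2"
  have XI: "fourier g \<in> X" if "g \<in> schwartz2" for g
    unfolding X_def using that by (rule imageI)
  show ?thesis
  proof (rule schwartz2_coinduct'[OF XI[OF assms]])
    fix u assume "u \<in> X"
    then obtain g where u: "u = fourier g" "g \<in> schwartz2" unfolding X_def by blast
    show "rapid u" unfolding u(1) by (rule rapid_fourier[OF u(2)])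
    show "\<exists>p\<in>X. \<exists>q\<in>X. \<forall>z. (u has_derivative (\<lambda>k. fst k *\<^sub>R p z + snd k *\<^sub>R q z)) (at z)"
      unfolding u(1)
      by (intro bexI[OF _ XI[OF schwartz2_dfreq(1)[OF u(2)]]] bexI[OF _ XI[OF schwartz2_dfreq(2)[OF u(2)]]]
            allI fourier_has_derivative u)
  qed
qed

lemma inv_fourier_schwartz2:
  assumes "g \<in> schwartz2"
  shows "inv_fourier g \<in> schwartz2"
proof -
  have "inv_fourier g = (\<lambda>x. fourier g (-1 * fst x, -1 * snd x))"
    by (auto simp: inv_fourier_eq uminus_prod_def)
  then show ?thesis
    using schwartz2_dilation[OF fourier_schwartz2[OF assms], of "-1" "-1"] by simp
qed

section \<open>Gaussian regularisation and Fourier inversion\<close>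

lemma lborel_scale:
  fixes f :: "'a::euclidean_space \<Rightarrow> 'b::{banach, second_countable_topology}"
  assumes "integrable lborel f" "c \<noteq> 0"
  shows "(\<integral>x. f x \<partial>lborel) = \<bar>c\<bar> ^ DIM('a) *\<^sub>R (\<integral>x. f (t + c *\<^sub>R x) \<partial>lborel)"
proof -
  have [measurable]: "f \<in> borel_measurable borel" using borel_measurable_integrable[OF assms(1)] by simp
  have "(\<integral>x. f x \<partial>lborel) = (\<integral>x. f x \<partial>density (distr lborel borel (\<lambda>x. t + c *\<^sub>R x)) (\<lambda>_. \<bar>c\<bar> ^ DIM('a)))"
    using lborel_affine[OF assms(2), of t] by simp
  also have "\<dots> = (\<integral>x. \<bar>c\<bar> ^ DIM('a) *\<^sub>R f x \<partial>distr lborel borel (\<lambda>x. t + c *\<^sub>R x))"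
    by (subst integral_density) auto
  also have "\<dots> = (\<integral>x. \<bar>c\<bar> ^ DIM('a) *\<^sub>R f (t + c *\<^sub>R x) \<partial>lborel)"
    by (subst integral_distr) auto
  finally show ?thesis by simp
qed

lemma nn_integral_reflect_translate:
  fixes f :: "'a::euclidean_space \<Rightarrow> ennreal"
  assumes [measurable]: "f \<in> borel_measurable borel"
  shows "(\<integral>\<^sup>+x. f (t - x) \<partial>lborel) = (\<integral>\<^sup>+x. f x \<partial>lborel)" "(\<integral>\<^sup>+x. f (x - t) \<partial>lborel) = (\<integral>\<^sup>+x. f x \<partial>lborel)"
proof -
  have "(\<integral>\<^sup>+x. f x \<partial>lborel) = (\<integral>\<^sup>+x. f x \<partial>density (distr lborel borel (\<lambda>x. t + (-1) *\<^sub>R x)) (\<lambda>_. ennreal (\<bar>-1\<bar> ^ DIM('a))))"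
    using lborel_affine[of "-1" t] by simp
  also have "\<dots> = (\<integral>\<^sup>+x. f (t - x) \<partial>lborel)"
    by (simp add: nn_integral_density nn_integral_distr)
  finally show "(\<integral>\<^sup>+x. f (t - x) \<partial>lborel) = (\<integral>\<^sup>+x. f x \<partial>lborel)" by simp
  have "(\<integral>\<^sup>+x. f x \<partial>lborel) = (\<integral>\<^sup>+x. f x \<partial>distr lborel borel ((+) (- t)))"
    by (subst lborel_distr_plus) simp
  also have "\<dots> = (\<integral>\<^sup>+x. f (x - t) \<partial>lborel)"
    by (simp add: nn_integral_distr)
  finally show "(\<integral>\<^sup>+x. f (x - t) \<partial>lborel) = (\<integral>\<^sup>+x. f x \<partial>lborel)" by simp
qed

section \<open>Gaussian densities and their windows\<close>

definition gauss :: "real \<Rightarrow> real \<times> real \<Rightarrow> real" where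
  "gauss \<sigma> z = normal_density 0 \<sigma> (fst z) * normal_density 0 \<sigma> (snd z)"

text \<open>The characteristic function of the centred normal law of deviation
  \<open>\<sigma>\<close>, at argument \<open>2 * pi * t\<close>. For positive
  \<open>\<sigma>\<close> it is integrable, it increases to 1 as \<open>\<sigma>\<close> decreases
  to 0, and its transform is the normal density itself.\<close>

definition gwindow :: "real \<Rightarrow> real \<Rightarrow> real" where
  "gwindow \<sigma> t = exp (- (2 * pi * \<sigma> * t)\<^sup>2 / 2)"

definition window :: "real \<Rightarrow> real \<times> real \<Rightarrow> real" where
  "window \<sigma> \<xi> = gwindow \<sigma> (fst \<xi>) * gwindow \<sigma> (snd \<xi>)"

lemma gwindow_measurable [measurable]: "gwindow \<sigma> \<in> borel_measurable borel"
  unfolding gwindow_def[abs_def] by measurable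

lemma gwindow_eq:
  "gwindow \<sigma> t = sqrt (2 * pi) * std_normal_density (0 + (2 * pi * \<sigma>) * t)"
  unfolding gwindow_def std_normal_density_def by simp

lemma integrable_gwindow: 
  assumes "\<sigma> > 0" shows "integrable lborel (gwindow \<sigma>)"
proof -
  have "integrable lborel (\<lambda>t. std_normal_density (0 + (2 * pi * \<sigma>) * t))"
    by (rule lborel_integrable_real_affine) (use assms in auto)
  then show ?thesis unfolding gwindow_eq[abs_def] by (intro integrable_mult_right)
qed

lemma gwindow_fourier:
  assumes "\<sigma> > 0"
  shows "(\<integral>t. cis (- 2 * pi * (t * x)) * complex_of_real (gwindow \<sigma> t) \<partial>lborel) = normal_density 0 \<sigma> x"
proof -
  \<comment> \<open>With the substitution \<open>u = c * t\<close> and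
    \<open>s = - x / \<sigma>\<close> the phase \<open>s * u\<close> becomes
    \<open>- 2 * pi * (t * x)\<close>: the characteristic function of the standard normal law at
    \<open>s\<close> is the wanted integral up to the constant
    \<open>c / sqrt (2 * pi)\<close>.\<close>
  define c where "c = 2 * pi * \<sigma>"
  define s where "s = - x / \<sigma>"
  have c: "c > 0" using assms by (simp add: c_def)
  have "exp (- s\<^sup>2 / 2) = char std_normal_distribution s"
    by (simp add: char_std_normal_distribution)
  also have "\<dots> = (\<integral>u. std_normal_density u *\<^sub>R iexp (s * u) \<partial>lborel)"
    unfolding char_def by (subst integral_density) auto
  also have "\<dots> = \<bar>c\<bar> *\<^sub>R (\<integral>t. std_normal_density (0 + c * t) *\<^sub>R iexp (s * (0 + c * t)) \<partial>lborel)"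
    using c by (intro lborel_integral_real_affine) simp
  also have "(\<lambda>t. std_normal_density (0 + c * t) *\<^sub>R iexp (s * (0 + c * t)))
      = (\<lambda>t. complex_of_real (1 / sqrt (2 * pi)) * (cis (- 2 * pi * (t * x)) * complex_of_real (gwindow \<sigma> t)))"
  proof
    fix t
    have "s * (0 + c * t) = - 2 * pi * (t * x)" using assms by (simp add: s_def c_def)
    moreover have "std_normal_density (0 + c * t) = 1 / sqrt (2 * pi) * gwindow \<sigma> t"
      unfolding gwindow_eq c_def by simp
    ultimately show "std_normal_density (0 + c * t) *\<^sub>R iexp (s * (0 + c * t)) =
        complex_of_real (1 / sqrt (2 * pi)) * (cis (- 2 * pi * (t * x)) * complex_of_real (gwindow \<sigma> t))"
      by (simp only: cis_conv_exp scaleR_conv_of_real of_real_mult mult_ac)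
  qed
  also have "\<bar>c\<bar> *\<^sub>R (\<integral>t. complex_of_real (1 / sqrt (2 * pi)) * (cis (- 2 * pi * (t * x)) * complex_of_real (gwindow \<sigma> t)) \<partial>lborel)
     = complex_of_real (c / sqrt (2 * pi)) * (\<integral>t. cis (- 2 * pi * (t * x)) * complex_of_real (gwindow \<sigma> t) \<partial>lborel)"
    using c by (subst integral_mult_right_zero) (simp add: scaleR_conv_of_real)
  finally have "(\<integral>t. cis (- 2 * pi * (t * x)) * complex_of_real (gwindow \<sigma> t) \<partial>lborel)
      = complex_of_real (exp (- s\<^sup>2 / 2)) / complex_of_real (c / sqrt (2 * pi))"
    using c by (simp add: field_simps)
  also have "\<dots> = complex_of_real (exp (- s\<^sup>2 / 2) / (c / sqrt (2 * pi)))" by simp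
  also have "exp (- s\<^sup>2 / 2) / (c / sqrt (2 * pi)) = normal_density 0 \<sigma> x"
  proof -
    have "sqrt (2 * pi * \<sigma>\<^sup>2) = sqrt (2 * pi) * \<sigma>" using assms by (simp add: real_sqrt_mult)
    moreover have "sqrt (2 * pi) / c = 1 / (sqrt (2 * pi) * \<sigma>)"
      unfolding c_def using assms by (simp add: field_simps)
    ultimately have "sqrt (2 * pi) / c = 1 / sqrt (2 * pi * \<sigma>\<^sup>2)" by simp
    moreover have "- s\<^sup>2 / 2 = - (x - 0)\<^sup>2 / (2 * \<sigma>\<^sup>2)"
      unfolding s_def by (simp add: power_divide)
    moreover have "exp (- s\<^sup>2 / 2) / (c / sqrt (2 * pi)) = (sqrt (2 * pi) / c) * exp (- s\<^sup>2 / 2)"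
      by simp
    ultimately show ?thesis by (simp only: normal_density_def)
  qed
  finally show ?thesis .
qed

lemma window_bounds: "0 \<le> window \<sigma> \<xi>" "window \<sigma> \<xi> \<le> 1"
  unfolding window_def gwindow_def by (auto intro!: mult_le_one)

lemma window_measurable [measurable]: "window \<sigma> \<in> borel_measurable borel"
  unfolding window_def[abs_def] borel_prod[symmetric] by measurable

lemma gauss_nonneg: "0 \<le> gauss \<sigma> z"
  unfolding gauss_def by simp

lemma gauss_measurable [measurable]: "gauss \<sigma> \<in> borel_measurable borel"
  unfolding gauss_def[abs_def] borel_prod[symmetric] by measurable

lemma integrable_gauss: "\<sigma> > 0 \<Longrightarrow> integrable lborel (gauss \<sigma>)"
  and integral_gauss: "\<sigma> > 0 \<Longrightarrow> (\<integral>z. gauss \<sigma> z \<partial>lborel) = 1"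
  unfolding gauss_def[abs_def]
  using integrable_tensor[of "normal_density 0 \<sigma>" "normal_density 0 \<sigma>"] by simp_all

lemma integrable_window: "\<sigma> > 0 \<Longrightarrow> integrable lborel (\<lambda>\<xi>. complex_of_real (window \<sigma> \<xi>))"
  unfolding window_def using integrable_tensor[of "gwindow \<sigma>" "gwindow \<sigma>"] integrable_gwindow
  by (intro integrable_of_real) simp

lemma fourier_window:
  assumes "\<sigma> > 0"
  shows "fourier (\<lambda>\<xi>. complex_of_real (window \<sigma> \<xi>)) x = complex_of_real (gauss \<sigma> x)"
proof -
  let ?u = "\<lambda>y t. cis (- 2 * pi * (t * y)) * complex_of_real (gwindow \<sigma> t)"
  have I: "integrable lborel (?u y)" for y
  proof (rule Bochner_Integration.integrable_bound[OF integrable_gwindow[OF assms]])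
    have [measurable]: "(\<lambda>t. cis (- 2 * pi * (t * y))) \<in> borel_measurable borel"
      by (intro borel_measurable_continuous_onI continuous_intros)
    show "?u y \<in> borel_measurable lborel" by measurable
  qed (simp add: norm_mult)
  have "fourier (\<lambda>\<xi>. complex_of_real (window \<sigma> \<xi>)) x
     = (\<integral>\<xi>. ?u (fst x) (fst \<xi>) * ?u (snd x) (snd \<xi>) \<partial>lborel)"
    unfolding fourier_def window_def
  proof (intro Bochner_Integration.integral_cong refl)
    fix \<xi> :: "real \<times> real"
    have "cis (- 2 * pi * (\<xi> \<bullet> x)) = cis (- 2 * pi * (fst \<xi> * fst x)) * cis (- 2 * pi * (snd \<xi> * snd x))"
      unfolding cis_mult by (simp add: inner_prod_def algebra_simps)
    then show "cis (- 2 * pi * (\<xi> \<bullet> x)) * complex_of_real (gwindow \<sigma> (fst \<xi>) * gwindow \<sigma> (snd \<xi>))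
        = ?u (fst x) (fst \<xi>) * ?u (snd x) (snd \<xi>)"
      by (simp only: of_real_mult mult_ac)
  qed
  also have "\<dots> = (\<integral>t. ?u (fst x) t \<partial>lborel) * (\<integral>t. ?u (snd x) t \<partial>lborel)"
    by (rule integrable_tensor(2)[OF I I])
  also have "\<dots> = complex_of_real (gauss \<sigma> x)"
    unfolding gwindow_fourier[OF assms] gauss_def by simp
  finally show ?thesis .
qed

lemma character_commute: "character \<xi> x = character x \<xi>"
  by (simp add: character_def inner_commute)

lemma character_pair_measurable [measurable]:
  "(\<lambda>z::(real\<times>real)\<times>(real\<times>real). character (snd z) (fst z)) \<in> borel_measurable borel"
  unfolding character_def by (intro borel_measurable_continuous_onI continuous_intros)

text \<open>The kernel is symmetric and unimodular, so Fubini applies as soon as both functions are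
  integrable. This identity moves the transform from one factor to the other in the inversion
  formula, in Plancherel's inequality and in the extension.\<close>

lemma fourier_multiplication:
  assumes g: "integrable lborel g" and w: "integrable lborel w"
  shows "(\<integral>\<xi>. fourier g \<xi> * w \<xi> \<partial>lborel) = (\<integral>x. g x * fourier w x \<partial>lborel)"
proof -
  have I0: "integrable lborel (\<lambda>z. g (fst z) * w (snd z))"
    by (rule integrable_tensor(1)[OF g w])
  have I: "integrable lborel (\<lambda>z. character (snd z) (fst z) * (g (fst z) * w (snd z)))"
  proof (rule Bochner_Integration.integrable_bound[OF I0])
    show "(\<lambda>z. character (snd z) (fst z) * (g (fst z) * w (snd z))) \<in> borel_measurable lborel"
      using borel_measurable_integrable[OF I0] character_pair_measurable by simp
  qed (simp add: norm_mult)
  have "(\<integral>\<xi>. fourier g \<xi> * w \<xi> \<partial>lborel) = (\<integral>\<xi>. (\<integral>x. character \<xi> x * (g x * w \<xi>) \<partial>lborel) \<partial>lborel)"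
    unfolding fourier_character by (simp flip: mult.assoc)
  also have "\<dots> = (\<integral>x. (\<integral>\<xi>. character \<xi> x * (g x * w \<xi>) \<partial>lborel) \<partial>lborel)"
    using I by (intro lborel_pair.Fubini_integral) (simp add: lborel_prod case_prod_unfold)
  also have "\<dots> = (\<integral>x. g x * fourier w x \<partial>lborel)"
    unfolding fourier_character
    by (subst character_commute) (simp add: mult.left_commute[of _ "g _"])
  finally show ?thesis .
qed

text \<open>Modulating the window translates its transform, so the Gauss-Weierstrass means of the
  inversion integral are averages of \<open>g\<close> around \<open>x\<close>.\<close>

lemma fourier_gauss_regularised:
  assumes g: "integrable lborel g" and \<sigma>: "\<sigma> > 0"
  shows "(\<integral>\<xi>. fourier g \<xi> * (character (- x) \<xi> * complex_of_real (window \<sigma> \<xi>)) \<partial>lborel)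
      = (\<integral>y. g y * complex_of_real (gauss \<sigma> (y - x)) \<partial>lborel)"
proof -
  have "fourier (\<lambda>\<xi>. character (- x) \<xi> * complex_of_real (window \<sigma> \<xi>)) y = complex_of_real (gauss \<sigma> (y - x))" for y
  proof -
    have "fourier (\<lambda>\<xi>. character (- x) \<xi> * complex_of_real (window \<sigma> \<xi>)) y
        = fourier (\<lambda>\<xi>. complex_of_real (window \<sigma> \<xi>)) (y - x)"
      unfolding fourier_character
    proof (intro Bochner_Integration.integral_cong refl)
      fix \<xi>
      have "character y \<xi> * character (- x) \<xi> = character (y - x) \<xi>"
        unfolding character_def cis_mult by (simp add: inner_diff_right algebra_simps)
      then show "character y \<xi> * (character (- x) \<xi> * complex_of_real (window \<sigma> \<xi>))
          = character (y - x) \<xi> * complex_of_real (window \<sigma> \<xi>)"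
        by (simp only: mult.assoc[symmetric])
    qed
    then show ?thesis by (simp add: fourier_window[OF \<sigma>])
  qed
  then show ?thesis
    using fourier_multiplication[OF g integrable_character_mult[OF integrable_window[OF \<sigma>]], of "- x"] by simp
qed

lemma window_tendsto: "(\<lambda>n. window (1 / real (Suc n)) \<xi>) \<longlonglongrightarrow> 1"
proof -
  have "(\<lambda>n. window (1 / real (Suc n)) \<xi>) \<longlonglongrightarrow>
      exp (- (2 * pi * 0 * fst \<xi>)\<^sup>2 / 2) * exp (- (2 * pi * 0 * snd \<xi>)\<^sup>2 / 2)"
    unfolding window_def gwindow_def
    by (intro tendsto_intros LIMSEQ_Suc[OF lim_1_over_n]) auto
  then show ?thesis by simp
qed

text \<open>One family of integrals has two limits as the deviation \<open>s n\<close> tends to 0: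
  on the frequency side the window tends to 1 and the inversion integral appears, on the other side
  the Gaussian averages concentrate at \<open>x\<close>.\<close>

theorem inv_fourier_fourier:
  assumes g: "g \<in> schwartz2"
  shows "inv_fourier (fourier g) = g"
proof
  fix x
  define s where "s n = 1 / real (Suc n)" for n
  have s: "s n > 0" for n by (simp add: s_def)
  have gi: "integrable lborel g" and Fi: "integrable lborel (fourier g)"
    using g fourier_schwartz2 schwartz2_integrable by blast+
  obtain M where M: "\<And>z. cmod (g z) \<le> M" using schwartz2_bounded[OF g] by blast
  have [measurable]: "g \<in> borel_measurable borel" "fourier g \<in> borel_measurable borel"
    using g fourier_schwartz2 schwartz2_measurable by blast+
  have "(\<lambda>n. \<integral>\<xi>. fourier g \<xi> * (character (- x) \<xi> * complex_of_real (window (s n) \<xi>)) \<partial>lborel)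
      \<longlonglongrightarrow> (\<integral>\<xi>. fourier g \<xi> * (character (- x) \<xi> * complex_of_real 1) \<partial>lborel)"
  proof (rule integral_dominated_convergence[where w = "\<lambda>\<xi>. cmod (fourier g \<xi>)"])
    show "AE \<xi> in lborel. (\<lambda>n. fourier g \<xi> * (character (- x) \<xi> * complex_of_real (window (s n) \<xi>)))
        \<longlonglongrightarrow> fourier g \<xi> * (character (- x) \<xi> * complex_of_real 1)"
      unfolding s_def by (intro AE_I2 tendsto_intros window_tendsto)
    show "AE \<xi> in lborel. cmod (fourier g \<xi> * (character (- x) \<xi> * complex_of_real (window (s n) \<xi>))) \<le> cmod (fourier g \<xi>)" for n
      using window_bounds by (intro AE_I2) (simp add: norm_mult mult_left_le)
  qed (use Fi in auto)
  moreover have "(\<integral>\<xi>. fourier g \<xi> * (character (- x) \<xi> * complex_of_real 1) \<partial>lborel) = inv_fourier (fourier g) x"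
    unfolding inv_fourier_eq fourier_character[of "fourier g"] by (simp add: mult.commute)
  ultimately have lim1: "(\<lambda>n. \<integral>y. g y * complex_of_real (gauss (s n) (y - x)) \<partial>lborel) \<longlonglongrightarrow> inv_fourier (fourier g) x"
    by (simp only: fourier_gauss_regularised[OF gi s])
  \<comment> \<open>Rescaling moves \<open>s n\<close> from the kernel into the argument of
    \<open>g\<close>. Then \<open>M\<close> times a fixed Gaussian is a majorant, and continuity of
    \<open>g\<close> at \<open>x\<close> gives the limit.\<close>
  have eq: "(\<integral>y. g y * complex_of_real (gauss (s n) (y - x)) \<partial>lborel)
      = (\<integral>z. g (x + s n *\<^sub>R z) * complex_of_real (gauss 1 z) \<partial>lborel)" for n
  proof -
    have "integrable lborel (\<lambda>y. g y * complex_of_real (gauss (s n) (y - x)))"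
    proof (rule Bochner_Integration.integrable_bound)
      have "integrable lborel (\<lambda>y. gauss (s n) (y - x))"
      proof (rule integrableI_nonneg)
        show "(\<integral>\<^sup>+y. ennreal (gauss (s n) (y - x)) \<partial>lborel) < \<infinity>"
          using nn_integral_reflect_translate(2)[of "\<lambda>y. ennreal (gauss (s n) y)" x] integrable_gauss[OF s, of n]
          by (simp add: nn_integral_eq_integral gauss_nonneg)
      qed (auto simp: gauss_nonneg)
      then show "integrable lborel (\<lambda>y. M * gauss (s n) (y - x))" by (rule integrable_mult_right)
      show "AE y in lborel. cmod (g y * complex_of_real (gauss (s n) (y - x))) \<le> norm (M * gauss (s n) (y - x))"
        using M by (intro AE_I2) (auto simp: norm_mult abs_mult gauss_nonneg intro!: mult_right_mono intro: order_trans[OF _ abs_ge_self])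
    qed measurable
    then have "(\<integral>y. g y * complex_of_real (gauss (s n) (y - x)) \<partial>lborel)
      = \<bar>s n\<bar> ^ DIM(real \<times> real) *\<^sub>R (\<integral>z. g (x + s n *\<^sub>R z) * complex_of_real (gauss (s n) (x + s n *\<^sub>R z - x)) \<partial>lborel)"
      by (rule lborel_scale) (use s[of n] in simp)
    also have "\<dots> = (\<integral>z. \<bar>s n\<bar> ^ DIM(real \<times> real) *\<^sub>R (g (x + s n *\<^sub>R z) * complex_of_real (gauss (s n) (s n *\<^sub>R z))) \<partial>lborel)"
      by simp
    also have "\<dots> = (\<integral>z. g (x + s n *\<^sub>R z) * complex_of_real (gauss 1 z) \<partial>lborel)"
    proof (intro Bochner_Integration.integral_cong refl)
      fix z :: "real \<times> real"
      have "s n * normal_density 0 (s n) (s n * t) = normal_density 0 1 t" for t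
        using s[of n] unfolding normal_density_def by (simp add: real_sqrt_mult power_mult_distrib)
      then have "(s n * s n) * gauss (s n) (s n *\<^sub>R z) = gauss 1 z"
        unfolding gauss_def by (simp add: mult_ac) (metis mult.assoc mult.left_commute)
      then show "\<bar>s n\<bar> ^ DIM(real \<times> real) *\<^sub>R (g (x + s n *\<^sub>R z) * complex_of_real (gauss (s n) (s n *\<^sub>R z)))
          = g (x + s n *\<^sub>R z) * complex_of_real (gauss 1 z)"
        using s[of n] by (simp add: scaleR_conv_of_real power2_eq_square flip: of_real_mult)
    qed
    finally show ?thesis .
  qed
  have "(\<lambda>n. \<integral>z. g (x + s n *\<^sub>R z) * complex_of_real (gauss 1 z) \<partial>lborel)
      \<longlonglongrightarrow> (\<integral>z. g x * complex_of_real (gauss 1 z) \<partial>lborel)"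
  proof (rule integral_dominated_convergence[where w = "\<lambda>z. M * gauss 1 z"])
    show "AE z in lborel. (\<lambda>n. g (x + s n *\<^sub>R z) * complex_of_real (gauss 1 z)) \<longlonglongrightarrow> g x * complex_of_real (gauss 1 z)"
    proof (intro AE_I2 tendsto_intros)
      fix z
      have "(\<lambda>n. x + s n *\<^sub>R z) \<longlonglongrightarrow> x + 0 *\<^sub>R z"
        unfolding s_def by (intro tendsto_intros LIMSEQ_Suc[OF lim_1_over_n])
      moreover have "isCont g x"
        by (rule differentiable_imp_continuous_within[OF schwartz2_differentiable[OF g]])
      ultimately show "(\<lambda>n. g (x + s n *\<^sub>R z)) \<longlonglongrightarrow> g x"
        by (intro isCont_tendsto_compose[of x g]) auto
    qed
    show "AE z in lborel. cmod (g (x + s n *\<^sub>R z) * complex_of_real (gauss 1 z)) \<le> M * gauss 1 z" for n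
      unfolding norm_mult norm_of_real abs_of_nonneg[OF gauss_nonneg]
      by (intro AE_I2 mult_right_mono M gauss_nonneg)
  qed (auto simp: integrable_gauss)
  moreover have "(\<integral>z. g x * complex_of_real (gauss 1 z) \<partial>lborel) = g x"
    using integral_gauss[of 1] by (simp only: integral_mult_right_zero integral_complex_of_real) simp
  ultimately have "(\<lambda>n. \<integral>y. g y * complex_of_real (gauss (s n) (y - x)) \<partial>lborel) \<longlonglongrightarrow> g x"
    by (simp only: eq)
  then show "inv_fourier (fourier g) x = g x" using lim1 LIMSEQ_unique by blast
qed

section \<open>Plancherel's inequality\<close>

lemma nn_integral_limit_le:
  fixes v :: "'a \<Rightarrow> ennreal"
  assumes u: "\<And>n. u n \<in> borel_measurable M"
    and lim: "AE x in M. (\<lambda>n. u n x) \<longlonglongrightarrow> v x"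
    and le: "\<And>n. (\<integral>\<^sup>+x. u n x \<partial>M) \<le> B"
  shows "(\<integral>\<^sup>+x. v x \<partial>M) \<le> B"
proof -
  have "(\<integral>\<^sup>+x. v x \<partial>M) = (\<integral>\<^sup>+x. liminf (\<lambda>n. u n x) \<partial>M)"
    by (rule nn_integral_cong_AE) (use lim in eventually_elim, simp add: lim_imp_Liminf)
  also have "\<dots> \<le> liminf (\<lambda>n. \<integral>\<^sup>+x. u n x \<partial>M)"
    by (rule nn_integral_liminf[OF u])
  also have "\<dots> \<le> limsup (\<lambda>n. \<integral>\<^sup>+x. u n x \<partial>M)"
    by (rule Liminf_le_Limsup) simp
  also have "\<dots> \<le> B"
    by (rule Limsup_bounded) (simp add: le)
  finally show ?thesis .
qed

lemma norm_integral_le_nn_integral: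
  fixes f :: "'a \<Rightarrow> 'b::{banach, second_countable_topology}"
  shows "ennreal (norm (\<integral>x. f x \<partial>M)) \<le> (\<integral>\<^sup>+x. ennreal (norm (f x)) \<partial>M)"
  \<comment> \<open>Outside the integrable case the Bochner integral has the default value
    0.\<close>
  by (cases "integrable M f") (simp_all add: integral_norm_bound_ennreal not_integrable_integral_eq)

lemma character_measurable2 [measurable (raw)]:
  assumes "f \<in> borel_measurable M" "h \<in> borel_measurable M"
  shows "(\<lambda>x. character (f x) (h x)) \<in> borel_measurable M"
  using measurable_compose[OF borel_measurable_Pair[OF assms(2,1)] character_pair_measurable] by simp

lemma fourier_measurable:
  assumes "integrable lborel g"
  shows "fourier g \<in> borel_measurable borel"
proof -
  have [measurable]: "g \<in> borel_measurable borel" using borel_measurable_integrable[OF assms] by simp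
  show ?thesis
    unfolding fourier_character[abs_def] by measurable
qed

lemma nn_integral_gauss:
  assumes "\<sigma> > 0"
  shows "(\<integral>\<^sup>+y. ennreal (gauss \<sigma> (y - x)) \<partial>lborel) = 1" "(\<integral>\<^sup>+x. ennreal (gauss \<sigma> (y - x)) \<partial>lborel) = 1"
proof -
  have 1: "(\<integral>\<^sup>+z. ennreal (gauss \<sigma> z) \<partial>lborel) = 1"
    using integrable_gauss[OF assms] by (simp add: nn_integral_eq_integral gauss_nonneg integral_gauss assms)
  show "(\<integral>\<^sup>+y. ennreal (gauss \<sigma> (y - x)) \<partial>lborel) = 1"
    using nn_integral_reflect_translate(2)[of "\<lambda>z. ennreal (gauss \<sigma> z)" x] 1 by simp
  show "(\<integral>\<^sup>+x. ennreal (gauss \<sigma> (y - x)) \<partial>lborel) = 1"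
    using nn_integral_reflect_translate(1)[of "\<lambda>z. ennreal (gauss \<sigma> z)" y] 1 by simp
qed

text \<open>A Schur test: \<open>b x * b y\<close> is at most the mean of the two squares, and the
  Gaussian has mass 1 in either variable, so the two squares contribute one half of the right-hand
  side each.\<close>

lemma gauss_schur_bound:
  assumes [measurable]: "b \<in> borel_measurable borel" and nn: "\<And>x. 0 \<le> b x" and \<sigma>: "\<sigma> > 0"
  shows "(\<integral>\<^sup>+x. ennreal (b x) * (\<integral>\<^sup>+y. ennreal (b y * gauss \<sigma> (y - x)) \<partial>lborel) \<partial>lborel) \<le> (\<integral>\<^sup>+x. ennreal ((b x)\<^sup>2) \<partial>lborel)"
proof -
  define a where "a x = ennreal ((b x)\<^sup>2 / 2)" for x
  have [measurable]: "a \<in> borel_measurable borel" unfolding a_def by measurable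
  have [measurable]: "(\<lambda>z. gauss \<sigma> (snd z - fst z)) \<in> borel_measurable (borel \<Otimes>\<^sub>M borel)"
    by measurable
  let ?G = "\<lambda>x y. ennreal (gauss \<sigma> (y - x))"
  have "(\<integral>\<^sup>+x. ennreal (b x) * (\<integral>\<^sup>+y. ennreal (b y * gauss \<sigma> (y - x)) \<partial>lborel) \<partial>lborel)
      = (\<integral>\<^sup>+x. (\<integral>\<^sup>+y. ennreal (b x) * ennreal (b y * gauss \<sigma> (y - x)) \<partial>lborel) \<partial>lborel)"
    by (subst nn_integral_cmult) simp_all
  also have "\<dots> \<le> (\<integral>\<^sup>+x. (\<integral>\<^sup>+y. a x * ?G x y + a y * ?G x y \<partial>lborel) \<partial>lborel)"
  proof (intro nn_integral_mono)
    fix x y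
    have "b x * b y \<le> (b x)\<^sup>2 / 2 + (b y)\<^sup>2 / 2"
      using sum_squares_bound[of "b x" "b y"] by simp
    then have "b x * b y * gauss \<sigma> (y - x) \<le> ((b x)\<^sup>2 / 2 + (b y)\<^sup>2 / 2) * gauss \<sigma> (y - x)"
      by (rule mult_right_mono) (rule gauss_nonneg)
    then have "ennreal (b x * b y * gauss \<sigma> (y - x)) \<le> ennreal (((b x)\<^sup>2 / 2 + (b y)\<^sup>2 / 2) * gauss \<sigma> (y - x))"
      by (rule ennreal_leI)
    then show "ennreal (b x) * ennreal (b y * gauss \<sigma> (y - x)) \<le> a x * ?G x y + a y * ?G x y"
      unfolding a_def by (simp add: nn gauss_nonneg ennreal_mult' ennreal_plus distrib_right flip: ennreal_mult' mult.assoc)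
  qed
  also have "\<dots> = (\<integral>\<^sup>+x. a x * 1 + (\<integral>\<^sup>+y. a y * ?G x y \<partial>lborel) \<partial>lborel)"
    by (subst nn_integral_add) (simp_all add: nn_integral_cmult nn_integral_gauss[OF \<sigma>])
  also have "\<dots> = (\<integral>\<^sup>+x. a x \<partial>lborel) + (\<integral>\<^sup>+x. (\<integral>\<^sup>+y. a y * ?G x y \<partial>lborel) \<partial>lborel)"
    by (subst nn_integral_add) simp_all
  also have "(\<integral>\<^sup>+x. (\<integral>\<^sup>+y. a y * ?G x y \<partial>lborel) \<partial>lborel) = (\<integral>\<^sup>+y. (\<integral>\<^sup>+x. a y * ?G x y \<partial>lborel) \<partial>lborel)"
    by (rule lborel_pair.Fubini') measurable
  also have "\<dots> = (\<integral>\<^sup>+y. a y \<partial>lborel)"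
    by (simp add: nn_integral_cmult nn_integral_gauss[OF \<sigma>])
  also have "(\<integral>\<^sup>+x. a x \<partial>lborel) + (\<integral>\<^sup>+x. a x \<partial>lborel) = (\<integral>\<^sup>+x. ennreal ((b x)\<^sup>2) \<partial>lborel)"
    by (subst nn_integral_add[symmetric]) (simp_all add: a_def flip: ennreal_plus)
  finally show ?thesis .
qed

text \<open>The transform is paired with its own conjugate times a Gaussian window. The
  multiplication formula turns this into \<open>g\<close> paired with a Gaussian average of its
  conjugate, to which the Schur bound applies; the window is then removed by Fatou's lemma.\<close>

theorem nn_integral_fourier_le:
  assumes gi: "integrable lborel g"
  shows "(\<integral>\<^sup>+\<xi>. ennreal ((cmod (fourier g \<xi>))\<^sup>2) \<partial>lborel) \<le> (\<integral>\<^sup>+x. ennreal ((cmod (g x))\<^sup>2) \<partial>lborel)"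
proof -
  have [measurable]: "g \<in> borel_measurable borel" "fourier g \<in> borel_measurable borel"
    using borel_measurable_integrable[OF gi] fourier_measurable[OF gi] by simp_all
  define M where "M = (\<integral>x. cmod (g x) \<partial>lborel)"
  have M: "cmod (fourier g \<xi>) \<le> M" for \<xi> unfolding M_def by (rule fourier_bound)
  have bound: "(\<integral>\<^sup>+\<xi>. ennreal ((cmod (fourier g \<xi>))\<^sup>2 * window \<sigma> \<xi>) \<partial>lborel) \<le> (\<integral>\<^sup>+x. ennreal ((cmod (g x))\<^sup>2) \<partial>lborel)"
    if \<sigma>: "\<sigma> > 0" for \<sigma>
  proof -
    define w where "w \<xi> = cnj (fourier g \<xi>) * complex_of_real (window \<sigma> \<xi>)" for \<xi>
    have M0: "0 \<le> M" using M[of 0] norm_ge_zero order_trans by blast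
    \<comment> \<open>The transform of an integrable function is bounded but perhaps not integrable;
      the window supplies integrability.\<close>
    have wi: "integrable lborel w"
    proof (rule Bochner_Integration.integrable_bound[OF integrable_mult_right[OF integrable_window[OF \<sigma>]]])
      have [measurable]: "cnj \<in> borel_measurable borel"
        by (intro borel_measurable_continuous_onI continuous_intros)
      show "w \<in> borel_measurable lborel" unfolding w_def[abs_def] by measurable
      show "AE \<xi> in lborel. cmod (w \<xi>) \<le> cmod (complex_of_real M * complex_of_real (window \<sigma> \<xi>))"
        using M0 M unfolding w_def norm_mult complex_mod_cnj
        by (intro AE_I2 mult_right_mono) simp_all
    qed
    have Fw: "fourier w x = cnj (\<integral>y. g y * complex_of_real (gauss \<sigma> (y - x)) \<partial>lborel)" for x
    proof -
      have "cnj (character (- x) \<xi>) = character x \<xi>" for \<xi>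
        by (simp add: character_def cis_cnj)
      then have "fourier w x = (\<integral>\<xi>. cnj (fourier g \<xi> * (character (- x) \<xi> * complex_of_real (window \<sigma> \<xi>))) \<partial>lborel)"
        unfolding fourier_character[of w] w_def by (simp add: mult_ac)
      then show ?thesis
        by (simp only: Bochner_Integration.integral_cnj fourier_gauss_regularised[OF gi \<sigma>])
    qed
    have eq: "fourier g \<xi> * w \<xi> = complex_of_real ((cmod (fourier g \<xi>))\<^sup>2 * window \<sigma> \<xi>)" for \<xi>
      unfolding w_def of_real_mult complex_norm_square by (rule mult.assoc[symmetric])
    have int: "integrable lborel (\<lambda>\<xi>. (cmod (fourier g \<xi>))\<^sup>2 * window \<sigma> \<xi>)"
    proof (rule Bochner_Integration.integrable_bound[OF integrable_mult_right[OF wi]])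
      show "AE \<xi> in lborel. norm ((cmod (fourier g \<xi>))\<^sup>2 * window \<sigma> \<xi>) \<le> cmod (complex_of_real M * w \<xi>)"
        using M0 M unfolding w_def norm_mult complex_mod_cnj power2_eq_square
        by (intro AE_I2) (simp add: mult.assoc mult_right_mono)
    qed measurable
    have "(\<integral>\<^sup>+\<xi>. ennreal ((cmod (fourier g \<xi>))\<^sup>2 * window \<sigma> \<xi>) \<partial>lborel)
       = ennreal (\<integral>\<xi>. (cmod (fourier g \<xi>))\<^sup>2 * window \<sigma> \<xi> \<partial>lborel)"
      by (rule nn_integral_eq_integral[OF int]) (simp add: window_bounds)
    also have "\<dots> \<le> ennreal (cmod (\<integral>\<xi>. fourier g \<xi> * w \<xi> \<partial>lborel))"
      unfolding eq integral_complex_of_real norm_of_real by (intro ennreal_leI abs_ge_self)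
    also have "\<dots> = ennreal (cmod (\<integral>x. g x * fourier w x \<partial>lborel))"
      by (simp only: fourier_multiplication[OF gi wi])
    also have "\<dots> \<le> (\<integral>\<^sup>+x. ennreal (cmod (g x * fourier w x)) \<partial>lborel)"
      by (rule norm_integral_le_nn_integral)
    also have "\<dots> \<le> (\<integral>\<^sup>+x. ennreal (cmod (g x)) * (\<integral>\<^sup>+y. ennreal (cmod (g y) * gauss \<sigma> (y - x)) \<partial>lborel) \<partial>lborel)"
    proof (intro nn_integral_mono)
      fix x
      have "ennreal (cmod (fourier w x)) \<le> (\<integral>\<^sup>+y. ennreal (cmod (g y * complex_of_real (gauss \<sigma> (y - x)))) \<partial>lborel)"
        unfolding Fw complex_mod_cnj by (rule norm_integral_le_nn_integral)
      then show "ennreal (cmod (g x * fourier w x)) \<le> ennreal (cmod (g x)) * (\<integral>\<^sup>+y. ennreal (cmod (g y) * gauss \<sigma> (y - x)) \<partial>lborel)"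
        unfolding norm_mult norm_of_real abs_of_nonneg[OF gauss_nonneg]
        by (subst ennreal_mult) (auto intro!: mult_left_mono)
    qed
    also have "\<dots> \<le> (\<integral>\<^sup>+x. ennreal ((cmod (g x))\<^sup>2) \<partial>lborel)"
      by (rule gauss_schur_bound[OF _ _ \<sigma>]) simp_all
    finally show ?thesis .
  qed
  show ?thesis
  proof (rule nn_integral_limit_le[where u = "\<lambda>n \<xi>. ennreal ((cmod (fourier g \<xi>))\<^sup>2 * window (1 / real (Suc n)) \<xi>)"])
    show "AE \<xi> in lborel. (\<lambda>n. ennreal ((cmod (fourier g \<xi>))\<^sup>2 * window (1 / real (Suc n)) \<xi>)) \<longlonglongrightarrow> ennreal ((cmod (fourier g \<xi>))\<^sup>2)"
    proof (rule AE_I2)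
      fix \<xi>
      have "(\<lambda>n. (cmod (fourier g \<xi>))\<^sup>2 * window (1 / real (Suc n)) \<xi>) \<longlonglongrightarrow> (cmod (fourier g \<xi>))\<^sup>2 * 1"
        by (intro tendsto_intros window_tendsto)
      then show "(\<lambda>n. ennreal ((cmod (fourier g \<xi>))\<^sup>2 * window (1 / real (Suc n)) \<xi>)) \<longlonglongrightarrow> ennreal ((cmod (fourier g \<xi>))\<^sup>2)"
        by (intro tendsto_ennrealI) simp
    qed
  qed (use bound in simp_all)
qed

section \<open>Extension of the Fourier transform to square-integrable functions\<close>

text \<open>A substitute for the Cauchy-Schwarz inequality with a free weight; the missing factor
  1/2 is immaterial. The weight \<open>2 ^ n\<close> will trade a rapidly decreasing square against
  a bounded one.\<close>

lemma amgm_weighted: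
  fixes x y c :: real
  assumes "c > 0" "x \<ge> 0" "y \<ge> 0"
  shows "x * y \<le> c * x\<^sup>2 + y\<^sup>2 / c"
proof -
  have "0 \<le> (c * x - y)\<^sup>2 / c" using assms by simp
  also have "\<dots> = c * x\<^sup>2 + y\<^sup>2 / c - 2 * (x * y)"
    using assms by (simp add: power2_eq_square field_simps)
  finally show ?thesis using mult_nonneg_nonneg[OF assms(2,3)] by linarith
qed

lemma integrable_mult_L2:
  fixes f g :: "'a \<Rightarrow> complex"
  assumes [measurable]: "f \<in> borel_measurable M" "g \<in> borel_measurable M"
    and f: "(\<integral>\<^sup>+x. ennreal ((cmod (f x))\<^sup>2) \<partial>M) < \<infinity>" and g: "(\<integral>\<^sup>+x. ennreal ((cmod (g x))\<^sup>2) \<partial>M) < \<infinity>"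
  shows "integrable M (\<lambda>x. f x * g x)"
proof (rule integrableI_bounded)
  have "(\<integral>\<^sup>+x. ennreal (cmod (f x * g x)) \<partial>M) \<le> (\<integral>\<^sup>+x. ennreal ((cmod (f x))\<^sup>2) + ennreal ((cmod (g x))\<^sup>2) \<partial>M)"
    using amgm_weighted[of 1 "cmod (f _)" "cmod (g _)"]
    by (intro nn_integral_mono) (simp add: norm_mult flip: ennreal_plus)
  also have "\<dots> = (\<integral>\<^sup>+x. ennreal ((cmod (f x))\<^sup>2) \<partial>M) + (\<integral>\<^sup>+x. ennreal ((cmod (g x))\<^sup>2) \<partial>M)"
    by (rule nn_integral_add) measurable
  also have "\<dots> < \<infinity>" using f g by simp
  finally show "(\<integral>\<^sup>+x. ennreal (cmod (f x * g x)) \<partial>M) < \<infinity>" .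
qed measurable

lemma schwartz2_L2:
  assumes "g \<in> schwartz2"
  shows "integrable lborel (\<lambda>x. (cmod (g x))\<^sup>2)" "(\<integral>\<^sup>+x. ennreal ((cmod (g x))\<^sup>2) \<partial>lborel) < \<infinity>"
proof -
  show 1: "integrable lborel (\<lambda>x. (cmod (g x))\<^sup>2)"
    using integrable_norm[OF schwartz2_integrable[OF schwartz2_mult[OF assms assms]]]
    by (simp add: norm_mult power2_eq_square)
  then show "(\<integral>\<^sup>+x. ennreal ((cmod (g x))\<^sup>2) \<partial>lborel) < \<infinity>"
    by (simp add: nn_integral_eq_integral)
qed

lemma fourier_diff:
  assumes "integrable lborel g" "integrable lborel h"
  shows "fourier (\<lambda>z. g z - h z) \<xi> = fourier g \<xi> - fourier h \<xi>"
  using assms unfolding fourier_character by (simp add: right_diff_distrib integrable_character_mult)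

lemma truncation_integrable:
  fixes g :: "real \<times> real \<Rightarrow> complex"
  assumes [measurable]: "g \<in> borel_measurable borel"
    and fin: "(\<integral>\<^sup>+x. ennreal ((cmod (g x))\<^sup>2) \<partial>lborel) < \<infinity>"
  shows "integrable lborel (\<lambda>x. if norm x \<le> r then g x else 0)"
proof (rule integrableI_bounded)
  have "(\<integral>\<^sup>+x. ennreal (cmod (if norm x \<le> r then g x else 0)) \<partial>lborel)
      \<le> (\<integral>\<^sup>+x. ennreal ((cmod (g x))\<^sup>2) + indicator (cball 0 r) x \<partial>lborel)"
  proof (intro nn_integral_mono)
    fix x :: "real \<times> real"
    show "ennreal (cmod (if norm x \<le> r then g x else 0)) \<le> ennreal ((cmod (g x))\<^sup>2) + indicator (cball 0 r) x"
    proof (cases "norm x \<le> r")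
      case True
      have "ennreal (cmod (g x)) \<le> ennreal ((cmod (g x))\<^sup>2 + 1)"
        using amgm_weighted[of 1 "cmod (g x)" 1] by (intro ennreal_leI) simp
      with True show ?thesis by (simp add: indicator_def)
    qed simp
  qed
  also have "\<dots> = (\<integral>\<^sup>+x. ennreal ((cmod (g x))\<^sup>2) \<partial>lborel) + emeasure lborel (cball (0::real\<times>real) r)"
    by (subst nn_integral_add) (simp_all add: borel_measurable_indicator borel_closed)
  also have "\<dots> < \<infinity>" using fin emeasure_lborel_cball_finite[of "0::real\<times>real" r] by simp
  finally show "(\<integral>\<^sup>+x. ennreal (cmod (if norm x \<le> r then g x else 0)) \<partial>lborel) < \<infinity>" .
qed measurable

lemma L2_tail:
  fixes g :: "real \<times> real \<Rightarrow> complex" and e :: real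
  assumes [measurable]: "g \<in> borel_measurable borel"
    and fin: "(\<integral>\<^sup>+x. ennreal ((cmod (g x))\<^sup>2) \<partial>lborel) < \<infinity>" and "e > 0"
  shows "\<exists>r. (\<integral>\<^sup>+x. ennreal (if norm x \<le> r then 0 else (cmod (g x))\<^sup>2) \<partial>lborel) \<le> ennreal e"
proof -
  have "(\<lambda>k. \<integral>\<^sup>+x. ennreal (if norm x \<le> real k then 0 else (cmod (g x))\<^sup>2) \<partial>lborel) \<longlonglongrightarrow> (\<integral>\<^sup>+x. 0 \<partial>(lborel::(real\<times>real) measure))"
  proof (rule nn_integral_dominated_convergence[where w = "\<lambda>x. ennreal ((cmod (g x))\<^sup>2)"])
    show "AE x in lborel. (\<lambda>k. ennreal (if norm x \<le> real k then 0 else (cmod (g x))\<^sup>2)) \<longlonglongrightarrow> 0"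
    proof (rule AE_I2)
      fix x :: "real \<times> real"
      obtain K where "norm x \<le> real K" using real_arch_simple by blast
      then have "eventually (\<lambda>k. ennreal (if norm x \<le> real k then 0 else (cmod (g x))\<^sup>2) = 0) sequentially"
        by (intro eventually_sequentiallyI[of K]) simp
      then show "(\<lambda>k. ennreal (if norm x \<le> real k then 0 else (cmod (g x))\<^sup>2)) \<longlonglongrightarrow> 0"
        by (rule tendsto_eventually)
    qed
  qed (use fin in auto)
  then have lim0: "(\<lambda>k. \<integral>\<^sup>+x. ennreal (if norm x \<le> real k then 0 else (cmod (g x))\<^sup>2) \<partial>lborel) \<longlonglongrightarrow> 0"
    by simp
  have e: "0 < ennreal e" using \<open>e > 0\<close> by (simp only: ennreal_less_zero_iff)
  have "eventually (\<lambda>k. (\<integral>\<^sup>+x. ennreal (if norm x \<le> real k then 0 else (cmod (g x))\<^sup>2) \<partial>lborel) < ennreal e) sequentially"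
    by (rule order_tendstoD(2)[OF lim0 e])
  then obtain k where "(\<integral>\<^sup>+x. ennreal (if norm x \<le> real k then 0 else (cmod (g x))\<^sup>2) \<partial>lborel) < ennreal e"
    using eventually_happens by fastforce
  then show ?thesis by (intro exI[of _ "real k"]) (rule less_imp_le)
qed

text \<open>With weight \<open>2 ^ n\<close> and second factor 1, each increment is at most its
  weighted square plus \<open>(1 / 2) ^ n\<close>, so the increments are absolutely
  summable.\<close>

lemma convergent_if_weighted_square_summable:
  fixes h :: "nat \<Rightarrow> complex"
  assumes "(\<Sum>n. ennreal (2 ^ n * (cmod (h (Suc n) - h n))\<^sup>2)) \<noteq> \<infinity>"
  shows "convergent h"
proof -
  have "summable (\<lambda>n. 2 ^ n * (cmod (h (Suc n) - h n))\<^sup>2)"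
    using assms by (intro summable_suminf_not_top) simp_all
  then have s: "summable (\<lambda>n. 2 ^ n * (cmod (h (Suc n) - h n))\<^sup>2 + (1 / 2) ^ n)"
    by (intro summable_add summable_geometric) simp_all
  have "summable (\<lambda>n. h (Suc n) - h n)"
  proof (rule summable_comparison_test'[OF s])
    show "cmod (h (Suc n) - h n) \<le> 2 ^ n * (cmod (h (Suc n) - h n))\<^sup>2 + (1 / 2) ^ n" for n
      using amgm_weighted[of "2 ^ n" "cmod (h (Suc n) - h n)" 1] by (simp add: power_one_over)
  qed
  then have "convergent (\<lambda>n. \<Sum>i<n. h (Suc i) - h i)" by (simp only: summable_iff_convergent)
  then have "convergent (\<lambda>n. h n - h 0)" by (simp only: sum_lessThan_telescope)
  then have "convergent (\<lambda>n. (h n - h 0) + h 0)" by (intro convergent_add convergent_const)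
  then show ?thesis by simp
qed

text \<open>The weight \<open>2 ^ n\<close> turns the error \<open>2 * (1 / 8) ^ n\<close> into
  \<open>2 * (1 / 4) ^ n\<close>, while the fixed square norm \<open>P\<close> of the test function
  is multiplied by \<open>(1 / 2) ^ n\<close>; both vanish in the limit.\<close>

lemma L2_pairing_tendsto:
  fixes u :: "nat \<Rightarrow> testfun" and v :: testfun
  assumes [measurable]: "v \<in> borel_measurable borel" "\<And>n. u n \<in> borel_measurable borel"
    and hi: "integrable lborel (\<lambda>x. v x * \<psi> x)" and Hi: "\<And>n. integrable lborel (\<lambda>x. u n x * \<psi> x)"
    and D: "\<And>n. (\<integral>\<^sup>+x. ennreal ((cmod (v x - u n x))\<^sup>2) \<partial>lborel) \<le> ennreal (2 * (1 / 8) ^ n)"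
    and \<psi>: "\<psi> \<in> schwartz2"
  shows "(\<lambda>n. \<integral>x. u n x * \<psi> x \<partial>lborel) \<longlonglongrightarrow> (\<integral>x. v x * \<psi> x \<partial>lborel)"
proof -
  have [measurable]: "\<psi> \<in> borel_measurable borel" by (rule schwartz2_measurable[OF \<psi>])
  define P where "P = (\<integral>x. (cmod (\<psi> x))\<^sup>2 \<partial>lborel)"
  have "P \<ge> 0" unfolding P_def by simp
  have bound: "cmod ((\<integral>x. u n x * \<psi> x \<partial>lborel) - (\<integral>x. v x * \<psi> x \<partial>lborel)) \<le> 2 * (1 / 4) ^ n + P * (1 / 2) ^ n" for n
  proof -
    have "ennreal (cmod ((\<integral>x. u n x * \<psi> x \<partial>lborel) - (\<integral>x. v x * \<psi> x \<partial>lborel)))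
        = ennreal (cmod (\<integral>x. (u n x - v x) * \<psi> x \<partial>lborel))"
      using hi Hi[of n] by (simp add: left_diff_distrib)
    also have "\<dots> \<le> (\<integral>\<^sup>+x. ennreal (cmod ((u n x - v x) * \<psi> x)) \<partial>lborel)"
      by (rule norm_integral_le_nn_integral)
    also have "\<dots> \<le> (\<integral>\<^sup>+x. ennreal (2 ^ n) * ennreal ((cmod (v x - u n x))\<^sup>2) + ennreal ((1 / 2) ^ n) * ennreal ((cmod (\<psi> x))\<^sup>2) \<partial>lborel)"
    proof (intro nn_integral_mono)
      fix x
      have "cmod ((u n x - v x) * \<psi> x) = cmod (v x - u n x) * cmod (\<psi> x)"
        by (simp only: norm_mult norm_minus_commute[of "u n x"])
      also have "\<dots> \<le> 2 ^ n * (cmod (v x - u n x))\<^sup>2 + (cmod (\<psi> x))\<^sup>2 / 2 ^ n"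
        by (rule amgm_weighted) simp_all
      also have "(cmod (\<psi> x))\<^sup>2 / 2 ^ n = (1 / 2) ^ n * (cmod (\<psi> x))\<^sup>2"
        by (simp add: power_one_over)
      finally have "ennreal (cmod ((u n x - v x) * \<psi> x)) \<le> ennreal (2 ^ n * (cmod (v x - u n x))\<^sup>2 + (1 / 2) ^ n * (cmod (\<psi> x))\<^sup>2)"
        by (rule ennreal_leI)
      also have "\<dots> = ennreal (2 ^ n) * ennreal ((cmod (v x - u n x))\<^sup>2) + ennreal ((1 / 2) ^ n) * ennreal ((cmod (\<psi> x))\<^sup>2)"
        by (subst ennreal_plus) (simp_all add: ennreal_mult)
      finally show "ennreal (cmod ((u n x - v x) * \<psi> x))
         \<le> ennreal (2 ^ n) * ennreal ((cmod (v x - u n x))\<^sup>2) + ennreal ((1 / 2) ^ n) * ennreal ((cmod (\<psi> x))\<^sup>2)" .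
    qed
    also have "\<dots> = ennreal (2 ^ n) * (\<integral>\<^sup>+x. ennreal ((cmod (v x - u n x))\<^sup>2) \<partial>lborel)
        + ennreal ((1 / 2) ^ n) * (\<integral>\<^sup>+x. ennreal ((cmod (\<psi> x))\<^sup>2) \<partial>lborel)"
      by (subst nn_integral_add) (simp_all add: nn_integral_cmult)
    also have "(\<integral>\<^sup>+x. ennreal ((cmod (\<psi> x))\<^sup>2) \<partial>lborel) = ennreal P"
      unfolding P_def using schwartz2_L2(1)[OF \<psi>] by (simp add: nn_integral_eq_integral)
    also have "ennreal (2 ^ n) * (\<integral>\<^sup>+x. ennreal ((cmod (v x - u n x))\<^sup>2) \<partial>lborel) + ennreal ((1 / 2) ^ n) * ennreal P
        \<le> ennreal (2 ^ n) * ennreal (2 * (1 / 8) ^ n) + ennreal ((1 / 2) ^ n) * ennreal P"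
      by (intro add_mono mult_left_mono D) simp_all
    also have "\<dots> = ennreal (2 * (1 / 4) ^ n + P * (1 / 2) ^ n)"
    proof -
      have "(2::real) ^ n * (2 * (1 / 8) ^ n) = 2 * (2 * (1 / 8)) ^ n" unfolding power_mult_distrib by simp
      then have "(2::real) ^ n * (2 * (1 / 8) ^ n) = 2 * (1 / 4) ^ n" by simp
      then have "ennreal (2 ^ n) * ennreal (2 * (1 / 8) ^ n) = ennreal (2 * (1 / 4) ^ n)"
        by (subst ennreal_mult[symmetric]) simp_all
      moreover have "ennreal ((1 / 2) ^ n) * ennreal P = ennreal (P * (1 / 2) ^ n)"
        using \<open>P \<ge> 0\<close> by (subst ennreal_mult[symmetric]) (simp_all add: mult.commute)
      ultimately show ?thesis using \<open>P \<ge> 0\<close> by (subst ennreal_plus) simp_all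
    qed
    finally show ?thesis using \<open>P \<ge> 0\<close> by (subst (asm) ennreal_le_iff) simp_all
  qed
  have "(\<lambda>n. 2 * (1 / 4 :: real) ^ n + P * (1 / 2) ^ n) \<longlonglongrightarrow> 2 * 0 + P * 0"
    by (intro tendsto_intros LIMSEQ_realpow_zero) simp_all
  then have "(\<lambda>n. 2 * (1 / 4 :: real) ^ n + P * (1 / 2) ^ n) \<longlonglongrightarrow> 0" by simp
  then have "(\<lambda>n. (\<integral>x. u n x * \<psi> x \<partial>lborel) - (\<integral>x. v x * \<psi> x \<partial>lborel)) \<longlonglongrightarrow> 0"
    by (rule Lim_null_comparison[OF always_eventually[OF allI[OF bound]]])
  then show ?thesis by (rule LIM_zero_cancel)
qed

text \<open>A square-integrable \<open>g\<close> need not be integrable, so it is cut off to balls.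
  Radii with geometrically small tails make the transforms of the truncations converge almost
  everywhere, which gives a measurable limit directly. Fatou's lemma bounds its norm, and the
  multiplication formula passes to the limit in the pairings.\<close>

theorem fourier_L2_extension:
  fixes g :: testfun
  assumes gm [measurable]: "g \<in> borel_measurable borel"
    and fin: "(\<integral>\<^sup>+x. ennreal ((cmod (g x))\<^sup>2) \<partial>lborel) < \<infinity>"
  shows "\<exists>h\<in>borel_measurable borel.
      (\<integral>\<^sup>+x. ennreal ((cmod (h x))\<^sup>2) \<partial>lborel) \<le> (\<integral>\<^sup>+x. ennreal ((cmod (g x))\<^sup>2) \<partial>lborel) \<and>
      (\<forall>\<psi>\<in>schwartz2. integrable lborel (\<lambda>x. h x * \<psi> x) \<and> (\<integral>x. h x * \<psi> x \<partial>lborel) = (\<integral>x. g x * fourier \<psi> x \<partial>lborel))"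
proof -
  \<comment> \<open>Fast enough that the weight \<open>2 ^ n\<close>, needed both for almost
    everywhere convergence and for the pairings, still leaves the summable rate
    \<open>(1 / 4) ^ n\<close>.\<close>
  let ?e = "\<lambda>n::nat. (1 / 8 :: real) ^ n"
  let ?T = "\<lambda>r x. ennreal (if norm x \<le> r then 0 else (cmod (g x))\<^sup>2)"
  have "\<forall>n. \<exists>r. (\<integral>\<^sup>+x. ?T r x \<partial>lborel) \<le> ennreal (?e n)"
    by (intro allI L2_tail[OF gm fin]) simp
  then obtain r where r: "\<And>n. (\<integral>\<^sup>+x. ?T (r n) x \<partial>lborel) \<le> ennreal (?e n)" by metis
  define G where "G n x = (if norm x \<le> r n then g x else 0)" for n :: nat and x
  have Gi: "integrable lborel (G n)" for n
    unfolding G_def by (rule truncation_integrable[OF gm fin])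
  have [measurable]: "G n \<in> borel_measurable borel" for n
    using borel_measurable_integrable[OF Gi] by simp
  define H where "H n = fourier (G n)" for n
  have [measurable]: "H n \<in> borel_measurable borel" for n
    unfolding H_def by (rule fourier_measurable[OF Gi])
  have G_le: "(\<integral>\<^sup>+x. ennreal ((cmod (G n x))\<^sup>2) \<partial>lborel) \<le> (\<integral>\<^sup>+x. ennreal ((cmod (g x))\<^sup>2) \<partial>lborel)" for n
    by (intro nn_integral_mono ennreal_leI) (simp add: G_def)
  have H_le: "(\<integral>\<^sup>+x. ennreal ((cmod (H n x))\<^sup>2) \<partial>lborel) \<le> (\<integral>\<^sup>+x. ennreal ((cmod (g x))\<^sup>2) \<partial>lborel)" for n
    unfolding H_def by (rule order_trans[OF nn_integral_fourier_le[OF Gi] G_le])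
  have D: "(\<integral>\<^sup>+x. ennreal ((cmod (H m x - H n x))\<^sup>2) \<partial>lborel) \<le> ennreal (2 * ?e n)" if "n \<le> m" for m n
  proof -
    have "(\<integral>\<^sup>+x. ennreal ((cmod (H m x - H n x))\<^sup>2) \<partial>lborel) = (\<integral>\<^sup>+x. ennreal ((cmod (fourier (\<lambda>x. G m x - G n x) x))\<^sup>2) \<partial>lborel)"
      unfolding H_def by (simp add: fourier_diff Gi)
    also have "\<dots> \<le> (\<integral>\<^sup>+x. ennreal ((cmod (G m x - G n x))\<^sup>2) \<partial>lborel)"
      by (intro nn_integral_fourier_le Bochner_Integration.integrable_diff Gi)
    also have "\<dots> \<le> (\<integral>\<^sup>+x. ?T (r m) x + ?T (r n) x \<partial>lborel)"
      by (intro nn_integral_mono) (auto simp: G_def)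
    also have "\<dots> = (\<integral>\<^sup>+x. ?T (r m) x \<partial>lborel) + (\<integral>\<^sup>+x. ?T (r n) x \<partial>lborel)"
      by (intro nn_integral_add) measurable
    also have "\<dots> \<le> ennreal (?e m) + ennreal (?e n)"
      by (intro add_mono r)
    also have "\<dots> \<le> ennreal (?e n) + ennreal (?e n)"
      using that by (intro add_mono ennreal_leI power_decreasing) simp_all
    finally show ?thesis by (simp flip: ennreal_plus)
  qed
  have "AE x in lborel. convergent (\<lambda>n. H n x)"
  proof -
    let ?S = "\<lambda>x. \<Sum>n. ennreal (2 ^ n * (cmod (H (Suc n) x - H n x))\<^sup>2)"
    have "(\<integral>\<^sup>+x. ?S x \<partial>lborel) = (\<Sum>n. \<integral>\<^sup>+x. ennreal (2 ^ n * (cmod (H (Suc n) x - H n x))\<^sup>2) \<partial>lborel)"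
      by (intro nn_integral_suminf) measurable
    also have "\<dots> \<le> (\<Sum>n. ennreal (2 * (1 / 4) ^ n))"
    proof (intro suminf_le)
      fix n
      have "(\<integral>\<^sup>+x. ennreal (2 ^ n * (cmod (H (Suc n) x - H n x))\<^sup>2) \<partial>lborel)
          = ennreal (2 ^ n) * (\<integral>\<^sup>+x. ennreal ((cmod (H (Suc n) x - H n x))\<^sup>2) \<partial>lborel)"
        by (subst nn_integral_cmult[symmetric]) (simp_all add: ennreal_mult)
      also have "\<dots> \<le> ennreal (2 ^ n) * ennreal (2 * ?e n)"
        by (intro mult_left_mono D) simp_all
      also have "\<dots> = ennreal (2 * (1 / 4) ^ n)"
      proof -
        have "(2::real) ^ n * (2 * ?e n) = 2 * (2 * (1 / 8)) ^ n" unfolding power_mult_distrib by simp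
        then show ?thesis by (simp flip: ennreal_mult)
      qed
      finally show "(\<integral>\<^sup>+x. ennreal (2 ^ n * (cmod (H (Suc n) x - H n x))\<^sup>2) \<partial>lborel) \<le> ennreal (2 * (1 / 4) ^ n)" .
    qed simp_all
    also have "\<dots> < \<infinity>"
    proof -
      have "summable (\<lambda>n. 2 * (1 / 4 :: real) ^ n)"
        by (intro summable_mult summable_geometric) simp
      then have "(\<Sum>n. ennreal (2 * (1 / 4) ^ n)) \<noteq> top"
        by (rule ennreal_suminf_neq_top) simp
      then show ?thesis by (simp only: infinity_ennreal_def less_top)
    qed
    finally have "(\<integral>\<^sup>+x. ?S x \<partial>lborel) \<noteq> \<infinity>" by (rule less_imp_neq)
    then have "AE x in lborel. ?S x \<noteq> \<infinity>"
      by (intro nn_integral_noteq_infinite) simp_all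
    then show ?thesis
      by eventually_elim (rule convergent_if_weighted_square_summable)
  qed
  \<comment> \<open>On the null set of divergence \<open>lim\<close> is an unspecified value;
    measurability holds all the same.\<close>
  define h where "h x = lim (\<lambda>n. H n x)" for x
  have hm [measurable]: "h \<in> borel_measurable borel"
    unfolding h_def[abs_def] by measurable
  have lim: "AE x in lborel. (\<lambda>n. H n x) \<longlonglongrightarrow> h x"
    using \<open>AE x in lborel. convergent (\<lambda>n. H n x)\<close>
    by eventually_elim (simp add: h_def convergent_LIMSEQ_iff)
  have h_le: "(\<integral>\<^sup>+x. ennreal ((cmod (h x))\<^sup>2) \<partial>lborel) \<le> (\<integral>\<^sup>+x. ennreal ((cmod (g x))\<^sup>2) \<partial>lborel)"
  proof (rule nn_integral_limit_le[where u = "\<lambda>n x. ennreal ((cmod (H n x))\<^sup>2)"])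
    show "AE x in lborel. (\<lambda>n. ennreal ((cmod (H n x))\<^sup>2)) \<longlonglongrightarrow> ennreal ((cmod (h x))\<^sup>2)"
      using lim by eventually_elim (intro tendsto_ennrealI tendsto_intros)
  qed (use H_le in simp_all)
  have h_D: "(\<integral>\<^sup>+x. ennreal ((cmod (h x - H n x))\<^sup>2) \<partial>lborel) \<le> ennreal (2 * ?e n)" for n
  \<comment> \<open>The index \<open>m + n\<close> keeps every term past \<open>n\<close>, where the
    Cauchy estimate \<open>D\<close> applies, while \<open>m\<close> tends to infinity.\<close>
  proof (rule nn_integral_limit_le[where u = "\<lambda>m x. ennreal ((cmod (H (m + n) x - H n x))\<^sup>2)"])
    show "AE x in lborel. (\<lambda>m. ennreal ((cmod (H (m + n) x - H n x))\<^sup>2)) \<longlonglongrightarrow> ennreal ((cmod (h x - H n x))\<^sup>2)"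
      using lim by eventually_elim (intro tendsto_ennrealI tendsto_intros LIMSEQ_ignore_initial_segment)
  qed (use D in simp_all)
  have pairing: "integrable lborel (\<lambda>x. h x * \<psi> x) \<and> (\<integral>x. h x * \<psi> x \<partial>lborel) = (\<integral>x. g x * fourier \<psi> x \<partial>lborel)"
    if \<psi>: "\<psi> \<in> schwartz2" for \<psi>
  proof
    note F\<psi> = fourier_schwartz2[OF \<psi>]
    have [measurable]: "\<psi> \<in> borel_measurable borel" "fourier \<psi> \<in> borel_measurable borel"
      using \<psi> F\<psi> schwartz2_measurable by blast+
    show hi: "integrable lborel (\<lambda>x. h x * \<psi> x)"
      using schwartz2_L2(2)[OF \<psi>] h_le fin by (intro integrable_mult_L2) simp_all
    have Hi: "integrable lborel (\<lambda>x. H n x * \<psi> x)" for n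
      using schwartz2_L2(2)[OF \<psi>] H_le[of n] fin by (intro integrable_mult_L2) simp_all
    have l1: "(\<lambda>n. \<integral>x. H n x * \<psi> x \<partial>lborel) \<longlonglongrightarrow> (\<integral>x. h x * \<psi> x \<partial>lborel)"
      by (rule L2_pairing_tendsto[OF _ _ hi Hi h_D \<psi>]) measurable
    have gF: "integrable lborel (\<lambda>x. g x * fourier \<psi> x)"
      using schwartz2_L2(2)[OF F\<psi>] fin by (intro integrable_mult_L2) simp_all
    have l2: "(\<lambda>n. \<integral>x. G n x * fourier \<psi> x \<partial>lborel) \<longlonglongrightarrow> (\<integral>x. g x * fourier \<psi> x \<partial>lborel)"
    proof (rule L2_pairing_tendsto[OF _ _ gF _ _ F\<psi>])
      show "integrable lborel (\<lambda>x. G n x * fourier \<psi> x)" for n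
        using schwartz2_L2(2)[OF F\<psi>] G_le[of n] fin by (intro integrable_mult_L2) simp_all
      have "(\<integral>\<^sup>+x. ennreal ((cmod (g x - G n x))\<^sup>2) \<partial>lborel) = (\<integral>\<^sup>+x. ?T (r n) x \<partial>lborel)" for n
        by (intro nn_integral_cong) (simp add: G_def)
      then show "(\<integral>\<^sup>+x. ennreal ((cmod (g x - G n x))\<^sup>2) \<partial>lborel) \<le> ennreal (2 * ?e n)" for n
        using r[of n] by (simp, elim order_trans) (intro ennreal_leI, simp)
    qed measurable
    have "(\<integral>x. H n x * \<psi> x \<partial>lborel) = (\<integral>x. G n x * fourier \<psi> x \<partial>lborel)" for n
      unfolding H_def by (rule fourier_multiplication[OF Gi schwartz2_integrable[OF \<psi>]])
    then show "(\<integral>x. h x * \<psi> x \<partial>lborel) = (\<integral>x. g x * fourier \<psi> x \<partial>lborel)"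
      using l1 LIMSEQ_unique[OF _ l2] by simp
  qed
  show ?thesis using hm h_le pairing by blast
qed

section \<open>Square norms of Fourier multipliers of distributions\<close>

text \<open>\<open>l2sq\<close> is an infimum over the functions that represent a functional. Upper
  bounds for it come from exhibiting one representative; exploiting a finite value means taking a
  near-optimal one, up to a positive error.\<close>

definition represents :: "distr \<Rightarrow> testfun \<Rightarrow> bool" where
  "represents T g \<longleftrightarrow> g \<in> borel_measurable borel \<and>
     (\<forall>\<psi>\<in>schwartz2. integrable lborel (\<lambda>z. g z * \<psi> z) \<and> T \<psi> = (\<integral>z. g z * \<psi> z \<partial>lborel))"

definition nsq :: "testfun \<Rightarrow> ennreal" where
  "nsq g = (\<integral>\<^sup>+z. ennreal ((cmod (g z))\<^sup>2) \<partial>lborel)"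

lemma l2sq_altdef: "l2sq T = Inf {nsq g |g. represents T g}"
  unfolding l2sq_def represents_def nsq_def by simp

lemma l2sq_le: "represents T g \<Longrightarrow> l2sq T \<le> nsq g"
  unfolding l2sq_altdef by (intro Inf_lower) blast

lemma l2sq_approx:
  assumes "l2sq T \<noteq> \<infinity>" "e > 0"
  shows "\<exists>g. represents T g \<and> nsq g \<le> l2sq T + ennreal e"
proof -
  have "l2sq T < l2sq T + ennreal e"
    using assms by (simp add: ennreal_add_left_cancel_less[of "l2sq T" 0, simplified])
  then have "Inf {nsq g |g. represents T g} < l2sq T + ennreal e"
    by (simp only: l2sq_altdef)
  then obtain g where "represents T g" "nsq g < l2sq T + ennreal e"
    unfolding Inf_less_iff by blast
  then show ?thesis using less_imp_le by blast
qed

lemma l2sq_mono_represents: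
  assumes "\<And>g. represents T g \<Longrightarrow> nsq g < \<infinity> \<Longrightarrow> \<exists>h. represents T' h \<and> nsq h \<le> nsq g"
  shows "l2sq T' \<le> l2sq T"
  unfolding l2sq_altdef[of T]
proof (rule Inf_greatest)
  fix x assume "x \<in> {nsq g |g. represents T g}"
  then obtain g where g: "x = nsq g" "represents T g" by blast
  show "l2sq T' \<le> x"
  proof (cases "nsq g < \<infinity>")
    case True
    then show ?thesis using assms[OF g(2)] l2sq_le g(1) order_trans by blast
  next
    case False
    then have "nsq g = top" unfolding infinity_ennreal_def less_top[symmetric] by simp
    then show ?thesis by (simp add: g(1))
  qed
qed

text \<open>Representatives are transported in each direction by the extended transform. For a
  representative of \<open>T\<close> it is applied after a reflection, because
  \<open>inv_fourier \<psi>\<close> is a reflected \<open>fourier \<psi>\<close>; for one of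
  \<open>dinv_fourier T\<close>, inversion writes \<open>T \<psi>\<close> as
  \<open>dinv_fourier T (fourier \<psi>)\<close>.\<close>

theorem l2sq_dinv_fourier: "l2sq (dinv_fourier T) = l2sq T"
proof (rule antisym)
  show "l2sq (dinv_fourier T) \<le> l2sq T"
  proof (rule l2sq_mono_represents)
    fix g assume g: "represents T g" "nsq g < \<infinity>"
    then have [measurable]: "g \<in> borel_measurable borel" unfolding represents_def by blast
    have nsq_eq: "nsq (\<lambda>x. g (- x)) = nsq g"
      using nn_integral_reflect_translate(1)[of "\<lambda>x. ennreal ((cmod (g x))\<^sup>2)" 0] unfolding nsq_def by simp
    have "\<exists>h\<in>borel_measurable borel. nsq h \<le> nsq (\<lambda>x. g (- x)) \<and>
      (\<forall>\<psi>\<in>schwartz2. integrable lborel (\<lambda>x. h x * \<psi> x) \<and> (\<integral>x. h x * \<psi> x \<partial>lborel) = (\<integral>x. g (- x) * fourier \<psi> x \<partial>lborel))"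
      unfolding nsq_def by (rule fourier_L2_extension) (use g(2) nsq_eq in \<open>simp_all add: nsq_def\<close>)
    then obtain h where h: "h \<in> borel_measurable borel" "nsq h \<le> nsq g"
      "\<And>\<psi>. \<psi> \<in> schwartz2 \<Longrightarrow> integrable lborel (\<lambda>x. h x * \<psi> x) \<and> (\<integral>x. h x * \<psi> x \<partial>lborel) = (\<integral>x. g (- x) * fourier \<psi> x \<partial>lborel)"
      unfolding nsq_eq by blast
    have "dinv_fourier T \<psi> = (\<integral>x. h x * \<psi> x \<partial>lborel)" if "\<psi> \<in> schwartz2" for \<psi>
    proof -
      have *: "integrable lborel (\<lambda>x. g x * inv_fourier \<psi> x)" "T (inv_fourier \<psi>) = (\<integral>x. g x * inv_fourier \<psi> x \<partial>lborel)"
        using g(1) inv_fourier_schwartz2[OF that] unfolding represents_def by blast+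
      have "T (inv_fourier \<psi>) = (\<integral>x. g (- x) * fourier \<psi> x \<partial>lborel)"
        unfolding *(2) using lborel_scale[OF *(1), of "-1" 0] by (simp add: inv_fourier_eq)
      then show ?thesis using h(3)[OF that] by (simp add: dinv_fourier_def)
    qed
    then show "\<exists>h. represents (dinv_fourier T) h \<and> nsq h \<le> nsq g"
      using h unfolding represents_def by blast
  qed
  show "l2sq T \<le> l2sq (dinv_fourier T)"
  proof (rule l2sq_mono_represents)
    fix g assume g: "represents (dinv_fourier T) g" "nsq g < \<infinity>"
    then have gm: "g \<in> borel_measurable borel" unfolding represents_def by blast
    from fourier_L2_extension[OF gm g(2)[unfolded nsq_def]]
    obtain h where h: "h \<in> borel_measurable borel" "nsq h \<le> nsq g"
      "\<And>\<psi>. \<psi> \<in> schwartz2 \<Longrightarrow> integrable lborel (\<lambda>x. h x * \<psi> x) \<and> (\<integral>x. h x * \<psi> x \<partial>lborel) = (\<integral>x. g x * fourier \<psi> x \<partial>lborel)"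
      unfolding nsq_def by blast
    have "T \<psi> = (\<integral>x. h x * \<psi> x \<partial>lborel)" if "\<psi> \<in> schwartz2" for \<psi>
    proof -
      have "T \<psi> = dinv_fourier T (fourier \<psi>)"
        unfolding dinv_fourier_def inv_fourier_fourier[OF that] ..
      also have "\<dots> = (\<integral>x. g x * fourier \<psi> x \<partial>lborel)"
        using g(1) fourier_schwartz2[OF that] unfolding represents_def by blast
      finally show ?thesis using h(3)[OF that] by simp
    qed
    then show "\<exists>h. represents T h \<and> nsq h \<le> nsq g"
      using h unfolding represents_def by blast
  qed
qed

section \<open>Linear functionals and multipliers of test functions\<close>

definition schwartz_linear :: "distr \<Rightarrow> bool" where
  "schwartz_linear T \<longleftrightarrow>
     (\<forall>\<psi>1\<in>schwartz2. \<forall>\<psi>2\<in>schwartz2. T (\<lambda>z. \<psi>1 z + \<psi>2 z) = T \<psi>1 + T \<psi>2) \<and>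
     (\<forall>\<psi>\<in>schwartz2. \<forall>c. T (\<lambda>z. c * \<psi> z) = c * T \<psi>)"

lemma tempered_imp_linear: "tempered T \<Longrightarrow> schwartz_linear T"
  unfolding tempered_def schwartz_linear_def by blast

lemma schwartz_linear_dfourier:
  assumes "schwartz_linear T"
  shows "schwartz_linear (dfourier T)"
  unfolding schwartz_linear_def
proof (intro conjI ballI allI)
  fix g h assume gh: "g \<in> schwartz2" "h \<in> schwartz2"
  have "fourier (\<lambda>z. g z + h z) = (\<lambda>\<xi>. fourier g \<xi> + fourier h \<xi>)"
    by (rule ext) (rule fourier_add[OF schwartz2_integrable[OF gh(1)] schwartz2_integrable[OF gh(2)]])
  then show "dfourier T (\<lambda>z. g z + h z) = dfourier T g + dfourier T h"
    unfolding dfourier_def using assms fourier_schwartz2[OF gh(1)] fourier_schwartz2[OF gh(2)]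
    by (simp add: schwartz_linear_def)
next
  fix g c assume g: "g \<in> schwartz2"
  have "fourier (\<lambda>z. c * g z) = (\<lambda>\<xi>. c * fourier g \<xi>)"
    by (rule ext) (rule fourier_cmult)
  then show "dfourier T (\<lambda>z. c * g z) = c * dfourier T g"
    unfolding dfourier_def using assms fourier_schwartz2[OF g]
    by (simp add: schwartz_linear_def)
qed

lemma schwartz_linear_sum:
  assumes T: "schwartz_linear T" and "finite I" and "\<And>i. i \<in> I \<Longrightarrow> \<psi> i \<in> schwartz2"
  shows "T (\<lambda>z. \<Sum>i\<in>I. \<psi> i z) = (\<Sum>i\<in>I. T (\<psi> i))"
  using assms(2,3)
proof (induction I rule: finite_induct)
  case empty
  have "T (\<lambda>z. 0 * (\<lambda>z. 0) z) = 0 * T (\<lambda>z. 0)"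
    by (rule bspec[OF conjunct2[OF T[unfolded schwartz_linear_def]] schwartz2_zero, rule_format])
  then show ?case by simp
next
  case (insert i I)
  have "T (\<lambda>z. \<psi> i z + (\<Sum>j\<in>I. \<psi> j z)) = T (\<psi> i) + T (\<lambda>z. \<Sum>j\<in>I. \<psi> j z)"
    using T insert.prems schwartz2_sum[of I \<psi>] unfolding schwartz_linear_def by simp
  then show ?case using insert by simp
qed

text \<open>Broader than the real-valued Schwartz functions: the constant 1 must qualify, since it
  serves as a trivial auxiliary cutoff.\<close>

definition multiplier :: "(real \<times> real \<Rightarrow> real) \<Rightarrow> bool" where
  "multiplier m \<longleftrightarrow> m \<in> borel_measurable borel \<and>
     (\<forall>\<psi>\<in>schwartz2. (\<lambda>z. complex_of_real (m z) * \<psi> z) \<in> schwartz2)"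

lemma multiplierD:
  assumes "multiplier m"
  shows "m \<in> borel_measurable borel" "\<psi> \<in> schwartz2 \<Longrightarrow> (\<lambda>z. complex_of_real (m z) * \<psi> z) \<in> schwartz2"
  using assms unfolding multiplier_def by blast+

lemma multiplier_schwartz2:
  assumes "(\<lambda>z. complex_of_real (m z)) \<in> schwartz2"
  shows "multiplier m"
proof -
  have "(\<lambda>z. Re (complex_of_real (m z))) \<in> borel_measurable borel"
    by (rule measurable_compose[OF schwartz2_measurable[OF assms] borel_measurable_Re])
  then show ?thesis using schwartz2_mult[OF assms] unfolding multiplier_def by simp
qed

lemma multiplier_one: "multiplier (\<lambda>z. 1)"
  unfolding multiplier_def by simp

lemma cmod_sum_mult_square_le:
  fixes c :: "'i \<Rightarrow> real" and g :: "'i \<Rightarrow> complex"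
  shows "(cmod (\<Sum>p\<in>P. complex_of_real (c p) * g p))\<^sup>2 \<le> (\<Sum>p\<in>P. (c p)\<^sup>2) * (\<Sum>p\<in>P. (cmod (g p))\<^sup>2)"
proof -
  have "cmod (\<Sum>p\<in>P. complex_of_real (c p) * g p) \<le> (\<Sum>p\<in>P. \<bar>c p\<bar> * cmod (g p))"
    by (rule sum_norm_le) (simp add: norm_mult)
  then have "(cmod (\<Sum>p\<in>P. complex_of_real (c p) * g p))\<^sup>2 \<le> (\<Sum>p\<in>P. \<bar>c p\<bar> * cmod (g p))\<^sup>2"
    by (rule power_mono) simp
  also have "\<dots> \<le> (\<Sum>p\<in>P. \<bar>c p\<bar>\<^sup>2) * (\<Sum>p\<in>P. (cmod (g p))\<^sup>2)"
    by (rule Cauchy_Schwarz_ineq_sum)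
  finally show ?thesis by simp
qed

text \<open>The cutoffs \<open>\<kappa>\<close> confine the unknown representatives of the pieces \<open>\<phi>\<^sub>p U\<close> to
  neighbourhoods of bounded overlap, which keeps the constant independent of the size of \<open>P\<close>.\<close>
theorem sum_l2sq_dmult_le:
  fixes \<phi> \<kappa> :: "'p \<Rightarrow> real \<times> real \<Rightarrow> real" and \<psi> :: "'k \<Rightarrow> real \<times> real \<Rightarrow> real"
  assumes U: "schwartz_linear U" and P: "finite P" and K: "finite K"
    and m\<phi>: "\<And>p. p \<in> P \<Longrightarrow> multiplier (\<phi> p)" and m\<kappa>: "\<And>p. p \<in> P \<Longrightarrow> multiplier (\<kappa> p)"
    and m\<psi>: "\<And>k. k \<in> K \<Longrightarrow> multiplier (\<psi> k)"
    and part: "\<And>k z. k \<in> K \<Longrightarrow> \<psi> k z \<noteq> 0 \<Longrightarrow> (\<Sum>p\<in>P. \<kappa> p z * \<phi> p z) = 1"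
    and A: "\<And>z. (\<Sum>k\<in>K. (\<psi> k z)\<^sup>2) \<le> A" "A > 0" and B: "\<And>z. (\<Sum>p\<in>P. (\<kappa> p z)\<^sup>2) \<le> B" "B > 0"
  shows "(\<Sum>k\<in>K. l2sq (dmult (\<psi> k) U)) \<le> ennreal (A * B) * (\<Sum>p\<in>P. l2sq (dmult (\<phi> p) U))"
proof (cases "\<exists>p\<in>P. l2sq (dmult (\<phi> p) U) = \<infinity>")
  case True
  then have "(\<Sum>p\<in>P. l2sq (dmult (\<phi> p) U)) = \<infinity>"
    using P by (simp add: ennreal_sum_eq_top)
  then have "ennreal (A * B) * (\<Sum>p\<in>P. l2sq (dmult (\<phi> p) U)) = top"
    using A B by (simp add: ennreal_mult_top)
  then show ?thesis by simp
next
  case False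
  show ?thesis
  proof (rule ennreal_le_epsilon)
    fix e :: real assume e: "e > 0"
    \<comment> \<open>Each of the \<open>card P\<close> representatives costs an error
      \<open>d\<close>, enlarged by \<open>A * B\<close>; the added 1 keeps the denominator nonzero
      when \<open>P\<close> is empty.\<close>
    define d where "d = e / (A * B * (real (card P) + 1))"
    have AB: "A * B > 0" using A B by simp
    have d: "d > 0" unfolding d_def using e AB by simp
    have "\<forall>p\<in>P. \<exists>g. represents (dmult (\<phi> p) U) g \<and> nsq g \<le> l2sq (dmult (\<phi> p) U) + ennreal d"
      using False l2sq_approx[OF _ d] by blast
    then obtain g where g: "\<And>p. p \<in> P \<Longrightarrow> represents (dmult (\<phi> p) U) (g p)"
      and gn: "\<And>p. p \<in> P \<Longrightarrow> nsq (g p) \<le> l2sq (dmult (\<phi> p) U) + ennreal d"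
      by (metis (no_types))
    have gm [measurable]: "p \<in> P \<Longrightarrow> g p \<in> borel_measurable borel" for p
      using g unfolding represents_def by blast
    have \<kappa>m [measurable]: "p \<in> P \<Longrightarrow> \<kappa> p \<in> borel_measurable borel" for p
      using multiplierD(1)[OF m\<kappa>] .
    have \<psi>m [measurable]: "k \<in> K \<Longrightarrow> \<psi> k \<in> borel_measurable borel" for k
      using multiplierD(1)[OF m\<psi>] .
    \<comment> \<open>A single glued function \<open>G\<close> serves all \<open>k\<close>; only its
      product with \<open>\<psi> k\<close> has to represent a piece.\<close>
    define G where "G z = (\<Sum>p\<in>P. complex_of_real (\<kappa> p z) * g p z)" for z
    have [measurable]: "G \<in> borel_measurable borel"
      unfolding G_def[abs_def] by measurable
    define h where "h k z = complex_of_real (\<psi> k z) * G z" for k z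
    have rep: "represents (dmult (\<psi> k) U) (h k)" if k: "k \<in> K" for k
      unfolding represents_def
    proof (intro conjI ballI)
      show "h k \<in> borel_measurable borel"
        unfolding h_def[abs_def] using k by measurable
      fix \<eta> assume \<eta>: "\<eta> \<in> schwartz2"
      \<comment> \<open>The factors \<open>\<kappa> p\<close> and \<open>\<psi> k\<close> are moved
        onto the test function, so that the representation of \<open>dmult (\<phi> p) U\<close> can
        be applied to \<open>\<zeta> p\<close>.\<close>
      define \<zeta> where "\<zeta> p z = complex_of_real (\<kappa> p z) * (complex_of_real (\<psi> k z) * \<eta> z)" for p z
      have \<zeta>: "\<zeta> p \<in> schwartz2" if "p \<in> P" for p
        unfolding \<zeta>_def[abs_def] by (intro multiplierD(2)[OF m\<kappa>[OF that]] multiplierD(2)[OF m\<psi>[OF k]] \<eta>)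
      have eq: "h k z * \<eta> z = (\<Sum>p\<in>P. g p z * \<zeta> p z)" for z
        unfolding h_def G_def \<zeta>_def sum_distrib_left sum_distrib_right
        by (intro sum.cong refl) (simp only: mult_ac)
      have int: "integrable lborel (\<lambda>z. g p z * \<zeta> p z)" "dmult (\<phi> p) U (\<zeta> p) = (\<integral>z. g p z * \<zeta> p z \<partial>lborel)" if "p \<in> P" for p
        using g[OF that] \<zeta>[OF that] unfolding represents_def by blast+
      show "integrable lborel (\<lambda>z. h k z * \<eta> z)"
        unfolding eq by (intro Bochner_Integration.integrable_sum int)
      have "(\<integral>z. h k z * \<eta> z \<partial>lborel) = (\<Sum>p\<in>P. \<integral>z. g p z * \<zeta> p z \<partial>lborel)"
        unfolding eq by (intro Bochner_Integration.integral_sum int)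
      also have "\<dots> = (\<Sum>p\<in>P. U (\<lambda>z. complex_of_real (\<phi> p z) * \<zeta> p z))"
        using int(2) by (intro sum.cong refl) (simp add: dmult_def)
      also have "\<dots> = U (\<lambda>z. \<Sum>p\<in>P. complex_of_real (\<phi> p z) * \<zeta> p z)"
        using multiplierD(2)[OF m\<phi> \<zeta>] by (intro schwartz_linear_sum[symmetric] U P) blast
      also have "(\<lambda>z. \<Sum>p\<in>P. complex_of_real (\<phi> p z) * \<zeta> p z) = (\<lambda>z. complex_of_real (\<psi> k z) * \<eta> z)"
      proof
        fix z
        have "(\<Sum>p\<in>P. complex_of_real (\<phi> p z) * \<zeta> p z) = complex_of_real (\<Sum>p\<in>P. \<kappa> p z * \<phi> p z) * (complex_of_real (\<psi> k z) * \<eta> z)"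
          unfolding \<zeta>_def of_real_sum of_real_mult sum_distrib_right by (intro sum.cong refl) (simp only: mult_ac)
        then show "(\<Sum>p\<in>P. complex_of_real (\<phi> p z) * \<zeta> p z) = complex_of_real (\<psi> k z) * \<eta> z"
          using part[OF k, of z] by (cases "\<psi> k z = 0") simp_all
      qed
      finally show "dmult (\<psi> k) U \<eta> = (\<integral>z. h k z * \<eta> z \<partial>lborel)"
        unfolding dmult_def ..
    qed
    have "(\<Sum>k\<in>K. l2sq (dmult (\<psi> k) U)) \<le> (\<Sum>k\<in>K. nsq (h k))"
      by (intro sum_mono l2sq_le rep)
    also have "\<dots> = (\<integral>\<^sup>+z. (\<Sum>k\<in>K. ennreal ((cmod (h k z))\<^sup>2)) \<partial>lborel)"
      unfolding nsq_def h_def by (intro nn_integral_sum[symmetric]) measurable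
    also have "\<dots> \<le> (\<integral>\<^sup>+z. ennreal (A * B) * (\<Sum>p\<in>P. ennreal ((cmod (g p z))\<^sup>2)) \<partial>lborel)"
    proof (intro nn_integral_mono)
      fix z
      have "(\<Sum>k\<in>K. (cmod (h k z))\<^sup>2) = (\<Sum>k\<in>K. (\<psi> k z)\<^sup>2) * (cmod (G z))\<^sup>2"
        unfolding h_def by (simp add: norm_mult power_mult_distrib sum_distrib_right)
      also have "\<dots> \<le> A * ((\<Sum>p\<in>P. (\<kappa> p z)\<^sup>2) * (\<Sum>p\<in>P. (cmod (g p z))\<^sup>2))"
        unfolding G_def using A(2) by (intro mult_mono A(1) cmod_sum_mult_square_le) simp_all
      also have "\<dots> \<le> A * (B * (\<Sum>p\<in>P. (cmod (g p z))\<^sup>2))"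
        using A(2) by (intro mult_left_mono mult_right_mono B(1)) (simp_all add: sum_nonneg)
      finally have "(\<Sum>k\<in>K. (cmod (h k z))\<^sup>2) \<le> (A * B) * (\<Sum>p\<in>P. (cmod (g p z))\<^sup>2)"
        by (simp only: mult.assoc)
      then have "ennreal (\<Sum>k\<in>K. (cmod (h k z))\<^sup>2) \<le> ennreal ((A * B) * (\<Sum>p\<in>P. (cmod (g p z))\<^sup>2))"
        by (rule ennreal_leI)
      then show "(\<Sum>k\<in>K. ennreal ((cmod (h k z))\<^sup>2)) \<le> ennreal (A * B) * (\<Sum>p\<in>P. ennreal ((cmod (g p z))\<^sup>2))"
        using AB by (simp add: ennreal_mult sum_ennreal sum_nonneg)
    qed
    also have "\<dots> = ennreal (A * B) * (\<Sum>p\<in>P. nsq (g p))"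
    proof -
      have "(\<integral>\<^sup>+z. ennreal (A * B) * (\<Sum>p\<in>P. ennreal ((cmod (g p z))\<^sup>2)) \<partial>lborel)
          = ennreal (A * B) * (\<integral>\<^sup>+z. (\<Sum>p\<in>P. ennreal ((cmod (g p z))\<^sup>2)) \<partial>lborel)"
        by (intro nn_integral_cmult) measurable
      also have "(\<integral>\<^sup>+z. (\<Sum>p\<in>P. ennreal ((cmod (g p z))\<^sup>2)) \<partial>lborel) = (\<Sum>p\<in>P. nsq (g p))"
        unfolding nsq_def by (intro nn_integral_sum) measurable
      finally show ?thesis .
    qed
    also have "\<dots> \<le> ennreal (A * B) * (\<Sum>p\<in>P. l2sq (dmult (\<phi> p) U) + ennreal d)"
      by (intro mult_left_mono sum_mono gn) simp_all
    also have "\<dots> = ennreal (A * B) * (\<Sum>p\<in>P. l2sq (dmult (\<phi> p) U)) + ennreal (A * B) * (ennreal (real (card P)) * ennreal d)"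
      by (simp add: sum.distrib distrib_left ennreal_of_nat_eq_real_of_nat)
    also have "ennreal (A * B) * (ennreal (real (card P)) * ennreal d) = ennreal (A * B * (real (card P) * d))"
      using AB d by (simp add: ennreal_mult)
    also have "\<dots> \<le> ennreal e"
    proof (rule ennreal_leI)
      have "A * B * (real (card P) * d) \<le> A * B * ((real (card P) + 1) * d)"
        using AB d by (intro mult_left_mono mult_right_mono) simp_all
      also have "\<dots> = e"
      proof -
        have "A * B * (real (card P) + 1) \<noteq> 0" using A(2) B(2) by (simp add: add_nonneg_eq_0_iff)
        then show ?thesis unfolding d_def by (simp add: mult.assoc[symmetric])
      qed
      finally show "A * B * (real (card P) * d) \<le> e" .
    qed
    finally show "(\<Sum>k\<in>K. l2sq (dmult (\<psi> k) U)) \<le> ennreal (A * B) * (\<Sum>p\<in>P. l2sq (dmult (\<phi> p) U)) + ennreal e"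
      by (simp add: add_left_mono)
  qed
qed

section \<open>Supports of the dyadic cutoffs\<close>

lemma sum_telescope_differences:
  fixes u d :: "nat \<Rightarrow> real"
  assumes d: "\<And>j. d j = (if j = 0 then u 0 else u j - u (j - 1))" and "m \<le> n"
  shows "(\<Sum>i=m..n. d i) = u n - (if m = 0 then 0 else u (m - 1))"
  using \<open>m \<le> n\<close>
proof (induction n rule: dec_induct)
  case base
  show ?case by (simp add: d[of m])
next
  case (step n)
  then show ?case by (simp add: d[of "Suc n"])
qed

text \<open>The least active index \<open>Min S\<close> confines all others to
  \<open>{Min S..Min S + d}\<close>, whatever the size of \<open>J\<close>.\<close>

lemma sum_squares_bounded_overlap:
  fixes v :: "nat \<Rightarrow> real"
  assumes bound: "\<And>j. \<bar>v j\<bar> \<le> M" and near: "\<And>j j'. v j \<noteq> 0 \<Longrightarrow> v j' \<noteq> 0 \<Longrightarrow> j' \<le> j + d"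
    and "finite J"
  shows "(\<Sum>j\<in>J. (v j)\<^sup>2) \<le> real (d + 1) * M\<^sup>2"
proof -
  define S where "S = {j\<in>J. v j \<noteq> 0}"
  have S: "finite S" unfolding S_def using \<open>finite J\<close> by simp
  have "card S \<le> d + 1"
  proof (cases "S = {}")
    case False
    then have "Min S \<in> S" using S by simp
    then have "S \<subseteq> {Min S..Min S + d}"
      using S near unfolding S_def by auto
    then have "card S \<le> card {Min S..Min S + d}" by (intro card_mono) simp_all
    then show ?thesis by simp
  qed simp
  have "(\<Sum>j\<in>J. (v j)\<^sup>2) = (\<Sum>j\<in>S. (v j)\<^sup>2)"
    using \<open>finite J\<close> unfolding S_def by (intro sum.mono_neutral_right) auto
  also have "\<dots> \<le> (\<Sum>j\<in>S. M\<^sup>2)"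
    by (intro sum_mono abs_le_square_iff[THEN iffD1]) (use bound in \<open>metis abs_ge_self order_trans\<close>)
  also have "\<dots> = real (card S) * M\<^sup>2" by simp
  also have "\<dots> \<le> real (d + 1) * M\<^sup>2"
    using \<open>card S \<le> d + 1\<close> by (intro mult_right_mono) simp_all
  finally show ?thesis .
qed

text \<open>\<open>P\<close> may fail to be a rectangle, as the index sets \<open>Gamma\<close> do,
  so it is enlarged to the product of its projections, where the sum of squares factorises.\<close>

lemma sum_product_le:
  fixes a b :: "nat \<Rightarrow> real"
  assumes "finite P" and A: "\<And>J. finite J \<Longrightarrow> (\<Sum>j\<in>J. (a j)\<^sup>2) \<le> A" and B: "\<And>J. finite J \<Longrightarrow> (\<Sum>j\<in>J. (b j)\<^sup>2) \<le> B"
  shows "(\<Sum>p\<in>P. (a (fst p) * b (snd p))\<^sup>2) \<le> A * B"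
proof -
  have "(\<Sum>p\<in>P. (a (fst p) * b (snd p))\<^sup>2) \<le> (\<Sum>p\<in>fst ` P \<times> snd ` P. (a (fst p) * b (snd p))\<^sup>2)"
    using \<open>finite P\<close> by (intro sum_mono2) (auto simp: image_iff, (metis fst_conv snd_conv)+)
  also have "\<dots> = (\<Sum>i\<in>fst ` P. \<Sum>j\<in>snd ` P. (a i)\<^sup>2 * (b j)\<^sup>2)"
    by (simp add: sum.cartesian_product power_mult_distrib case_prod_unfold)
  also have "\<dots> = (\<Sum>i\<in>fst ` P. (a i)\<^sup>2) * (\<Sum>j\<in>snd ` P. (b j)\<^sup>2)"
    by (rule sum_product[symmetric])
  also have "\<dots> \<le> A * B"
  proof (intro mult_mono A B)
    show "0 \<le> A" using A[of "{}"] by simp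
  qed (use \<open>finite P\<close> in \<open>simp_all add: sum_nonneg\<close>)
  finally show ?thesis .
qed

lemma powr_scaled_le_iff:
  fixes n x c :: real
  shows "2 powr (- n) * \<bar>x\<bar> \<le> c \<longleftrightarrow> \<bar>x\<bar> \<le> c * 2 powr n" "c \<le> 2 powr (- n) * \<bar>x\<bar> \<longleftrightarrow> c * 2 powr n \<le> \<bar>x\<bar>"
  by (simp_all add: powr_minus divide_inverse[symmetric] pos_divide_le_eq pos_le_divide_eq mult.commute)

section \<open>One-dimensional dyadic cutoffs and their tensor products\<close>

lemma theta_eq:
  "theta \<theta>0 j t = (if j = 0 then \<theta>0 (2 powr (- real 0) * t)
     else \<theta>0 (2 powr (- real j) * t) - \<theta>0 (2 powr (- real (j - 1)) * t))"
  unfolding theta_def by (cases j) simp_all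

lemma sum_theta:
  "m \<le> n \<Longrightarrow> (\<Sum>i=m..n. theta \<theta>0 i t)
     = \<theta>0 (2 powr (- real n) * t) - (if m = 0 then 0 else \<theta>0 (2 powr (- real (m - 1)) * t))"
  by (rule sum_telescope_differences[where u = "\<lambda>n. \<theta>0 (2 powr (- real n) * t)", OF theta_eq])

lemma hyp_cutoff_scaled:
  assumes "hyp_cutoff \<theta>0"
  shows "\<bar>t\<bar> \<le> 2 powr n \<Longrightarrow> \<theta>0 (2 powr (- n) * t) = 1"
    and "2 powr (n + 1) < \<bar>t\<bar> \<Longrightarrow> \<theta>0 (2 powr (- n) * t) = 0"
proof -
  have abs: "\<bar>2 powr (- n) * t\<bar> = 2 powr (- n) * \<bar>t\<bar>" by (simp add: abs_mult)
  show "\<theta>0 (2 powr (- n) * t) = 1" if "\<bar>t\<bar> \<le> 2 powr n"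
  proof -
    have "\<bar>2 powr (- n) * t\<bar> \<le> 1" unfolding abs powr_scaled_le_iff using that by simp
    then show ?thesis using assms unfolding hyp_cutoff_def by blast
  qed
  show "\<theta>0 (2 powr (- n) * t) = 0" if "2 powr (n + 1) < \<bar>t\<bar>"
  proof -
    have "\<not> \<bar>2 powr (- n) * t\<bar> \<le> 2"
      unfolding abs powr_scaled_le_iff using that by (simp add: powr_add mult.commute)
    then have "\<bar>2 powr (- n) * t\<bar> > 2" by simp
    then show ?thesis using assms unfolding hyp_cutoff_def by blast
  qed
qed

lemma theta_support:
  assumes h: "hyp_cutoff \<theta>0" and nz: "theta \<theta>0 j t \<noteq> 0"
  shows "\<bar>t\<bar> \<le> 2 powr (real j + 1)" and "j \<ge> 1 \<Longrightarrow> 2 powr (real j - 1) < \<bar>t\<bar>"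
proof -
  show "\<bar>t\<bar> \<le> 2 powr (real j + 1)"
  proof (rule ccontr)
    assume "\<not> \<bar>t\<bar> \<le> 2 powr (real j + 1)"
    then have l: "2 powr (real j + 1) < \<bar>t\<bar>" by simp
    have "2 powr (real (j - 1) + 1) \<le> 2 powr (real j + 1)" by simp
    then have "2 powr (real (j - 1) + 1) < \<bar>t\<bar>" using l by linarith
    then have "theta \<theta>0 j t = 0"
      unfolding theta_eq using hyp_cutoff_scaled(2)[OF h l] hyp_cutoff_scaled(2)[OF h, of "real (j - 1)" t] by (cases "j = 0") simp_all
    with nz show False ..
  qed
  show "2 powr (real j - 1) < \<bar>t\<bar>" if "j \<ge> 1"
  proof (rule ccontr)
    assume "\<not> 2 powr (real j - 1) < \<bar>t\<bar>"
    then have l: "\<bar>t\<bar> \<le> 2 powr (real (j - 1))" using that by (simp add: of_nat_diff)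
    have "2 powr (real (j - 1)) \<le> 2 powr (real j)" by simp
    then have "\<bar>t\<bar> \<le> 2 powr (real j)" using l by linarith
    then have "theta \<theta>0 j t = 0"
      unfolding theta_eq using hyp_cutoff_scaled(1)[OF h l] hyp_cutoff_scaled(1)[OF h, of t "real j"] that by simp
    with nz show False ..
  qed
qed

text \<open>The lower edge of the support of \<open>theta \<theta>0 j'\<close> is strict, which
  excludes \<open>j' = j + 2\<close>.\<close>

lemma theta_overlap:
  assumes h: "hyp_cutoff \<theta>0" and "theta \<theta>0 j t \<noteq> 0" "theta \<theta>0 j' t \<noteq> 0"
  shows "j' \<le> j + 1"
proof (cases "j' = 0")
  case False
  then have "2 powr (real j' - 1) < \<bar>t\<bar>" using theta_support(2)[OF h assms(3)] by simp
  also have "\<bar>t\<bar> \<le> 2 powr (real j + 1)" by (rule theta_support(1)[OF h assms(2)])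
  finally have "real j' - 1 < real j + 1" by simp
  then show ?thesis by linarith
qed simp

lemma theta_bounded:
  assumes h: "hyp_cutoff \<theta>0"
  obtains M where "M > 0" "\<And>j t. \<bar>theta \<theta>0 j t\<bar> \<le> M"
proof -
  have S: "\<theta>0 \<in> schwartz1" and nn: "\<And>t. 0 \<le> \<theta>0 t" using h unfolding hyp_cutoff_def by blast+
  obtain C where C: "C \<ge> 0" "\<And>t. (1 + \<bar>t\<bar>) ^ 0 * \<bar>\<theta>0 t\<bar> \<le> C" using schwartz1_decay[OF S, of 0] by blast
  have le: "\<theta>0 t \<le> C + 1" for t using C(2)[of t] nn[of t] by simp
  have "\<bar>theta \<theta>0 j t\<bar> \<le> C + 1" for j t
    unfolding theta_eq
    using le[of "2 powr (- real 0) * t"] nn[of "2 powr (- real 0) * t"]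
      le[of "2 powr (- real j) * t"] nn[of "2 powr (- real j) * t"]
      le[of "2 powr (- real (j - 1)) * t"] nn[of "2 powr (- real (j - 1)) * t"]
    by (simp only: split: if_split) linarith
  then show ?thesis using that[of "C + 1"] C(1) by simp
qed

text \<open>Neighbouring cutoffs are added so as to give 1 on the support of the middle one; for
  \<open>j = 0\<close> truncated subtraction leaves the indices 0 and 1.\<close>

definition wide_theta :: "(real \<Rightarrow> real) \<Rightarrow> nat \<Rightarrow> real \<Rightarrow> real" where
  "wide_theta \<theta>0 j t = (\<Sum>i=j-1..j+1. theta \<theta>0 i t)"

lemma wide_theta_one:
  assumes h: "hyp_cutoff \<theta>0" and nz: "theta \<theta>0 j t \<noteq> 0"
  shows "wide_theta \<theta>0 j t = 1"
proof -
  have "\<theta>0 (2 powr (- real (j + 1)) * t) = 1"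
    using theta_support(1)[OF h nz] by (intro hyp_cutoff_scaled(1)[OF h]) (simp add: add.commute)
  moreover have "\<theta>0 (2 powr (- real (j - 1 - 1)) * t) = 0" if "j - 1 \<noteq> 0"
  proof (rule hyp_cutoff_scaled(2)[OF h])
    have "real (j - 1 - 1) + 1 = real j - 1" using that by (simp add: of_nat_diff)
    then show "2 powr (real (j - 1 - 1) + 1) < \<bar>t\<bar>"
      using theta_support(2)[OF h nz] that by simp
  qed
  ultimately show ?thesis unfolding wide_theta_def by (subst sum_theta) simp_all
qed

lemma theta_square_sums:
  assumes h: "hyp_cutoff \<theta>0"
  obtains A where "A > 0" "\<And>J t. finite J \<Longrightarrow> (\<Sum>j\<in>J. (theta \<theta>0 j t)\<^sup>2) \<le> A"
    "\<And>J t. finite J \<Longrightarrow> (\<Sum>j\<in>J. (wide_theta \<theta>0 j t)\<^sup>2) \<le> A"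
proof -
  obtain M where M: "M > 0" "\<And>j t. \<bar>theta \<theta>0 j t\<bar> \<le> M" using theta_bounded[OF h] by blast
  \<comment> \<open>\<open>wide_theta\<close> has at most three terms of size \<open>M\<close>, and
    at most 4 of its indices are active at a point; the same constant covers \<open>theta\<close>,
    where at most 2 are active.\<close>
  define A where "A = 4 * (3 * M)\<^sup>2"
  have A: "A > 0" "2 * M\<^sup>2 \<le> A" unfolding A_def using M(1) by (simp_all add: power_mult_distrib)
  have 1: "(\<Sum>j\<in>J. (theta \<theta>0 j t)\<^sup>2) \<le> A" if "finite J" for J t
    using sum_squares_bounded_overlap[of "\<lambda>j. theta \<theta>0 j t" M 1 J] M(2) theta_overlap[OF h] that A(2) by simp
  have w_le: "\<bar>wide_theta \<theta>0 j t\<bar> \<le> 3 * M" for j t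
  proof -
    have "\<bar>wide_theta \<theta>0 j t\<bar> \<le> (\<Sum>i=j-1..j+1. \<bar>theta \<theta>0 i t\<bar>)" unfolding wide_theta_def by (rule sum_abs)
    also have "\<dots> \<le> (\<Sum>i=j-1..j+1. M)" by (intro sum_mono M)
    also have "\<dots> = real (card {j-1..j+1}) * M" by simp
    also have "\<dots> \<le> 3 * M" using M(1) by (intro mult_right_mono) auto
    finally show ?thesis .
  qed
  \<comment> \<open>Three steps: one from each window to an active \<open>theta\<close>, and one
    between the two active indices.\<close>
  have w_near: "j' \<le> j + 3" if nz: "wide_theta \<theta>0 j t \<noteq> 0" "wide_theta \<theta>0 j' t \<noteq> 0" for j j' t
  proof -
    obtain i where i: "i \<in> {j-1..j+1}" "theta \<theta>0 i t \<noteq> 0"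
      using nz(1) unfolding wide_theta_def by (meson sum.neutral)
    obtain i' where i': "i' \<in> {j'-1..j'+1}" "theta \<theta>0 i' t \<noteq> 0"
      using nz(2) unfolding wide_theta_def by (meson sum.neutral)
    from theta_overlap[OF h i(2) i'(2)] i(1) i'(1) show ?thesis unfolding atLeastAtMost_iff by linarith
  qed
  have 2: "(\<Sum>j\<in>J. (wide_theta \<theta>0 j t)\<^sup>2) \<le> A" if "finite J" for J t
    using sum_squares_bounded_overlap[of "\<lambda>j. wide_theta \<theta>0 j t" "3 * M" 3 J] w_le w_near that unfolding A_def by simp
  show ?thesis by (rule that[OF A(1) 1 2])
qed

text \<open>Expanding the differences in both variables leaves a combination of dilates of the
  tensor square of \<open>\<theta>0\<close>.\<close>

lemma hyp_phi_schwartz2: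
  assumes h: "hyp_cutoff \<theta>0"
  shows "(\<lambda>z. complex_of_real (hyp_phi \<theta>0 j1 j2 z)) \<in> schwartz2"
proof -
  have S: "\<theta>0 \<in> schwartz1" using h unfolding hyp_cutoff_def by blast
  let ?D = "\<lambda>a b z. complex_of_real (\<theta>0 (2 powr (- real a) * fst z) * \<theta>0 (2 powr (- real b) * snd z))"
  have D: "?D a b \<in> schwartz2" for a b
    using schwartz2_dilation[OF schwartz2_tensor[OF S S], of "2 powr (- real a)" "2 powr (- real b)"] by simp
  let ?T = "\<lambda>b z. complex_of_real (\<theta>0 (2 powr (- real b) * snd z))"
  have 1: "(\<lambda>z. complex_of_real (theta \<theta>0 j1 (fst z) * \<theta>0 (2 powr (- real b) * snd z))) \<in> schwartz2" for b
    using D[of 0 b] schwartz2_diff[OF D[of j1 b] D[of "j1 - 1" b]]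
    unfolding theta_eq by (cases "j1 = 0") (simp_all add: left_diff_distrib)
  show ?thesis
    using 1[of 0] schwartz2_diff[OF 1[of j2] 1[of "j2 - 1"]]
    unfolding hyp_phi_def theta_eq[of \<theta>0 j2] by (cases "j2 = 0") (simp_all add: right_diff_distrib)
qed

definition wide_hyp_phi :: "(real \<Rightarrow> real) \<Rightarrow> nat \<times> nat \<Rightarrow> real \<times> real \<Rightarrow> real" where
  "wide_hyp_phi \<theta>0 p z = wide_theta \<theta>0 (fst p) (fst z) * wide_theta \<theta>0 (snd p) (snd z)"

lemma wide_hyp_phi_schwartz2:
  assumes h: "hyp_cutoff \<theta>0"
  shows "(\<lambda>z. complex_of_real (wide_hyp_phi \<theta>0 p z)) \<in> schwartz2"
proof -
  have "(\<lambda>z. complex_of_real (wide_hyp_phi \<theta>0 p z))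
     = (\<lambda>z. \<Sum>i=fst p-1..fst p+1. \<Sum>k=snd p-1..snd p+1. complex_of_real (hyp_phi \<theta>0 i k z))"
    unfolding wide_hyp_phi_def wide_theta_def hyp_phi_def sum_product of_real_sum ..
  also have "\<dots> \<in> schwartz2"
    by (intro schwartz2_sum hyp_phi_schwartz2 h)
  finally show ?thesis .
qed

text \<open>The telescoping sequence behind the anisotropic cutoffs: 1 on the box with half-sides
  \<open>2 powr (n * \<alpha>1)\<close> and \<open>2 powr (n * \<alpha>2)\<close>, and 0 outside the
  box of the next index.\<close>

definition aniso_box :: "real \<Rightarrow> real \<Rightarrow> (real \<times> real \<Rightarrow> real) \<Rightarrow> nat \<Rightarrow> real \<times> real \<Rightarrow> real" where
  "aniso_box \<alpha>1 \<alpha>2 \<phi>0 n \<xi> = \<phi>0 (2 powr (- (real n * \<alpha>1)) * fst \<xi>, 2 powr (- (real n * \<alpha>2)) * snd \<xi>)"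

lemma aniso_scale_nat:
  "aniso_scale \<alpha>1 \<alpha>2 (2 powr (- real n)) \<xi> = (2 powr (- (real n * \<alpha>1)) * fst \<xi>, 2 powr (- (real n * \<alpha>2)) * snd \<xi>)"
  unfolding aniso_scale_def by (simp add: powr_powr)

lemma aniso_phi_eq:
  "aniso_phi \<alpha>1 \<alpha>2 \<phi>0 j \<xi> = (if j = 0 then aniso_box \<alpha>1 \<alpha>2 \<phi>0 0 \<xi>
      else aniso_box \<alpha>1 \<alpha>2 \<phi>0 j \<xi> - aniso_box \<alpha>1 \<alpha>2 \<phi>0 (j - 1) \<xi>)"
proof (cases "j = 0")
  case False
  then have "real j - 1 = real (j - 1)" by (simp add: of_nat_diff)
  with False show ?thesis unfolding aniso_phi_def aniso_box_def by (simp only: aniso_scale_nat if_False)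
qed (simp add: aniso_phi_def aniso_box_def)

lemma sum_aniso_phi:
  "m \<le> n \<Longrightarrow> (\<Sum>i=m..n. aniso_phi \<alpha>1 \<alpha>2 \<phi>0 i \<xi>)
     = aniso_box \<alpha>1 \<alpha>2 \<phi>0 n \<xi> - (if m = 0 then 0 else aniso_box \<alpha>1 \<alpha>2 \<phi>0 (m - 1) \<xi>)"
  by (rule sum_telescope_differences[where u = "\<lambda>n. aniso_box \<alpha>1 \<alpha>2 \<phi>0 n \<xi>", OF aniso_phi_eq])

lemma aniso_box_one:
  assumes "aniso_cutoff \<alpha>1 \<alpha>2 \<phi>0" "\<bar>fst \<xi>\<bar> \<le> 2 powr (real n * \<alpha>1)" "\<bar>snd \<xi>\<bar> \<le> 2 powr (real n * \<alpha>2)"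
  shows "aniso_box \<alpha>1 \<alpha>2 \<phi>0 n \<xi> = 1"
proof -
  have "2 powr (- (real n * \<alpha>1)) * \<bar>fst \<xi>\<bar> \<le> 1" "2 powr (- (real n * \<alpha>2)) * \<bar>snd \<xi>\<bar> \<le> 1"
    unfolding powr_scaled_le_iff using assms by simp_all
  then show ?thesis
    using assms(1) unfolding aniso_cutoff_def aniso_box_def by (simp add: abs_mult)
qed

lemma aniso_box_zero:
  assumes "aniso_cutoff \<alpha>1 \<alpha>2 \<phi>0"
    and "2 powr ((real n + 1) * \<alpha>1) \<le> \<bar>fst \<xi>\<bar> \<or> 2 powr ((real n + 1) * \<alpha>2) \<le> \<bar>snd \<xi>\<bar>"
  shows "aniso_box \<alpha>1 \<alpha>2 \<phi>0 n \<xi> = 0"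
proof -
  have *: "1 \<le> 2 powr (- a) * (2 powr (- (real n * a)) * \<bar>x\<bar>) \<longleftrightarrow> 2 powr ((real n + 1) * a) \<le> \<bar>x\<bar>" for a x :: real
  proof -
    have "2 powr (- a) * (2 powr (- (real n * a)) * \<bar>x\<bar>) = 2 powr (- ((real n + 1) * a)) * \<bar>x\<bar>"
      by (simp add: mult.assoc[symmetric] powr_add[symmetric] algebra_simps)
    then show ?thesis by (simp only: powr_scaled_le_iff mult_1)
  qed
  have "1 \<le> max (2 powr (- \<alpha>1) * \<bar>2 powr (- (real n * \<alpha>1)) * fst \<xi>\<bar>) (2 powr (- \<alpha>2) * \<bar>2 powr (- (real n * \<alpha>2)) * snd \<xi>\<bar>)"
    using assms(2) unfolding abs_mult le_max_iff_disj by (simp add: *)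
  then show ?thesis
    using assms(1) unfolding aniso_cutoff_def aniso_box_def by simp
qed

text \<open>Outside the inner box only one of the two coordinates has to be large. This alternative
  is the counterpart of the one between the two lower bounds in \<open>Gamma_iff\<close>.\<close>

lemma aniso_phi_support:
  assumes c: "aniso_cutoff \<alpha>1 \<alpha>2 \<phi>0" and "\<alpha>1 \<ge> 0" "\<alpha>2 \<ge> 0" and nz: "aniso_phi \<alpha>1 \<alpha>2 \<phi>0 j \<xi> \<noteq> 0"
  shows "\<bar>fst \<xi>\<bar> < 2 powr ((real j + 1) * \<alpha>1)" "\<bar>snd \<xi>\<bar> < 2 powr ((real j + 1) * \<alpha>2)"
    and "j \<ge> 1 \<Longrightarrow> 2 powr ((real j - 1) * \<alpha>1) < \<bar>fst \<xi>\<bar> \<or> 2 powr ((real j - 1) * \<alpha>2) < \<bar>snd \<xi>\<bar>"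
proof -
  have mono: "2 powr (x * \<alpha>1) \<le> 2 powr (y * \<alpha>1)" "2 powr (x * \<alpha>2) \<le> 2 powr (y * \<alpha>2)" if "x \<le> y" for x y :: real
    using that assms by (simp_all add: mult_right_mono)
  have "\<not> (2 powr ((real j + 1) * \<alpha>1) \<le> \<bar>fst \<xi>\<bar> \<or> 2 powr ((real j + 1) * \<alpha>2) \<le> \<bar>snd \<xi>\<bar>)"
  proof
    assume l: "2 powr ((real j + 1) * \<alpha>1) \<le> \<bar>fst \<xi>\<bar> \<or> 2 powr ((real j + 1) * \<alpha>2) \<le> \<bar>snd \<xi>\<bar>"
    have le: "real (j - 1) + 1 \<le> real j + 1" by simp
    have "2 powr ((real (j - 1) + 1) * \<alpha>1) \<le> \<bar>fst \<xi>\<bar> \<or> 2 powr ((real (j - 1) + 1) * \<alpha>2) \<le> \<bar>snd \<xi>\<bar>"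
      using l mono[OF le] by linarith
    then have "aniso_phi \<alpha>1 \<alpha>2 \<phi>0 j \<xi> = 0"
      unfolding aniso_phi_eq using aniso_box_zero[OF c l] aniso_box_zero[OF c, of "j - 1" \<xi>] by (cases "j = 0") simp_all
    with nz show False ..
  qed
  then show "\<bar>fst \<xi>\<bar> < 2 powr ((real j + 1) * \<alpha>1)" "\<bar>snd \<xi>\<bar> < 2 powr ((real j + 1) * \<alpha>2)" by linarith+
  show "2 powr ((real j - 1) * \<alpha>1) < \<bar>fst \<xi>\<bar> \<or> 2 powr ((real j - 1) * \<alpha>2) < \<bar>snd \<xi>\<bar>" if "j \<ge> 1"
  proof (rule ccontr)
    assume "\<not> (2 powr ((real j - 1) * \<alpha>1) < \<bar>fst \<xi>\<bar> \<or> 2 powr ((real j - 1) * \<alpha>2) < \<bar>snd \<xi>\<bar>)"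
    then have l: "\<bar>fst \<xi>\<bar> \<le> 2 powr (real (j - 1) * \<alpha>1)" "\<bar>snd \<xi>\<bar> \<le> 2 powr (real (j - 1) * \<alpha>2)"
      using that by (simp_all add: of_nat_diff)
    have le: "real (j - 1) \<le> real j" by simp
    have "\<bar>fst \<xi>\<bar> \<le> 2 powr (real j * \<alpha>1)" "\<bar>snd \<xi>\<bar> \<le> 2 powr (real j * \<alpha>2)"
      using l mono[OF le] by linarith+
    then have "aniso_phi \<alpha>1 \<alpha>2 \<phi>0 j \<xi> = 0"
      unfolding aniso_phi_eq using aniso_box_one[OF c l] aniso_box_one[OF c, of \<xi> j] that by simp
    with nz show False ..
  qed
qed

lemma aniso_phi_schwartz2:
  assumes c: "aniso_cutoff \<alpha>1 \<alpha>2 \<phi>0"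
  shows "(\<lambda>z. complex_of_real (aniso_phi \<alpha>1 \<alpha>2 \<phi>0 j z)) \<in> schwartz2"
proof -
  have S: "(\<lambda>z. complex_of_real (\<phi>0 z)) \<in> schwartz2" using c unfolding aniso_cutoff_def by blast
  have B: "(\<lambda>z. complex_of_real (aniso_box \<alpha>1 \<alpha>2 \<phi>0 n z)) \<in> schwartz2" for n
    unfolding aniso_box_def by (rule schwartz2_dilation[OF S]) simp_all
  show ?thesis
    using B[of 0] schwartz2_diff[OF B[of j] B[of "j - 1"]] unfolding aniso_phi_eq by (cases "j = 0") simp_all
qed

lemma aniso_phi_bounded:
  assumes c: "aniso_cutoff \<alpha>1 \<alpha>2 \<phi>0"
  obtains M where "M > 0" "\<And>j \<xi>. (aniso_phi \<alpha>1 \<alpha>2 \<phi>0 j \<xi>)\<^sup>2 \<le> M"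
proof -
  have S: "(\<lambda>z. complex_of_real (\<phi>0 z)) \<in> schwartz2" and nn: "\<And>z. 0 \<le> \<phi>0 z"
    using c unfolding aniso_cutoff_def by blast+
  obtain C where C: "C \<ge> 0" "\<And>z. cmod (complex_of_real (\<phi>0 z)) \<le> C" using schwartz2_bounded[OF S] by blast
  have b: "0 \<le> aniso_box \<alpha>1 \<alpha>2 \<phi>0 n \<xi>" "aniso_box \<alpha>1 \<alpha>2 \<phi>0 n \<xi> \<le> C + 1" for n \<xi>
  proof -
    show "0 \<le> aniso_box \<alpha>1 \<alpha>2 \<phi>0 n \<xi>" unfolding aniso_box_def by (rule nn)
    have "\<phi>0 z \<le> C + 1" for z using C(2)[of z] by simp
    then show "aniso_box \<alpha>1 \<alpha>2 \<phi>0 n \<xi> \<le> C + 1" unfolding aniso_box_def .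
  qed
  have "\<bar>aniso_phi \<alpha>1 \<alpha>2 \<phi>0 j \<xi>\<bar> \<le> C + 1" for j \<xi>
    unfolding aniso_phi_eq using b[of 0 \<xi>] b[of j \<xi>] b[of "j - 1" \<xi>] by (simp only: split: if_split) linarith
  then have "(aniso_phi \<alpha>1 \<alpha>2 \<phi>0 j \<xi>)\<^sup>2 \<le> (C + 1)\<^sup>2" for j \<xi>
    using power_mono[of "\<bar>aniso_phi \<alpha>1 \<alpha>2 \<phi>0 j \<xi>\<bar>" "C + 1" 2] by simp
  then show ?thesis using that[of "(C + 1)\<^sup>2"] C(1) by simp
qed

text \<open>If \<alpha>1 vanished, the point \<open>(1, 0)\<close> would lie both in the unit box,
  where the cutoff is 1, and in the region where it must be 0; \<open>(0, 1)\<close> does the same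
  for \<alpha>2. Positivity is what makes a finite window width \<open>K\<close> possible.\<close>

lemma aniso_cutoff_pos:
  assumes "admissible \<alpha>1 \<alpha>2" and c: "aniso_cutoff \<alpha>1 \<alpha>2 \<phi>0"
  shows "\<alpha>1 > 0" "\<alpha>2 > 0"
proof -
  have Z: "\<forall>\<xi>. max (2 powr (- \<alpha>1) * \<bar>fst \<xi>\<bar>) (2 powr (- \<alpha>2) * \<bar>snd \<xi>\<bar>) \<ge> 1 \<longrightarrow> \<phi>0 \<xi> = 0"
    using c unfolding aniso_cutoff_def by blast
  have "\<alpha>1 \<noteq> 0"
  proof
    assume 0: "\<alpha>1 = 0"
    have "\<phi>0 (1, 0) = 1" using c unfolding aniso_cutoff_def by simp
    moreover have "\<phi>0 (1, 0) = 0" using Z[rule_format, of "(1, 0)"] 0 by simp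
    ultimately show False by simp
  qed
  moreover have "\<alpha>2 \<noteq> 0"
  proof
    assume 0: "\<alpha>2 = 0"
    have "\<phi>0 (0, 1) = 1" using c unfolding aniso_cutoff_def by simp
    moreover have "\<phi>0 (0, 1) = 0" using Z[rule_format, of "(0, 1)"] 0 by simp
    ultimately show False by simp
  qed
  ultimately show "\<alpha>1 > 0" "\<alpha>2 > 0" using assms(1) unfolding admissible_def by linarith+
qed

text \<open>The three pieces form a rectangle with its lower corner removed: both indices stay below
  the upper edges, and at least one reaches its band. Monotonicity of the integer part puts the low
  ranges below those edges.\<close>

lemma Gamma_iff:
  assumes "\<alpha>1 \<ge> 0" "\<alpha>2 \<ge> 0"
  shows "(j1, j2) \<in> Gamma \<alpha>1 \<alpha>2 j \<longleftrightarrow>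
    int j1 \<le> \<lfloor>real j * \<alpha>1\<rfloor> + 1 \<and> int j2 \<le> \<lfloor>real j * \<alpha>2\<rfloor> + 1 \<and>
    (\<lfloor>(real j - 1) * \<alpha>1\<rfloor> - 1 \<le> int j1 \<or> \<lfloor>(real j - 1) * \<alpha>2\<rfloor> - 1 \<le> int j2)"
proof -
  have "\<lfloor>(real j - 1) * \<alpha>1\<rfloor> \<le> \<lfloor>real j * \<alpha>1\<rfloor>" "\<lfloor>(real j - 1) * \<alpha>2\<rfloor> \<le> \<lfloor>real j * \<alpha>2\<rfloor>"
    using assms by (simp_all add: floor_mono mult_right_mono)
  then show ?thesis
    unfolding Gamma_def Gamma_HL_def Gamma_LH_def Gamma_HH_def by auto
qed

lemma finite_Gamma:
  assumes "\<alpha>1 \<ge> 0" "\<alpha>2 \<ge> 0"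
  shows "finite (Gamma \<alpha>1 \<alpha>2 j)"
proof (rule finite_subset)
  show "Gamma \<alpha>1 \<alpha>2 j \<subseteq> {..nat (\<lfloor>real j * \<alpha>1\<rfloor> + 1)} \<times> {..nat (\<lfloor>real j * \<alpha>2\<rfloor> + 1)}"
  proof (rule subrelI)
    fix j1 j2 assume "(j1, j2) \<in> Gamma \<alpha>1 \<alpha>2 j"
    then show "(j1, j2) \<in> {..nat (\<lfloor>real j * \<alpha>1\<rfloor> + 1)} \<times> {..nat (\<lfloor>real j * \<alpha>2\<rfloor> + 1)}"
      unfolding Gamma_iff[OF assms] by (simp add: le_nat_iff le_nat_iff)
  qed
qed simp

section \<open>Comparison of the two decompositions\<close>

text \<open>For \<open>j \<le> K\<close> truncated subtraction starts the range at 0, where the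
  telescoping sums carry no lower term. Membership is symmetric in the two indices.\<close>

abbreviation nearby :: "nat \<Rightarrow> nat \<Rightarrow> nat set" where
  "nearby K j \<equiv> {j - K..j + K}"

lemma hyp_phi_support_box:
  assumes h: "hyp_cutoff \<theta>0" and nz: "hyp_phi \<theta>0 j1 j2 \<xi> \<noteq> 0"
  shows "\<bar>fst \<xi>\<bar> \<le> 2 powr (real j1 + 1)" "\<bar>snd \<xi>\<bar> \<le> 2 powr (real j2 + 1)"
    "j1 \<ge> 1 \<Longrightarrow> 2 powr (real j1 - 1) < \<bar>fst \<xi>\<bar>" "j2 \<ge> 1 \<Longrightarrow> 2 powr (real j2 - 1) < \<bar>snd \<xi>\<bar>"
  using theta_support[OF h, of j1 "fst \<xi>"] theta_support[OF h, of j2 "snd \<xi>"] nz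
  unfolding hyp_phi_def by simp_all

text \<open>Telescoping leaves two boxes. The upper one is 1 on the support, whose exponents are at
  most \<open>j * \<alpha>1 + 2\<close> and \<open>j * \<alpha>2 + 2\<close>. The lower one vanishes
  because some coordinate has exponent above \<open>(j - 1) * b - 3\<close>, where rounding, the
  margin of \<open>Gamma\<close> and the annulus each cost 1; \<open>K * b \<ge> 3 + b\<close> is
  exactly what this requires.\<close>

lemma sum_aniso_phi_one:
  assumes h: "hyp_cutoff \<theta>0" and c: "aniso_cutoff \<alpha>1 \<alpha>2 \<phi>0" and a: "\<alpha>1 > 0" "\<alpha>2 > 0"
    and K: "real K * \<alpha>1 \<ge> 3 + \<alpha>1" "real K * \<alpha>2 \<ge> 3 + \<alpha>2"
    and G: "(j1, j2) \<in> Gamma \<alpha>1 \<alpha>2 j" and nz: "hyp_phi \<theta>0 j1 j2 \<xi> \<noteq> 0"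
  shows "(\<Sum>l\<in>nearby K j. aniso_phi \<alpha>1 \<alpha>2 \<phi>0 l \<xi>) = 1"
proof -
  note supp = hyp_phi_support_box[OF h nz]
  have G': "int j1 \<le> \<lfloor>real j * \<alpha>1\<rfloor> + 1" "int j2 \<le> \<lfloor>real j * \<alpha>2\<rfloor> + 1"
    "\<lfloor>(real j - 1) * \<alpha>1\<rfloor> - 1 \<le> int j1 \<or> \<lfloor>(real j - 1) * \<alpha>2\<rfloor> - 1 \<le> int j2"
    using G Gamma_iff[of \<alpha>1 \<alpha>2 j1 j2 j] a by simp_all
  have up: "real j1 \<le> real j * \<alpha>1 + 1" "real j2 \<le> real j * \<alpha>2 + 1" using G'(1,2) by linarith+
  have "real j1 + 1 \<le> real (j + K) * \<alpha>1" "real j2 + 1 \<le> real (j + K) * \<alpha>2"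
    using up K a unfolding of_nat_add distrib_right by linarith+
  then have "2 powr (real j1 + 1) \<le> 2 powr (real (j + K) * \<alpha>1)" "2 powr (real j2 + 1) \<le> 2 powr (real (j + K) * \<alpha>2)"
    by simp_all
  with supp(1,2) have one: "aniso_box \<alpha>1 \<alpha>2 \<phi>0 (j + K) \<xi> = 1"
    by (intro aniso_box_one[OF c]) linarith+
  have zero: "aniso_box \<alpha>1 \<alpha>2 \<phi>0 (j - K - 1) \<xi> = 0" if "j - K \<noteq> 0"
  proof (rule aniso_box_zero[OF c])
    have e: "real (j - K - 1) + 1 = real j - real K" using that by (simp add: of_nat_diff)
    have j: "real j \<ge> real K + 1" using that by simp
    have *: "2 powr ((real j - real K) * b) \<le> \<bar>x\<bar>"
      if "\<lfloor>(real j - 1) * b\<rfloor> - 1 \<le> int i" "b > 0" "real K * b \<ge> 3 + b" "i \<ge> 1 \<Longrightarrow> 2 powr (real i - 1) < \<bar>x\<bar>" for i b x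
    proof -
      have l: "real i > (real j - 1) * b - 2" using that(1) by linarith
      have "(real j - 1) * b \<ge> real K * b" using j that(2) by (intro mult_right_mono) simp_all
      \<comment> \<open>The lower edge of the support is available only for positive
        indices.\<close>
      with l that(2,3) have "real i > 1" by linarith
      then have s: "2 powr (real i - 1) < \<bar>x\<bar>" using that(4) by simp
      have "(real j - real K) * b \<le> real i - 1"
        using l that(3) by (simp add: left_diff_distrib)
      then have "2 powr ((real j - real K) * b) \<le> 2 powr (real i - 1)" by simp
      with s show ?thesis by linarith
    qed
    show "2 powr ((real (j - K - 1) + 1) * \<alpha>1) \<le> \<bar>fst \<xi>\<bar> \<or> 2 powr ((real (j - K - 1) + 1) * \<alpha>2) \<le> \<bar>snd \<xi>\<bar>"
      unfolding e using G'(3) *[OF _ a(1) K(1) supp(3)] *[OF _ a(2) K(2) supp(4)] by blast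
  qed
  have "(\<Sum>l\<in>nearby K j. aniso_phi \<alpha>1 \<alpha>2 \<phi>0 l \<xi>)
      = aniso_box \<alpha>1 \<alpha>2 \<phi>0 (j + K) \<xi> - (if j - K = 0 then 0 else aniso_box \<alpha>1 \<alpha>2 \<phi>0 (j - K - 1) \<xi>)"
    by (rule sum_aniso_phi) simp
  then show ?thesis
    unfolding one using zero by (cases "j - K = 0") simp_all
qed

text \<open>The level is found by minimality: \<open>j\<close> is the first level whose upper edges
  contain both indices. At level \<open>j - 1\<close> an edge is exceeded, which puts that index
  into its band at level \<open>j\<close>. Since both supports contain \<xi>, \<open>j\<close> stays
  within \<open>K\<close> of \<open>l\<close>.\<close>

lemma hyp_phi_meets_near_Gamma:
  assumes h: "hyp_cutoff \<theta>0" and c: "aniso_cutoff \<alpha>1 \<alpha>2 \<phi>0" and a: "\<alpha>1 > 0" "\<alpha>2 > 0"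
    and K: "real K * \<alpha>1 \<ge> 3 + \<alpha>1" "real K * \<alpha>2 \<ge> 3 + \<alpha>2"
    and nzl: "aniso_phi \<alpha>1 \<alpha>2 \<phi>0 l \<xi> \<noteq> 0" and nz: "hyp_phi \<theta>0 j1 j2 \<xi> \<noteq> 0"
  shows "\<exists>j\<in>nearby K l. (j1, j2) \<in> Gamma \<alpha>1 \<alpha>2 j"
proof -
  note supp = hyp_phi_support_box[OF h nz] and suppl = aniso_phi_support[OF c less_imp_le[OF a(1)] less_imp_le[OF a(2)] nzl]
  define Q where "Q j \<longleftrightarrow> int j1 \<le> \<lfloor>real j * \<alpha>1\<rfloor> + 1 \<and> int j2 \<le> \<lfloor>real j * \<alpha>2\<rfloor> + 1" for j :: nat
  have *: "int i \<le> \<lfloor>real (l + K) * b\<rfloor> + 1"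
    if "b > 0" "real K * b \<ge> 3 + b" "i \<ge> 1 \<Longrightarrow> 2 powr (real i - 1) < \<bar>x\<bar>" "\<bar>x\<bar> < 2 powr ((real l + 1) * b)" for i b x
  proof (cases "i = 0")
    case True
    have "0 \<le> \<lfloor>real (l + K) * b\<rfloor>" using that(1) by simp
    then show ?thesis using True by simp
  next
    case False
    then have "2 powr (real i - 1) < \<bar>x\<bar>" using that(3) by simp
    also note that(4)
    finally have "real i - 1 < (real l + 1) * b" by simp
    then have "real i \<le> real (l + K) * b" using that(1,2) by (simp add: distrib_right)
    then show ?thesis by linarith
  qed
  have Q: "Q (l + K)"
    unfolding Q_def using *[OF a(1) K(1) supp(3) suppl(1)] *[OF a(2) K(2) supp(4) suppl(2)] by blast
  define j where "j = (LEAST j. Q j)"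
  have Qj: "Q j" unfolding j_def by (rule LeastI[of Q, OF Q])
  have upper: "j \<le> l + K" unfolding j_def by (rule Least_le[of Q, OF Q])
  have lower: "l - K \<le> j"
  proof (cases "l \<le> K")
    case False
    then have l: "l \<ge> 1" by simp
    have **: "real l - real K < real j"
      if "b > 0" "real K * b \<ge> 3 + b" "2 powr ((real l - 1) * b) < \<bar>x\<bar>" "\<bar>x\<bar> \<le> 2 powr (real i + 1)" "int i \<le> \<lfloor>real j * b\<rfloor> + 1" for b x i
    proof -
      have "2 powr ((real l - 1) * b) < 2 powr (real i + 1)" using that(3,4) by linarith
      then have "(real l - 1) * b < real i + 1" by simp
      moreover have "real i \<le> real j * b + 1" using that(5) by linarith
      ultimately have "(real l - real K) * b < real j * b"
        using that(1,2) by (simp add: left_diff_distrib)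
      then show ?thesis using that(1) by simp
    qed
    have "real l - real K < real j"
      using suppl(3)[OF l] **[OF a(1) K(1) _ supp(1)] **[OF a(2) K(2) _ supp(2)] Qj unfolding Q_def by blast
    then show ?thesis by linarith
  qed simp
  have "(j1, j2) \<in> Gamma \<alpha>1 \<alpha>2 j"
  proof -
    have "\<lfloor>(real j - 1) * \<alpha>1\<rfloor> - 1 \<le> int j1 \<or> \<lfloor>(real j - 1) * \<alpha>2\<rfloor> - 1 \<le> int j2"
    \<comment> \<open>At level 0 the lower bound is negative, hence trivially met; separating this
      case also avoids the truncated predecessor of 0.\<close>
    proof (cases "j = 0")
      case True
      have "\<lfloor>- \<alpha>1\<rfloor> - 1 \<le> int j1" using a(1) by linarith
      with True show ?thesis by simp
    next
      case False
      then have "\<not> Q (j - 1)" unfolding j_def using not_less_Least[of "j - 1" Q] by (simp add: j_def)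
      moreover have "real (j - 1) = real j - 1" using False by (simp add: of_nat_diff)
      ultimately have "\<not> (int j1 \<le> \<lfloor>(real j - 1) * \<alpha>1\<rfloor> + 1 \<and> int j2 \<le> \<lfloor>(real j - 1) * \<alpha>2\<rfloor> + 1)"
        unfolding Q_def by (simp only: not_False_eq_True)
      then show ?thesis by auto
    qed
    then show ?thesis using Qj a unfolding Q_def by (simp add: Gamma_iff)
  qed
  with upper lower show ?thesis by auto
qed

text \<open>Indices outside \<open>P\<close> contribute 0 at \<xi>, so the sum may be taken over a
  large square, where it factors into two telescoping sums.\<close>

lemma sum_hyp_phi_one:
  assumes h: "hyp_cutoff \<theta>0" and P: "finite P" and cover: "\<And>j1 j2. hyp_phi \<theta>0 j1 j2 \<xi> \<noteq> 0 \<Longrightarrow> (j1, j2) \<in> P"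
  shows "(\<Sum>p\<in>P. hyp_phi \<theta>0 (fst p) (snd p) \<xi>) = 1"
proof -
  obtain N :: nat where N: "\<bar>fst \<xi>\<bar> \<le> 2 powr real N" "\<bar>snd \<xi>\<bar> \<le> 2 powr real N"
  proof -
    obtain N where "\<bar>fst \<xi>\<bar> + \<bar>snd \<xi>\<bar> < 2 ^ N" using real_arch_pow[of 2] by auto
    then show ?thesis using that[of N] by (simp add: powr_realpow)
  qed
  \<comment> \<open>Large enough both to contain \<open>P\<close> and to reach past both coordinates
    of \<xi>.\<close>
  define N' where "N' = (N + Max (insert 0 (fst ` P \<union> snd ` P)))"
  have sub: "P \<subseteq> {0..N'} \<times> {0..N'}"
  proof
    fix p assume "p \<in> P"
    then have "fst p \<le> Max (insert 0 (fst ` P \<union> snd ` P))" "snd p \<le> Max (insert 0 (fst ` P \<union> snd ` P))"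
      using P by (auto intro!: Max_ge)
    then show "p \<in> {0..N'} \<times> {0..N'}" unfolding N'_def by (simp add: mem_Times_iff)
  qed
  have "2 powr real N \<le> 2 powr real N'" unfolding N'_def by simp
  with N have N'1: "\<bar>fst \<xi>\<bar> \<le> 2 powr real N'" and N'2: "\<bar>snd \<xi>\<bar> \<le> 2 powr real N'" by linarith+
  have "(\<Sum>p\<in>P. hyp_phi \<theta>0 (fst p) (snd p) \<xi>) = (\<Sum>p\<in>{0..N'} \<times> {0..N'}. hyp_phi \<theta>0 (fst p) (snd p) \<xi>)"
  proof (rule sum.mono_neutral_left[OF _ sub])
    show "\<forall>p\<in>{0..N'} \<times> {0..N'} - P. hyp_phi \<theta>0 (fst p) (snd p) \<xi> = 0"
      using cover by (metis DiffD2 prod.collapse)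
  qed simp
  also have "\<dots> = (\<Sum>i=0..N'. theta \<theta>0 i (fst \<xi>)) * (\<Sum>k=0..N'. theta \<theta>0 k (snd \<xi>))"
    unfolding hyp_phi_def sum_product by (simp add: sum.cartesian_product case_prod_unfold)
  also have "\<dots> = 1"
    using hyp_cutoff_scaled(1)[OF h N'1] hyp_cutoff_scaled(1)[OF h N'2] by (simp add: sum_theta)
  finally show ?thesis .
qed

text \<open>Neighbouring sets \<open>Gamma\<close> overlap, so a sum over their union is only
  bounded by the sum counted with multiplicity.\<close>

lemma sum_UNION_le:
  fixes g :: "'b \<Rightarrow> ennreal"
  assumes "finite I" and A: "\<And>i. i \<in> I \<Longrightarrow> finite (A i)"
  shows "(\<Sum>x\<in>(\<Union>i\<in>I. A i). g x) \<le> (\<Sum>i\<in>I. \<Sum>x\<in>A i. g x)"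
  using assms
proof (induction I rule: finite_induct)
  case (insert i I)
  have f: "finite (A i)" "finite (\<Union>i\<in>I. A i)" using insert by simp_all
  have "(\<Sum>x\<in>A i \<union> (\<Union>i\<in>I. A i). g x) \<le> (\<Sum>x\<in>A i. g x) + (\<Sum>x\<in>(\<Union>i\<in>I. A i). g x)"
    unfolding sum.union_inter[OF f, symmetric] by simp
  also have "\<dots> \<le> (\<Sum>x\<in>A i. g x) + (\<Sum>i\<in>I. \<Sum>x\<in>A i. g x)"
    using insert by (intro add_left_mono) simp
  finally show ?case using insert by simp
qed simp

text \<open>There are at most \<open>2 * K + 1\<close> source pieces, so trivial auxiliary cutoffs
  suffice; the many target pieces are controlled by the bounded overlap of the hyperbolic
  cutoffs.\<close>

lemma l2sq_hyp_le_aniso: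
  assumes h: "hyp_cutoff \<theta>0" and c: "aniso_cutoff \<alpha>1 \<alpha>2 \<phi>0" and a: "\<alpha>1 > 0" "\<alpha>2 > 0"
    and K: "real K * \<alpha>1 \<ge> 3 + \<alpha>1" "real K * \<alpha>2 \<ge> 3 + \<alpha>2"
  shows "\<exists>C>0. \<forall>U j. schwartz_linear U \<longrightarrow> (\<Sum>(j1, j2)\<in>Gamma \<alpha>1 \<alpha>2 j. l2sq (dmult (hyp_phi \<theta>0 j1 j2) U))
      \<le> ennreal C * (\<Sum>l\<in>nearby K j. l2sq (dmult (aniso_phi \<alpha>1 \<alpha>2 \<phi>0 l) U))"
proof -
  obtain A where A: "A > 0" "\<And>J t. finite J \<Longrightarrow> (\<Sum>j\<in>J. (theta \<theta>0 j t)\<^sup>2) \<le> A"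
    using theta_square_sums[OF h] by metis
  have fG: "finite (Gamma \<alpha>1 \<alpha>2 j)" for j by (rule finite_Gamma) (use a in simp_all)
  have "(\<Sum>p\<in>Gamma \<alpha>1 \<alpha>2 j. l2sq (dmult (hyp_phi \<theta>0 (fst p) (snd p)) U))
      \<le> ennreal ((A * A) * real (2 * K + 1)) * (\<Sum>l\<in>nearby K j. l2sq (dmult (aniso_phi \<alpha>1 \<alpha>2 \<phi>0 l) U))"
    if U: "schwartz_linear U" for U j
  proof (rule sum_l2sq_dmult_le[OF U, where \<kappa> = "\<lambda>_ _. 1"])
    show "(\<Sum>p\<in>Gamma \<alpha>1 \<alpha>2 j. (hyp_phi \<theta>0 (fst p) (snd p) z)\<^sup>2) \<le> A * A" for z
      unfolding hyp_phi_def by (rule sum_product_le[OF fG A(2) A(2)])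
    show "(\<Sum>l\<in>nearby K j. 1\<^sup>2) \<le> real (2 * K + 1)" by simp
    fix p z assume p: "p \<in> Gamma \<alpha>1 \<alpha>2 j" "hyp_phi \<theta>0 (fst p) (snd p) z \<noteq> 0"
    then show "(\<Sum>l\<in>nearby K j. 1 * aniso_phi \<alpha>1 \<alpha>2 \<phi>0 l z) = 1"
      using sum_aniso_phi_one[OF h c a K, of "fst p" "snd p" j z] by simp
  qed (use A(1) in \<open>simp_all add: fG multiplier_one multiplier_schwartz2 aniso_phi_schwartz2[OF c] hyp_phi_schwartz2[OF h]\<close>)
  then show ?thesis
    using A(1) by (intro exI[of _ "(A * A) * real (2 * K + 1)"]) (simp add: case_prod_unfold)
qed

text \<open>Now there is one target piece but a number of source pieces that grows with
  \<open>l\<close>. Widened cutoffs are 1 on the supports of the narrow ones, hence leave the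
  partition of unity intact, and their square sum stays bounded.\<close>

lemma l2sq_aniso_le_hyp:
  assumes h: "hyp_cutoff \<theta>0" and c: "aniso_cutoff \<alpha>1 \<alpha>2 \<phi>0" and a: "\<alpha>1 > 0" "\<alpha>2 > 0"
    and K: "real K * \<alpha>1 \<ge> 3 + \<alpha>1" "real K * \<alpha>2 \<ge> 3 + \<alpha>2"
  shows "\<exists>C>0. \<forall>U l. schwartz_linear U \<longrightarrow> l2sq (dmult (aniso_phi \<alpha>1 \<alpha>2 \<phi>0 l) U)
      \<le> ennreal C * (\<Sum>j\<in>nearby K l. \<Sum>(j1, j2)\<in>Gamma \<alpha>1 \<alpha>2 j. l2sq (dmult (hyp_phi \<theta>0 j1 j2) U))"
proof -
  obtain A where A: "A > 0" "\<And>J t. finite J \<Longrightarrow> (\<Sum>j\<in>J. (wide_theta \<theta>0 j t)\<^sup>2) \<le> A"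
    using theta_square_sums[OF h] by metis
  obtain M where M: "M > 0" "\<And>j \<xi>. (aniso_phi \<alpha>1 \<alpha>2 \<phi>0 j \<xi>)\<^sup>2 \<le> M" using aniso_phi_bounded[OF c] by blast
  have fG: "finite (Gamma \<alpha>1 \<alpha>2 j)" for j by (rule finite_Gamma) (use a in simp_all)
  have "l2sq (dmult (aniso_phi \<alpha>1 \<alpha>2 \<phi>0 l) U)
      \<le> ennreal (M * (A * A)) * (\<Sum>j\<in>nearby K l. \<Sum>(j1, j2)\<in>Gamma \<alpha>1 \<alpha>2 j. l2sq (dmult (hyp_phi \<theta>0 j1 j2) U))"
    if U: "schwartz_linear U" for U l
  proof -
    define P where "P = (\<Union>j\<in>nearby K l. Gamma \<alpha>1 \<alpha>2 j)"
    have P: "finite P" unfolding P_def using fG by simp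
    have "(\<Sum>k\<in>{l}. l2sq (dmult (aniso_phi \<alpha>1 \<alpha>2 \<phi>0 k) U))
        \<le> ennreal (M * (A * A)) * (\<Sum>p\<in>P. l2sq (dmult (hyp_phi \<theta>0 (fst p) (snd p)) U))"
    proof (rule sum_l2sq_dmult_le[OF U P, where \<kappa> = "wide_hyp_phi \<theta>0"])
      show "(\<Sum>p\<in>P. (wide_hyp_phi \<theta>0 p z)\<^sup>2) \<le> A * A" for z
        unfolding wide_hyp_phi_def by (rule sum_product_le[OF P A(2) A(2)])
      fix k z assume k: "k \<in> {l}" "aniso_phi \<alpha>1 \<alpha>2 \<phi>0 k z \<noteq> 0"
      have "(\<Sum>p\<in>P. wide_hyp_phi \<theta>0 p z * hyp_phi \<theta>0 (fst p) (snd p) z) = (\<Sum>p\<in>P. hyp_phi \<theta>0 (fst p) (snd p) z)"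
      proof (intro sum.cong refl)
        fix p
        show "wide_hyp_phi \<theta>0 p z * hyp_phi \<theta>0 (fst p) (snd p) z = hyp_phi \<theta>0 (fst p) (snd p) z"
          using wide_theta_one[OF h, of "fst p" "fst z"] wide_theta_one[OF h, of "snd p" "snd z"]
          unfolding wide_hyp_phi_def hyp_phi_def
          by (cases "theta \<theta>0 (fst p) (fst z) = 0"; cases "theta \<theta>0 (snd p) (snd z) = 0") simp_all
      qed
      also have "\<dots> = 1"
      proof (rule sum_hyp_phi_one[OF h P])
        fix j1 j2 assume "hyp_phi \<theta>0 j1 j2 z \<noteq> 0"
        from hyp_phi_meets_near_Gamma[OF h c a K _ this, of l] k
        show "(j1, j2) \<in> P" unfolding P_def by simp
      qed
      finally show "(\<Sum>p\<in>P. wide_hyp_phi \<theta>0 p z * hyp_phi \<theta>0 (fst p) (snd p) z) = 1" .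
    qed (use A(1) M in \<open>simp_all add: multiplier_schwartz2 aniso_phi_schwartz2[OF c] hyp_phi_schwartz2[OF h] wide_hyp_phi_schwartz2[OF h]\<close>)
    also have "(\<Sum>p\<in>P. l2sq (dmult (hyp_phi \<theta>0 (fst p) (snd p)) U))
        \<le> (\<Sum>j\<in>nearby K l. \<Sum>p\<in>Gamma \<alpha>1 \<alpha>2 j. l2sq (dmult (hyp_phi \<theta>0 (fst p) (snd p)) U))"
      unfolding P_def by (rule sum_UNION_le) (simp_all add: fG)
    finally show ?thesis by (simp add: case_prod_unfold mult_left_mono)
  qed
  then show ?thesis
    using A(1) M(1) by (intro exI[of _ "M * (A * A)"]) simp
qed

section \<open>Comparable weights and windowed sums\<close>

lemma wt_pos: "0 < wt s \<beta> j"
  unfolding wt_def by simp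

lemma wt_near:
  assumes "j \<in> nearby K l"
  shows "wt s \<beta> j \<le> ((1 + real K) powr (2 * \<bar>\<beta>\<bar>) * 2 powr (2 * real K * \<bar>s\<bar>)) * wt s \<beta> l"
proof -
  \<comment> \<open>\<open>max 1\<close> builds in the convention that powers of \<open>j\<close>
    are 1 at \<open>j = 0\<close>, and makes nearby indices comparable up to the factor
    \<open>1 + K\<close>.\<close>
  define J L where "J = max 1 (real j)" and "L = max 1 (real l)"
  have wt: "wt s \<beta> i = max 1 (real i) powr (- 2 * \<beta>) * 2 powr (2 * real i * s)" for i
    unfolding wt_def by (cases "i = 0") simp_all
  have near: "real j \<le> real l + real K" "real l \<le> real j + real K" using assms by auto
  have JL: "J \<ge> 1" "L \<ge> 1" unfolding J_def L_def by simp_all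
  have "J \<le> L + real K" "L \<le> J + real K" unfolding J_def L_def using near by linarith+
  moreover have "real K * 1 \<le> real K * L" "real K * 1 \<le> real K * J" using JL by (intro mult_left_mono; simp)+
  ultimately have 1: "J \<le> (1 + real K) * L" "L \<le> (1 + real K) * J" unfolding distrib_right by linarith+
  have p: "J powr (- 2 * \<beta>) \<le> (1 + real K) powr (2 * \<bar>\<beta>\<bar>) * L powr (- 2 * \<beta>)"
  \<comment> \<open>The power increases or decreases with the index according to the sign of
    \<beta>, so a different one of the two comparisons of \<open>J\<close> and \<open>L\<close> is
    used in each case.\<close>
  proof (cases "\<beta> \<le> 0")
    case True
    then have "J powr (- 2 * \<beta>) \<le> ((1 + real K) * L) powr (- 2 * \<beta>)"
      using 1 JL by (intro powr_mono2) simp_all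
    also have "\<dots> = (1 + real K) powr (2 * \<bar>\<beta>\<bar>) * L powr (- 2 * \<beta>)"
      using True JL by (simp add: powr_mult)
    finally show ?thesis .
  next
    case False
    then have "L powr (2 * \<beta>) \<le> ((1 + real K) * J) powr (2 * \<beta>)"
      using 1 JL by (intro powr_mono2) simp_all
    also have "\<dots> = (1 + real K) powr (2 * \<beta>) * J powr (2 * \<beta>)"
      using JL by (simp add: powr_mult)
    finally have "inverse (J powr (2 * \<beta>)) \<le> (1 + real K) powr (2 * \<beta>) * inverse (L powr (2 * \<beta>))"
      using JL by (simp add: field_simps)
    then show ?thesis
      using False by (simp add: powr_minus)
  qed
  have "(real j - real l) * s \<le> real K * \<bar>s\<bar>"
  proof -
    have "(real j - real l) * s \<le> \<bar>real j - real l\<bar> * \<bar>s\<bar>" by (metis abs_ge_self abs_mult)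
    also have "\<dots> \<le> real K * \<bar>s\<bar>" using near by (intro mult_right_mono) auto
    finally show ?thesis .
  qed
  then have "2 * real j * s \<le> 2 * real K * \<bar>s\<bar> + 2 * real l * s" by (simp add: left_diff_distrib)
  then have q: "2 powr (2 * real j * s) \<le> 2 powr (2 * real K * \<bar>s\<bar>) * 2 powr (2 * real l * s)"
    unfolding powr_add[symmetric] by simp
  have "wt s \<beta> j \<le> ((1 + real K) powr (2 * \<bar>\<beta>\<bar>) * L powr (- 2 * \<beta>)) * (2 powr (2 * real K * \<bar>s\<bar>) * 2 powr (2 * real l * s))"
    unfolding wt using p q unfolding J_def[symmetric] by (intro mult_mono) simp_all
  also have "\<dots> = ((1 + real K) powr (2 * \<bar>\<beta>\<bar>) * 2 powr (2 * real K * \<bar>s\<bar>)) * wt s \<beta> l"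
    unfolding wt L_def[symmetric] by (simp only: mult_ac)
  finally show ?thesis .
qed

lemma suminf_window_le:
  fixes x :: "nat \<Rightarrow> ennreal"
  shows "(\<Sum>j. \<Sum>l\<in>nearby K j. x l) \<le> of_nat (2 * K + 1) * (\<Sum>l. x l)"
proof -
  \<comment> \<open>The offset \<open>l - j\<close> lies between \<open>-K\<close> and
    \<open>K\<close>; adding \<open>K\<close> makes it a natural number \<open>d\<close>, and terms
    of negative index are set to 0. Each fixed \<open>d\<close> is then a mere shift of the
    sequence.\<close>
  define y where "y d j = (if K \<le> j + d then x (j + d - K) else 0)" for d j
  have shift: "(\<Sum>j. y d j) \<le> (\<Sum>l. x l)" for d
  proof (rule suminf_le_const[OF summableI])
    fix n
    have "(\<Sum>j<n. y d j) = (\<Sum>j\<in>{j. j < n \<and> K \<le> j + d}. x (j + d - K))"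
      unfolding y_def by (rule sum.inter_filter[symmetric, of "{..<n}", simplified])
    also have "\<dots> = (\<Sum>l\<in>(\<lambda>j. j + d - K) ` {j. j < n \<and> K \<le> j + d}. x l)"
      by (subst sum.reindex) (auto simp: inj_on_def)
    also have "\<dots> \<le> (\<Sum>l. x l)"
      by (rule sum_le_suminf[OF summableI]) simp_all
    finally show "(\<Sum>j<n. y d j) \<le> (\<Sum>l. x l)" .
  qed
  have "(\<Sum>l\<in>nearby K j. x l) \<le> (\<Sum>d\<le>2 * K. y d j)" for j
  proof -
    have "(\<Sum>l\<in>nearby K j. x l) = (\<Sum>l\<in>nearby K j. y (l + K - j) j)"
      by (intro sum.cong refl) (auto simp: y_def)
    also have "\<dots> = (\<Sum>d\<in>(\<lambda>l. l + K - j) ` nearby K j. y d j)"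
      by (subst sum.reindex) (auto simp: inj_on_def)
    also have "\<dots> \<le> (\<Sum>d\<le>2 * K. y d j)"
      by (intro sum_mono2) auto
    finally show ?thesis .
  qed
  then have "(\<Sum>j. \<Sum>l\<in>nearby K j. x l) \<le> (\<Sum>j. \<Sum>d\<le>2 * K. y d j)"
    by (intro suminf_le summableI)
  also have "\<dots> = (\<Sum>d\<le>2 * K. \<Sum>j. y d j)"
    by (rule suminf_sum) (rule summableI)
  also have "\<dots> \<le> (\<Sum>d\<le>2 * K. \<Sum>l. x l)"
    by (intro sum_mono shift)
  also have "\<dots> = of_nat (2 * K + 1) * (\<Sum>l. x l)" by simp
  finally show ?thesis .
qed

text \<open>The weight moves inside the window at the cost of \<open>M\<close>, and each index then
  lies in at most \<open>2 * K + 1\<close> windows. Both implications of the equivalence are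
  instances, with the two sequences exchanged.\<close>

lemma weighted_suminf_finite:
  fixes a b :: "nat \<Rightarrow> ennreal" and w :: "nat \<Rightarrow> real"
  assumes le: "\<And>j. a j \<le> ennreal C * (\<Sum>l\<in>nearby K j. b l)"
    and w: "\<And>j l. j \<in> nearby K l \<Longrightarrow> w j \<le> M * w l" and nn: "\<And>j. 0 \<le> w j" "0 \<le> M"
    and fin: "(\<Sum>l. ennreal (w l) * b l) < \<infinity>"
  shows "(\<Sum>j. ennreal (w j) * a j) < \<infinity>"
proof -
  have "ennreal (w j) * a j \<le> ennreal C * ennreal M * (\<Sum>l\<in>nearby K j. ennreal (w l) * b l)" for j
  proof -
    have "ennreal (w j) * a j \<le> ennreal (w j) * (ennreal C * (\<Sum>l\<in>nearby K j. b l))"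
      by (intro mult_left_mono le) simp
    also have "\<dots> = ennreal C * (\<Sum>l\<in>nearby K j. ennreal (w j) * b l)"
      by (simp add: sum_distrib_left mult.left_commute)
    also have "\<dots> \<le> ennreal C * (\<Sum>l\<in>nearby K j. ennreal M * (ennreal (w l) * b l))"
    proof (intro mult_left_mono sum_mono)
      fix l assume "l \<in> nearby K j"
      then have "j \<in> nearby K l" by auto
      from ennreal_leI[OF w[OF this]] have "ennreal (w j) \<le> ennreal M * ennreal (w l)"
        using nn by (simp add: ennreal_mult)
      then show "ennreal (w j) * b l \<le> ennreal M * (ennreal (w l) * b l)"
        unfolding mult.assoc[symmetric] by (rule mult_right_mono) simp
    qed simp
    finally show ?thesis by (simp only: sum_distrib_left[symmetric] mult.assoc)
  qed
  then have "(\<Sum>j. ennreal (w j) * a j) \<le> (\<Sum>j. ennreal C * ennreal M * (\<Sum>l\<in>nearby K j. ennreal (w l) * b l))"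
    by (intro suminf_le summableI)
  also have "\<dots> = ennreal C * ennreal M * (\<Sum>j. \<Sum>l\<in>nearby K j. ennreal (w l) * b l)"
    by (rule ennreal_suminf_cmult)
  also have "\<dots> \<le> ennreal C * ennreal M * (of_nat (2 * K + 1) * (\<Sum>l. ennreal (w l) * b l))"
    by (intro mult_left_mono suminf_window_le) simp
  also have "\<dots> < \<infinity>"
    unfolding ennreal_of_nat_eq_real_of_nat infinity_ennreal_def ennreal_mult_less_top using fin by simp
  finally show ?thesis .
qed

theorem theorem6:
  fixes \<alpha>1 \<alpha>2 s \<beta> :: real
    and f :: distr
    and \<phi>0 :: "real \<times> real \<Rightarrow> real"
    and \<theta>0 :: "real \<Rightarrow> real"
  assumes "admissible \<alpha>1 \<alpha>2"
    and "s > 0"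
    and "tempered f"
    and "aniso_cutoff \<alpha>1 \<alpha>2 \<phi>0"
    and "hyp_cutoff \<theta>0"
  shows "in_besov \<alpha>1 \<alpha>2 \<phi>0 s \<beta> f \<longleftrightarrow>
    ((\<Sum>j. ennreal (wt s \<beta> j) *
           (\<Sum>(j1, j2)\<in>Gamma \<alpha>1 \<alpha>2 j. l2sq (dmult (hyp_phi \<theta>0 j1 j2) (dfourier f))))
     = (\<Sum>j. ennreal (wt s \<beta> j) *
           (\<Sum>(j1, j2)\<in>Gamma \<alpha>1 \<alpha>2 j. l2sq (hyp_Delta \<theta>0 j1 j2 f)))
     \<and> (\<Sum>j. ennreal (wt s \<beta> j) *
           (\<Sum>(j1, j2)\<in>Gamma \<alpha>1 \<alpha>2 j. l2sq (hyp_Delta \<theta>0 j1 j2 f))) < \<infinity>)"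
proof -
  define U where "U = dfourier f"
  have U: "schwartz_linear U"
    unfolding U_def by (intro schwartz_linear_dfourier tempered_imp_linear assms)
  note a = aniso_cutoff_pos[OF assms(1,4)]
  \<comment> \<open>Dividing by the positive \<alpha>_i turns the requirement on \<open>K\<close>
    into a lower bound in each coordinate; their maximum meets both.\<close>
  obtain K1 :: nat where K1: "(3 + \<alpha>1) / \<alpha>1 \<le> real K1" using real_arch_simple by blast
  obtain K2 :: nat where K2: "(3 + \<alpha>2) / \<alpha>2 \<le> real K2" using real_arch_simple by blast
  define K where "K = max K1 K2"
  have "(3 + \<alpha>1) / \<alpha>1 \<le> real K" "(3 + \<alpha>2) / \<alpha>2 \<le> real K" using K1 K2 unfolding K_def by simp_all
  then have K: "real K * \<alpha>1 \<ge> 3 + \<alpha>1" "real K * \<alpha>2 \<ge> 3 + \<alpha>2" using a by (simp_all add: pos_divide_le_eq)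
  define Hy where "Hy j = (\<Sum>(j1, j2)\<in>Gamma \<alpha>1 \<alpha>2 j. l2sq (dmult (hyp_phi \<theta>0 j1 j2) U))" for j
  define An where "An l = l2sq (dmult (aniso_phi \<alpha>1 \<alpha>2 \<phi>0 l) U)" for l
  obtain C1 where C1: "\<And>j. Hy j \<le> ennreal C1 * (\<Sum>l\<in>nearby K j. An l)"
    using l2sq_hyp_le_aniso[OF assms(5,4) a K] U unfolding Hy_def An_def by blast
  obtain C2 where C2: "\<And>l. An l \<le> ennreal C2 * (\<Sum>j\<in>nearby K l. Hy j)"
    using l2sq_aniso_le_hyp[OF assms(5,4) a K] U unfolding Hy_def An_def by blast
  have nn: "0 \<le> wt s \<beta> j" for j by (rule less_imp_le[OF wt_pos])
  define M where "M = (1 + real K) powr (2 * \<bar>\<beta>\<bar>) * 2 powr (2 * real K * \<bar>s\<bar>)"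
  have M: "0 \<le> M" unfolding M_def by simp
  have near: "wt s \<beta> j \<le> M * wt s \<beta> l" if "j \<in> nearby K l" for j l
    unfolding M_def by (rule wt_near[OF that])
  have "(\<Sum>l. ennreal (wt s \<beta> l) * An l) < \<infinity> \<longleftrightarrow> (\<Sum>j. ennreal (wt s \<beta> j) * Hy j) < \<infinity>"
    using weighted_suminf_finite[where w = "wt s \<beta>", OF C1 near nn M]
      weighted_suminf_finite[where w = "wt s \<beta>", OF C2 near nn M] by blast
  \<comment> \<open>Plancherel holds piece by piece, so the two sums in the second condition agree
    term by term, finite or not.\<close>
  moreover have "l2sq (hyp_Delta \<theta>0 j1 j2 f) = l2sq (dmult (hyp_phi \<theta>0 j1 j2) U)" for j1 j2
    unfolding hyp_Delta_def U_def by (rule l2sq_dinv_fourier)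
  moreover have "l2sq (aniso_Delta \<alpha>1 \<alpha>2 \<phi>0 j f) = An j" for j
    unfolding aniso_Delta_def An_def U_def by (rule l2sq_dinv_fourier)
  ultimately show ?thesis
    using assms(3) unfolding in_besov_def U_def[symmetric] by (simp add: Hy_def)
qed

end
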